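(* Let $\gamma$ be an (essential, non-peripheral) simple closed curve on the once-punctured torus $S_{1,1}$. The slope $\tau_\alpha^\gamma/\ell_\alpha^\gamma$ of the associated left earthquake $E_\gamma^{\mathrm{FN}}(\mathbf{u},s)=(\ell_\alpha^\gamma(\mathbf{u},s),\tau_\alpha^\gamma(\mathbf{u},s))$ converges to the inverse of the slope of $\gamma$ for all starting points $\mathbf{u}\in\mathbb{R}_+\times\mathbb{R}$, in the following sense. For $\gamma=\alpha$, $$\frac{\tau_\alpha^\alpha(\mathbf{u},s)}{\ell_\alpha^\alpha(\mathbf{u},s)}\to-\frac{1}{\mathrm{sl}(\alpha)}=-\infty\quad\text{as }s\to\infty,\ \text{for all }\mathbf{u}\in\mathbb{R}_+\times\mathbb{R},$$ and for $\gamma\neq\alpha$, $$\frac{\tau_\alpha^\gamma(\mathbf{u},s)}{\ell_\alpha^\gamma(\mathbf{u},s)}\to\frac{1}{\mathrm{sl}(\gamma)}=\frac{i(\gamma,\beta)}{i(\gamma,\alpha)}\quad\text{as }s\to\infty,\ \text{for all }\mathbf{u}\in\mathbb{R}_+\times\mathbb{R}.$$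
   Context: $\mathbb{R}_+$ denotes the positive reals. $\pi_1(S_{1,1})$ is free on the simple closed curves $\alpha,\beta$ (meridian and longitude). $i(\cdot,\cdot)$ is the (antisymmetric) algebraic intersection number, and the slope of a simple closed curve $\gamma$ is $\mathrm{sl}(\gamma)=i(\gamma,\alpha)/i(\gamma,\beta)\in\mathbb{Q}\cup\{\infty\}$ (independent of the orientation of $\gamma$), with $1/\infty=0$; $\mathrm{sl}(\alpha)=0$, $\mathrm{sl}(\beta)=\infty$. Curves are considered up to isotopy and orientation. Teichm\"uller space is identified with $\mathcal{T}_{\mathrm{tr}}=\{(x,y,z)\in\mathbb{R}_+^3:x^2+y^2+z^2-xyz-2=-2\}$ by the trace coordinates $(x,y,z)=(\mathrm{tr}\,\rho(\alpha),\mathrm{tr}\,\rho(\beta),\mathrm{tr}\,\rho(\alpha\beta))$ of the holonomy $\rho$ (lifted with positive traces). Fenchel–Nielsen coordinates $(\ell_\alpha,\tau_\alpha)\in\mathbb{R}_+\times\mathbb{R}$ for the pants decomposition given by $\alpha$ satisfy $x=2\cosh(\ell_\alpha/2)$ and $y=2\coth(\ell_\alpha/2)\cosh(\tau_\alpha/2)$, with the sign of $\tau_\alpha$ fixed by requiring that the left earthquake about $\alpha$ be $s\mapsto(\ell_\alpha,\tau_\alpha-s)$; equivalently, $z=2\coth(\ell_\alpha/2)\cosh((\tau_\alpha+\ell_\alpha)/2)$. These coordinates identify Teichm\"uller space with $\mathbb{R}_+\times\mathbb{R}$. The left earthquake about a simple closed geodesic $\gamma$ at time $s$ is obtained by cutting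 along $\gamma$, twisting to the left by hyperbolic distance $s$, and regluing. Explicitly, the left earthquake about $\alpha$ in trace coordinates is the flow $E_\alpha^{\mathrm{tr}}$ which in Fenchel–Nielsen coordinates is $(\ell,\tau)\mapsto(\ell,\tau-s)$ (at $s=\ell_\alpha$ it is the left Dehn twist $(x,y,z)\mapsto(x,xy-z,y)$). For general $\gamma$, choose $\delta$ such that $(\gamma,\delta)$ is the image of $(\alpha,\beta)$ under an orientation-preserving mapping class, let $\varphi:\mathcal{T}_{\mathrm{tr}}\to\mathcal{T}_{\mathrm{tr}}$ send $(x,y,z)$ to $(\mathrm{tr}\,\rho(\gamma),\mathrm{tr}\,\rho(\delta),\mathrm{tr}\,\rho(\gamma\delta))$; then the left earthquake about $\gamma$ is $\varphi^{-1}\circ E_\alpha^{\mathrm{tr}}\circ\varphi$. $E_\gamma^{\mathrm{FN}}(\mathbf{u},s)=(\ell_\alpha^\gamma(\mathbf{u},s),\tau_\alpha^\gamma(\mathbf{u},s))$ denotes the Fenchel–Nielsen coordinates (for $\alpha$) of the time-$s$ left earthquake about $\gamma$ starting at the point with Fenchel–Nielsen coordinates $\mathbf{u}$. *)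

theory Defs
  imports
    "HOL-Complex_Analysis.Complex_Analysis"
    "HOL-Algebra.Generated_Groups"
begin

section \<open>The once-punctured torus and its curves\<close>

definition S11 :: "(complex \<times> complex) set" where
  "S11 = (sphere 0 1 \<times> sphere 0 1) - {(1, 1)}"

definition closed_curve :: "(real \<Rightarrow> complex \<times> complex) \<Rightarrow> bool" where
  "closed_curve c \<longleftrightarrow> path c \<and> path_image c \<subseteq> S11 \<and> pathfinish c = pathstart c"

text \<open>Curves are considered up to isotopy and orientation. For essential simple closed curves
  on a surface isotopy is the same relation as free homotopy, which is what is used here.\<close>

definition same_curve :: "(real \<Rightarrow> complex \<times> complex) \<Rightarrow> (real \<Rightarrow> complex \<times> complex) \<Rightarrow> bool" where
  "same_curve c d \<longleftrightarrow> homotopic_loops S11 c d \<or> homotopic_loops S11 c (reversepath d)"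

text \<open>A closed curve is peripheral if it can be pushed into the puncture, that is, freely
  homotoped off every compact subset of the surface.\<close>

definition peripheral :: "(real \<Rightarrow> complex \<times> complex) \<Rightarrow> bool" where
  "peripheral c \<longleftrightarrow>
     (\<forall>K. compact K \<and> K \<subseteq> S11 \<longrightarrow> (\<exists>d. homotopic_loops S11 c d \<and> path_image d \<inter> K = {}))"

definition simple_closed_curve :: "(real \<Rightarrow> complex \<times> complex) \<Rightarrow> bool" where
  "simple_closed_curve c \<longleftrightarrow> closed_curve c \<and> simple_path c
     \<and> \<not> (\<exists>q. homotopic_loops S11 c (\<lambda>_. q)) \<and> \<not> peripheral c"

text \<open>The homology class of a closed curve in the first homology of the torus is given by the
  winding numbers of its two coordinates, and the algebraic intersection number is the
  determinant of the two homology classes. Its values on closed curves are integers.\<close>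

definition intersection_number ::
  "(real \<Rightarrow> complex \<times> complex) \<Rightarrow> (real \<Rightarrow> complex \<times> complex) \<Rightarrow> real" where
  "intersection_number c d =
     Re (winding_number (fst \<circ> c) 0 * winding_number (snd \<circ> d) 0
       - winding_number (snd \<circ> c) 0 * winding_number (fst \<circ> d) 0)"

definition slope :: "(real \<Rightarrow> complex \<times> complex) \<Rightarrow> (real \<Rightarrow> complex \<times> complex) \<Rightarrow>
    (real \<Rightarrow> complex \<times> complex) \<Rightarrow> ereal" where
  "slope \<alpha> \<beta> \<gamma> = (if intersection_number \<gamma> \<beta> = 0 then \<infinity>
     else ereal (intersection_number \<gamma> \<alpha> / intersection_number \<gamma> \<beta>))"

text \<open>Representatives of the mapping classes. A self-homeomorphism of the surface preserves the
  orientation if it preserves algebraic intersection numbers (otherwise it negates them).\<close>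

definition op_homeo :: "(complex \<times> complex \<Rightarrow> complex \<times> complex) \<Rightarrow> bool" where
  "op_homeo f \<longleftrightarrow> (\<exists>g. homeomorphism S11 S11 f g) \<and>
     (\<forall>c d. closed_curve c \<longrightarrow> closed_curve d \<longrightarrow>
        intersection_number (f \<circ> c) (f \<circ> d) = intersection_number c d)"


section \<open>The fundamental group and its free generators\<close>

definition loops_at :: "complex \<times> complex \<Rightarrow> (real \<Rightarrow> complex \<times> complex) set" where
  "loops_at p = {c. closed_curve c \<and> pathstart c = p}"

definition loop_class :: "(real \<Rightarrow> complex \<times> complex) \<Rightarrow> (real \<Rightarrow> complex \<times> complex) set" where
  "loop_class c = {d. homotopic_paths S11 c d}"

definition pi1 :: "complex \<times> complex \<Rightarrow> (real \<Rightarrow> complex \<times> complex) set monoid" where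
  "pi1 p = \<lparr>carrier = loop_class ` loops_at p,
     monoid.mult = (\<lambda>X Y. {e. \<exists>c\<in>X. \<exists>d\<in>Y. homotopic_paths S11 (c +++ d) e}),
     one = loop_class (\<lambda>_. p)\<rparr>"

text \<open>A word is a list of letters \<open>(g, e)\<close>, standing for \<open>g\<close> if \<open>e\<close> holds and for its inverse
  otherwise.\<close>

definition word_value :: "('g, 'm) monoid_scheme \<Rightarrow> ('g \<times> bool) list \<Rightarrow> 'g" where
  "word_value G w =
     foldr (\<lambda>(g, e) h. (if e then g else inv\<^bsub>G\<^esub> g) \<otimes>\<^bsub>G\<^esub> h) w \<one>\<^bsub>G\<^esub>"

definition reduced_word :: "('g \<times> bool) list \<Rightarrow> bool" where
  "reduced_word w \<longleftrightarrow> (\<forall>i. Suc i < length w \<longrightarrow>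
     \<not> (fst (w ! i) = fst (w ! Suc i) \<and> snd (w ! i) \<noteq> snd (w ! Suc i)))"

definition free_on :: "('g, 'm) monoid_scheme \<Rightarrow> 'g set \<Rightarrow> bool" where
  "free_on G X \<longleftrightarrow> X \<subseteq> carrier G \<and> generate G X = carrier G \<and>
     (\<forall>w. set w \<subseteq> X \<times> UNIV \<and> w \<noteq> [] \<and> reduced_word w \<longrightarrow> word_value G w \<noteq> \<one>\<^bsub>G\<^esub>)"

text \<open>Two simple closed curves meeting exactly once, at the base point, which freely generate
  the fundamental group. The standard instance is given by the two coordinate circles through
  a point \<open>(a, b)\<close> with \<open>a \<noteq> 1\<close> and \<open>b \<noteq> 1\<close>.\<close>

definition meridian_longitude ::
  "complex \<times> complex \<Rightarrow> (real \<Rightarrow> complex \<times> complex) \<Rightarrow> (real \<Rightarrow> complex \<times> complex) \<Rightarrow> bool" where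
  "meridian_longitude p \<alpha> \<beta> \<longleftrightarrow>
     simple_closed_curve \<alpha> \<and> simple_closed_curve \<beta> \<and> \<alpha> \<in> loops_at p \<and> \<beta> \<in> loops_at p \<and>
     path_image \<alpha> \<inter> path_image \<beta> = {p} \<and>
     loop_class \<alpha> \<noteq> loop_class \<beta> \<and> free_on (pi1 p) {loop_class \<alpha>, loop_class \<beta>}"


section \<open>Trace coordinates and Fenchel--Nielsen coordinates\<close>

definition T_tr :: "(real \<times> real \<times> real) set" where
  "T_tr = {(x, y, z). 0 < x \<and> 0 < y \<and> 0 < z \<and> x\<^sup>2 + y\<^sup>2 + z\<^sup>2 - x * y * z - 2 = -2}"

definition FN_space :: "(real \<times> real) set" where
  "FN_space = {0<..} \<times> UNIV"

definition SL2R :: "(real^2^2) monoid" where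
  "SL2R = \<lparr>carrier = {A. det A = 1}, monoid.mult = (**), one = mat 1\<rparr>"

text \<open>The lifted holonomy of the point of Teichmueller space with the given trace coordinates.
  For points of \<^const>\<open>T_tr\<close> it is determined by the coordinates up to conjugation (by matrices of
  determinant \<open>\<plusminus>1\<close>), so that all its traces are determined.\<close>

definition holonomy :: "complex \<times> complex \<Rightarrow> (real \<Rightarrow> complex \<times> complex) \<Rightarrow>
    (real \<Rightarrow> complex \<times> complex) \<Rightarrow> real \<times> real \<times> real \<Rightarrow>
    ((real \<Rightarrow> complex \<times> complex) set \<Rightarrow> real^2^2) \<Rightarrow> bool" where
  "holonomy p \<alpha> \<beta> X \<rho> \<longleftrightarrow> \<rho> \<in> hom (pi1 p) SL2R \<and>
     (trace (\<rho> (loop_class \<alpha>)), trace (\<rho> (loop_class \<beta>)), trace (\<rho> (loop_class (\<alpha> +++ \<beta>)))) = X"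

text \<open>The trace of the holonomy along a closed curve that need not pass through the base point;
  the curve is joined to the base point by an arbitrary path \<open>k\<close>.\<close>

definition curve_trace :: "complex \<times> complex \<Rightarrow> (real \<Rightarrow> complex \<times> complex) \<Rightarrow>
    (real \<Rightarrow> complex \<times> complex) \<Rightarrow> real \<times> real \<times> real \<Rightarrow> (real \<Rightarrow> complex \<times> complex) \<Rightarrow> real" where
  "curve_trace p \<alpha> \<beta> X c = (THE t. \<exists>\<rho> k. holonomy p \<alpha> \<beta> X \<rho> \<and>
     path k \<and> path_image k \<subseteq> S11 \<and> pathstart k = p \<and> pathfinish k = pathstart c \<and>
     t = trace (\<rho> (loop_class (k +++ c +++ reversepath k))))"

definition FN_to_tr :: "real \<times> real \<Rightarrow> real \<times> real \<times> real" where
  "FN_to_tr = (\<lambda>(l, \<tau>). let coth = cosh (l / 2) / sinh (l / 2) in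
     (2 * cosh (l / 2), 2 * coth * cosh (\<tau> / 2), 2 * coth * cosh ((\<tau> + l) / 2)))"

definition tr_to_FN :: "real \<times> real \<times> real \<Rightarrow> real \<times> real" where
  "tr_to_FN = inv_into FN_space FN_to_tr"


section \<open>Left earthquakes\<close>

definition earthquake_alpha_tr :: "real \<times> real \<times> real \<Rightarrow> real \<Rightarrow> real \<times> real \<times> real" where
  "earthquake_alpha_tr X s = (let (l, \<tau>) = tr_to_FN X in FN_to_tr (l, \<tau> - s))"

definition trace_change :: "complex \<times> complex \<Rightarrow> (real \<Rightarrow> complex \<times> complex) \<Rightarrow>
    (real \<Rightarrow> complex \<times> complex) \<Rightarrow> (real \<Rightarrow> complex \<times> complex) \<Rightarrow> (real \<Rightarrow> complex \<times> complex) \<Rightarrow>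
    real \<times> real \<times> real \<Rightarrow> real \<times> real \<times> real" where
  "trace_change p \<alpha> \<beta> \<gamma> \<delta> X =
     (curve_trace p \<alpha> \<beta> X \<gamma>, curve_trace p \<alpha> \<beta> X \<delta>, curve_trace p \<alpha> \<beta> X (\<gamma> +++ \<delta>))"

text \<open>For loops \<open>\<gamma>\<close>, \<open>\<delta>\<close> with a common base point: conjugate the earthquake about \<open>\<alpha>\<close> by the
  change of trace coordinates from \<open>(\<alpha>, \<beta>)\<close> to \<open>(\<gamma>, \<delta>)\<close>.\<close>

definition earthquake_tr :: "complex \<times> complex \<Rightarrow> (real \<Rightarrow> complex \<times> complex) \<Rightarrow>
    (real \<Rightarrow> complex \<times> complex) \<Rightarrow> (real \<Rightarrow> complex \<times> complex) \<Rightarrow> (real \<Rightarrow> complex \<times> complex) \<Rightarrow>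
    real \<times> real \<times> real \<Rightarrow> real \<Rightarrow> real \<times> real \<times> real" where
  "earthquake_tr p \<alpha> \<beta> \<gamma> \<delta> X s =
     (let \<phi> = trace_change p \<alpha> \<beta> \<gamma> \<delta> in inv_into T_tr \<phi> (earthquake_alpha_tr (\<phi> X) s))"

text \<open>\<open>E\<close> is the left earthquake about \<open>\<gamma>\<close> in Fenchel--Nielsen coordinates for \<open>\<alpha>\<close>. The pair
  \<open>(f \<circ> \<alpha>, f \<circ> \<beta>)\<close> plays the role of \<open>(\<gamma>, \<delta>)\<close>; the first curve has to represent \<open>\<gamma>\<close> only up to
  isotopy and orientation. The flow does not depend on the choice of \<open>f\<close>.\<close>

definition left_earthquake_FN :: "complex \<times> complex \<Rightarrow> (real \<Rightarrow> complex \<times> complex) \<Rightarrow>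
    (real \<Rightarrow> complex \<times> complex) \<Rightarrow> (real \<Rightarrow> complex \<times> complex) \<Rightarrow>
    (real \<times> real \<Rightarrow> real \<Rightarrow> real \<times> real) \<Rightarrow> bool" where
  "left_earthquake_FN p \<alpha> \<beta> \<gamma> E \<longleftrightarrow> (\<exists>f. op_homeo f \<and> same_curve (f \<circ> \<alpha>) \<gamma> \<and>
     (\<forall>u\<in>FN_space. \<forall>s.
        E u s = tr_to_FN (earthquake_tr p \<alpha> \<beta> (f \<circ> \<alpha>) (f \<circ> \<beta>) (FN_to_tr u) s)))"

end

theory Submission
  imports Defs "HOL-Algebra.Elementary_Groups"
begin

text \<open>
  Everything is expressed through traces of representations of the free group \<open>\<pi>\<^sub>1\<close> on \<open>\<alpha>\<close>, \<open>\<beta>\<close>. Let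
  \<open>w1\<close>, \<open>w2\<close> be the images of \<open>\<alpha>\<close>, \<open>\<beta>\<close> under the mapping class that carries \<open>\<alpha>\<close> to \<open>\<gamma>\<close>. Along the
  earthquake about \<open>\<gamma>\<close> the traces of \<open>w1\<close>, \<open>w2\<close> and \<open>w1 w2\<close> are explicit: the first is constant, the other two
  grow as \<open>exp (s / 2)\<close>. The Fenchel--Nielsen coordinates for \<open>\<alpha>\<close> are read off from the traces of
  \<open>\<alpha>\<close>, \<open>\<beta>\<close> and \<open>\<alpha> \<beta>\<close>, so the growth has to be transported from one basis of the free group to the other.

  By Nielsen's theorem (\<open>nielsen_theorem\<close>) the two bases are connected by elementary moves. A move creates one new
  trace, \<open>tr (u v)\<close> from \<open>tr (u\<^sup>-\<^sup>1 v)\<close> or conversely, and on the Teichmueller space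
  \<open>tr (u v) tr (u\<^sup>-\<^sup>1 v) = tr(u)\<^sup>2 + tr(v)\<^sup>2\<close>. All terms are positive, so no cancellation can hide a leading term:
  the growth rate of a primitive element with homology class \<open>m w1 + n w2\<close> is \<open>\<bar>n\<bar> / 2\<close>, because
  \<open>2 max(\<bar>n\<bar>, \<bar>n'\<bar>) = \<bar>n + n'\<bar> + \<bar>n - n'\<bar>\<close>, and even the leading coefficient is an explicit function of \<open>m\<close> and \<open>n\<close>
  (\<open>nielsen_growth\<close>). The number \<open>n\<close> is, up to sign, the intersection number with \<open>\<gamma>\<close>.

  If \<open>i(\<gamma>, \<alpha>) \<noteq> 0\<close>, then \<open>l / s\<close>, \<open>\<bar>\<tau>\<bar> / s\<close> and \<open>\<bar>\<tau> + l\<bar> / s\<close> tend to the moduli of \<open>i(\<gamma>, \<alpha>)\<close>, \<open>i(\<gamma>, \<beta>)\<close> and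
  their sum, up to a common normalisation. So the moduli of \<open>\<tau> / l\<close> and of \<open>\<tau> / l + 1\<close> have the limits of the claim, and they
  determine \<open>\<tau> / l\<close> (\<open>slope_limit\<close>). If \<open>i(\<gamma>, \<alpha>) = 0\<close>, then \<open>l\<close> converges to a positive number while \<open>\<bar>\<tau>\<bar>\<close> tends to
  infinity, and the leading coefficients, which know the orientation, show that \<open>\<tau>\<close> is negative
  (\<open>slope_limit_infinite\<close>).

  It remains to match the two cases with the two cases of the theorem: a simple closed curve with \<open>i(\<gamma>, \<alpha>) = 0\<close> is
  isotopic to \<open>\<alpha>\<close> up to orientation. Every basis of the free group is, up to conjugation and inversion, a pair of words in which
  each of the two letters occurs with one sign only, so that a primitive element with vanishing exponent sum in
  \<open>\<beta>\<close> does not contain \<open>\<beta>\<close> (\<open>primitive_conj_generator\<close>).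

  The change of trace coordinates is well defined by Fricke's theorem that three traces determine all others
  (\<open>trace_determined\<close>), and surjective because all trace coordinates are realised by matrices
  (\<open>earthquake_representations\<close>). The topological input is that a homeomorphism induces a surjection of
  fundamental groups and that winding numbers give homology classes.
\<close>

section \<open>Words and free groups\<close>

definition flip_letter :: "'g \<times> bool \<Rightarrow> 'g \<times> bool" where
  "flip_letter l = (fst l, \<not> snd l)"

definition inv_word :: "('g \<times> bool) list \<Rightarrow> ('g \<times> bool) list" where
  "inv_word w = rev (map flip_letter w)"

definition letter_value :: "('g, 'm) monoid_scheme \<Rightarrow> 'g \<times> bool \<Rightarrow> 'g" where
  "letter_value G l = (if snd l then fst l else inv\<^bsub>G\<^esub> (fst l))"

lemma flip_flip [simp]: "flip_letter (flip_letter l) = l"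
  by (simp add: flip_letter_def)

lemma flip_neq [simp]: "flip_letter l \<noteq> l" "l \<noteq> flip_letter l"
  by (auto simp: flip_letter_def prod_eq_iff)

lemma flip_eq_iff: "flip_letter k = l \<longleftrightarrow> k = flip_letter l"
  by (auto simp: flip_letter_def)

lemma flip_inj [simp]: "flip_letter k = flip_letter l \<longleftrightarrow> k = l"
  by (auto simp: flip_letter_def prod_eq_iff)

lemma flip_mem [simp]: "flip_letter l \<in> X \<times> UNIV \<longleftrightarrow> l \<in> X \<times> UNIV"
  by (cases l) (auto simp: flip_letter_def)

lemma inv_word_simps [simp]:
  "inv_word [] = []" "inv_word (l # w) = inv_word w @ [flip_letter l]"
  "inv_word (v @ w) = inv_word w @ inv_word v" "length (inv_word w) = length w"
  "inv_word (inv_word w) = w" "inv_word w = [] \<longleftrightarrow> w = []"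
  by (auto simp: inv_word_def rev_map map_idI)

lemma inv_word_nth: "i < length w \<Longrightarrow> inv_word w ! i = flip_letter (w ! (length w - Suc i))"
  by (simp add: inv_word_def rev_nth)

lemma set_inv_word [simp]: "set (inv_word w) \<subseteq> X \<times> UNIV \<longleftrightarrow> set w \<subseteq> X \<times> UNIV"
proof -
  have "set (inv_word w) = flip_letter ` set w" by (simp add: inv_word_def)
  then show ?thesis by (auto simp: flip_letter_def)
qed

lemma reduced_word_altdef: "reduced_word w \<longleftrightarrow> successively (\<lambda>x y. y \<noteq> flip_letter x) w"
  unfolding reduced_word_def successively_conv_nth flip_letter_def prod_eq_iff by auto

lemma reduced_word_Nil [simp]: "reduced_word []"
  by (simp add: reduced_word_altdef)

lemma reduced_word_Cons:
  "reduced_word (l # w) \<longleftrightarrow> reduced_word w \<and> (w \<noteq> [] \<longrightarrow> hd w \<noteq> flip_letter l)"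
  by (auto simp: reduced_word_altdef successively_Cons)

lemma reduced_word_append:
  "reduced_word (v @ w) \<longleftrightarrow>
     reduced_word v \<and> reduced_word w \<and> (v \<noteq> [] \<and> w \<noteq> [] \<longrightarrow> hd w \<noteq> flip_letter (last v))"
  by (auto simp: reduced_word_altdef successively_append_iff)

lemma reduced_inv_word [simp]: "reduced_word (inv_word w) \<longleftrightarrow> reduced_word w"
  unfolding reduced_word_altdef inv_word_def successively_rev successively_map
  by (intro arg_cong2[where f = successively] ext) (auto simp: flip_eq_iff)

fun cons_reduced :: "'g \<times> bool \<Rightarrow> ('g \<times> bool) list \<Rightarrow> ('g \<times> bool) list" where
  "cons_reduced l [] = [l]"
| "cons_reduced l (k # w) = (if k = flip_letter l then w else l # k # w)"

definition free_reduce :: "('g \<times> bool) list \<Rightarrow> ('g \<times> bool) list" where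
  "free_reduce w = foldr cons_reduced w []"

lemma free_reduce_simps [simp]:
  "free_reduce [] = []" "free_reduce (l # w) = cons_reduced l (free_reduce w)"
  by (simp_all add: free_reduce_def)

lemma reduced_cons_reduced: "reduced_word w \<Longrightarrow> reduced_word (cons_reduced l w)"
  by (cases w) (auto simp: reduced_word_Cons)

lemma reduced_free_reduce [simp]: "reduced_word (free_reduce w)"
  by (induction w) (auto simp: reduced_cons_reduced)

lemma set_free_reduce: "set (free_reduce w) \<subseteq> set w"
proof (induction w)
  case (Cons l w)
  then show ?case by (cases "free_reduce w") auto
qed simp

context group
begin

lemma word_value_simps [simp]:
  "word_value G [] = \<one>" "word_value G (l # w) = letter_value G l \<otimes> word_value G w"
  by (auto simp: word_value_def letter_value_def split: prod.splits)

lemma letter_value_closed [simp]: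
  "l \<in> X \<times> UNIV \<Longrightarrow> X \<subseteq> carrier G \<Longrightarrow> letter_value G l \<in> carrier G"
  by (auto simp: letter_value_def)

lemma word_value_closed [simp]:
  "set w \<subseteq> X \<times> UNIV \<Longrightarrow> X \<subseteq> carrier G \<Longrightarrow> word_value G w \<in> carrier G"
  by (induction w) (auto intro!: m_closed letter_value_closed[of _ X])

lemma word_value_append:
  assumes "set v \<subseteq> X \<times> UNIV" "set w \<subseteq> X \<times> UNIV" "X \<subseteq> carrier G"
  shows "word_value G (v @ w) = word_value G v \<otimes> word_value G w"
  using assms
proof (induction v)
  case (Cons l v)
  then have "letter_value G l \<in> carrier G" "word_value G v \<in> carrier G" "word_value G w \<in> carrier G"
    by (auto intro: letter_value_closed[of _ X] word_value_closed[of _ X])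
  with Cons show ?case by (simp add: m_assoc)
qed (auto intro: word_value_closed)

lemma letter_value_flip:
  "l \<in> X \<times> UNIV \<Longrightarrow> X \<subseteq> carrier G \<Longrightarrow> letter_value G (flip_letter l) = inv (letter_value G l)"
  by (auto simp: letter_value_def flip_letter_def)

lemma word_value_inv_word:
  assumes "set w \<subseteq> X \<times> UNIV" "X \<subseteq> carrier G"
  shows "word_value G (inv_word w) = inv (word_value G w)"
  using assms
proof (induction w)
  case (Cons l w)
  then have l: "letter_value G l \<in> carrier G" "word_value G w \<in> carrier G"
    by (auto intro: letter_value_closed[of _ X] word_value_closed[of _ X])
  have "word_value G (inv_word (l # w)) = word_value G (inv_word w) \<otimes> word_value G [flip_letter l]"
    using Cons.prems word_value_append[of "inv_word w" X "[flip_letter l]"]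
    by (simp del: word_value_simps)
  also have "\<dots> = inv (word_value G w) \<otimes> inv (letter_value G l)"
    using Cons l letter_value_flip[of l X] by auto
  finally show ?case using l by (simp add: inv_mult_group)
qed auto

text \<open>Cancelling adjacent inverse letters is compatible with every evaluation of the letters in
  every group, which is why free reduction decides equality in a free group.\<close>

lemma word_value_free_reduce:
  assumes "set w \<subseteq> X \<times> UNIV" "\<sigma> \<in> X \<rightarrow> carrier G"
  shows "word_value G (map (apfst \<sigma>) (free_reduce w)) = word_value G (map (apfst \<sigma>) w)"
  using assms
proof (induction w)
  case (Cons l w)
  let ?v = "\<lambda>l. letter_value G (apfst \<sigma> l)"
  have l: "?v l \<in> carrier G"
    using Cons.prems by (cases l) (auto simp: letter_value_def Pi_def)
  have cl: "word_value G (map (apfst \<sigma>) w) \<in> carrier G" if "set w \<subseteq> X \<times> UNIV" for w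
    using that Cons.prems by (intro word_value_closed[of _ "\<sigma> ` X"]) auto
  show ?case
  proof (cases "free_reduce w")
    case Nil
    then show ?thesis using Cons by auto
  next
    case (Cons k u)
    have su: "set u \<subseteq> X \<times> UNIV"
      using set_free_reduce[of w] Cons Cons.prems by auto
    have IH: "?v k \<otimes> word_value G (map (apfst \<sigma>) u) = word_value G (map (apfst \<sigma>) w)"
      using Cons Cons.IH Cons.prems by auto
    show ?thesis
    proof (cases "k = flip_letter l")
      case True
      then have "?v k = inv (?v l)"
        using Cons.prems by (cases l) (auto simp: letter_value_def flip_letter_def Pi_def)
      then show ?thesis
        using Cons True IH l cl[OF su] by (auto simp flip: IH m_assoc)
    next
      case False
      then show ?thesis using Cons IH by auto
    qed
  qed
qed auto

lemma word_value_free_reduce_self: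
  assumes "set w \<subseteq> X \<times> UNIV" "X \<subseteq> carrier G"
  shows "word_value G (free_reduce w) = word_value G w"
proof -
  have "map (apfst (\<lambda>x. x)) v = v" for v :: "('a \<times> bool) list"
    by (induction v) auto
  with word_value_free_reduce[of w X "\<lambda>x. x"] assms show ?thesis by (auto simp: Pi_def)
qed

lemma generate_reduced_word:
  assumes "X \<subseteq> carrier G" "g \<in> generate G X"
  shows "\<exists>w. set w \<subseteq> X \<times> UNIV \<and> reduced_word w \<and> word_value G w = g"
proof -
  have "\<exists>w. set w \<subseteq> X \<times> UNIV \<and> word_value G w = g"
    using assms(2)
  proof (induction rule: generate.induct)
    case one
    then show ?case by (intro exI[of _ "[]"]) auto
  next
    case (incl h)
    then show ?case using assms(1) by (intro exI[of _ "[(h, True)]"]) (auto simp: letter_value_def)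
  next
    case (inv h)
    then show ?case using assms(1) by (intro exI[of _ "[(h, False)]"]) (auto simp: letter_value_def)
  next
    case (eng h1 h2)
    then obtain w1 w2 where "set w1 \<subseteq> X \<times> UNIV" "word_value G w1 = h1"
        "set w2 \<subseteq> X \<times> UNIV" "word_value G w2 = h2" by auto
    then show ?case using word_value_append[of w1 X w2] assms(1)
      by (intro exI[of _ "w1 @ w2"]) auto
  qed
  then obtain w where w: "set w \<subseteq> X \<times> UNIV" "word_value G w = g" by auto
  then have "word_value G (free_reduce w) = g"
    using word_value_free_reduce_self assms(1) by simp
  with w set_free_reduce[of w] show ?thesis
    by (intro exI[of _ "free_reduce w"]) auto
qed

end

text \<open>The length of the longest common prefix. For the normal forms of \<open>g\<close> and \<open>h\<close> it is the number
  of letters of each that cancel in \<open>g\<^sup>-\<^sup>1 h\<close>.\<close>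

fun agree :: "'a list \<Rightarrow> 'a list \<Rightarrow> nat" where
  "agree (x # xs) (y # ys) = (if x = y then Suc (agree xs ys) else 0)"
| "agree _ _ = 0"

lemma agree_le: "agree xs ys \<le> length xs" "agree xs ys \<le> length ys"
  by (induction xs ys rule: agree.induct) auto

lemma agree_commute: "agree xs ys = agree ys xs"
  by (induction xs ys rule: agree.induct) auto

lemma take_agree: "k \<le> agree xs ys \<Longrightarrow> take k xs = take k ys"
proof (induction xs ys arbitrary: k rule: agree.induct)
  case (1 x xs y ys)
  then show ?case by (cases k) (auto split: if_splits)
qed auto

lemma agree_ge:
  "take k xs = take k ys \<Longrightarrow> k \<le> length xs \<Longrightarrow> k \<le> length ys \<Longrightarrow> k \<le> agree xs ys"
proof (induction xs ys arbitrary: k rule: agree.induct)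
  case (1 x xs y ys)
  then show ?case by (cases k) auto
qed auto

lemma hd_drop_agree:
  "drop (agree xs ys) xs \<noteq> [] \<Longrightarrow> drop (agree xs ys) ys \<noteq> [] \<Longrightarrow>
   hd (drop (agree xs ys) xs) \<noteq> hd (drop (agree xs ys) ys)"
  by (induction xs ys rule: agree.induct) auto

lemma agree_prefix:
  "take k ys = take k zs \<Longrightarrow> k \<le> length ys \<Longrightarrow> k \<le> length zs \<Longrightarrow> agree xs ys < k \<Longrightarrow> agree xs zs = agree xs ys"
proof (induction xs ys arbitrary: k zs rule: agree.induct)
  case (1 x xs y ys)
  obtain k' where k: "k = Suc k'" using "1.prems"(4) by (cases k) auto
  obtain z zs' where zs: "zs = z # zs'" using "1.prems"(3) k by (cases zs) auto
  show ?case
  proof (cases "x = y")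
    case True
    have "agree xs zs' = agree xs ys"
      using "1.prems" True by (intro "1.IH"[OF True, of k']) (simp_all add: k zs)
    then show ?thesis using "1.prems"(1) True by (simp add: k zs)
  qed (use "1.prems"(1) in \<open>simp add: k zs\<close>)
next
  case ("2_1" ys)
  show ?case by (cases zs) auto
qed (case_tac zs, auto)

text \<open>A nonempty reduced word shares less than half of its letters with its inverse: the middle
  letter would be its own inverse, or the two middle letters would cancel.\<close>

lemma agree_inv_word_less:
  assumes "reduced_word w" "w \<noteq> []"
  shows "2 * agree w (inv_word w) < length w"
proof (rule ccontr)
  assume *: "\<not> ?thesis"
  define j where "j = (length w - 1) div 2"
  have len: "length w > 0" using assms(2) by simp
  have j: "j < agree w (inv_word w)" "j < length w" using * len unfolding j_def by linarith+
  have "take (Suc j) w = take (Suc j) (inv_word w)" using j by (intro take_agree) auto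
  then have "w ! j = inv_word w ! j" by (metis lessI nth_take)
  then have eq: "w ! j = flip_letter (w ! (length w - Suc j))" using j by (simp add: inv_word_nth)
  show False
  proof (cases "even (length w)")
    case True
    then have "length w - Suc j = Suc j" using len unfolding j_def by presburger
    then have "w ! Suc j = flip_letter (w ! j)" "Suc j < length w" using eq j by auto
    then show False using assms(1) by (auto simp: reduced_word_altdef successively_conv_nth)
  next
    case False
    then have "length w - Suc j = j" using len unfolding j_def by presburger
    with eq show False by simp
  qed
qed

locale free_group = group +
  fixes X
  assumes free: "free_on G X"
begin

lemma X_closed: "X \<subseteq> carrier G" and gen: "generate G X = carrier G"
  using free by (auto simp: free_on_def)

lemma reduced_nontrivial:
  "set w \<subseteq> X \<times> UNIV \<Longrightarrow> reduced_word w \<Longrightarrow> word_value G w = \<one> \<Longrightarrow> w = []"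
  using free by (auto simp: free_on_def)

definition nf :: "'a \<Rightarrow> ('a \<times> bool) list" where
  "nf g = (SOME w. set w \<subseteq> X \<times> UNIV \<and> reduced_word w \<and> word_value G w = g)"

abbreviation "len g \<equiv> length (nf g)"

lemma nf:
  assumes "g \<in> carrier G"
  shows "set (nf g) \<subseteq> X \<times> UNIV" "reduced_word (nf g)" "word_value G (nf g) = g"
proof -
  have "\<exists>w. set w \<subseteq> X \<times> UNIV \<and> reduced_word w \<and> word_value G w = g"
    using generate_reduced_word[OF X_closed] assms gen by auto
  from someI_ex[OF this] show "set (nf g) \<subseteq> X \<times> UNIV" "reduced_word (nf g)" "word_value G (nf g) = g"
    unfolding nf_def by auto
qed

text \<open>After the common prefix is removed, the two words start with different letters, so nothing cancels
  any more.\<close>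

lemma nf_div_aux:
  fixes v w
  defines "c \<equiv> agree v w"
  assumes v: "set v \<subseteq> X \<times> UNIV" "reduced_word v" and w: "set w \<subseteq> X \<times> UNIV" "reduced_word w"
  defines "u \<equiv> inv_word (drop c v) @ drop c w"
  shows "set u \<subseteq> X \<times> UNIV" "reduced_word u"
    "word_value G u = inv (word_value G v) \<otimes> word_value G w"
proof -
  have dv: "set (drop c v) \<subseteq> X \<times> UNIV" "set (drop c w) \<subseteq> X \<times> UNIV" "set (take c w) \<subseteq> X \<times> UNIV"
    using v(1) w(1) set_drop_subset set_take_subset by (meson subset_trans)+
  show "set u \<subseteq> X \<times> UNIV" unfolding u_def using dv by simp
  have red: "reduced_word (drop c v)" "reduced_word (drop c w)"
    using v(2) w(2) reduced_word_append[of "take c v" "drop c v"]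
      reduced_word_append[of "take c w" "drop c w"] by auto
  have "hd (drop c w) \<noteq> flip_letter (last (inv_word (drop c v)))"
    if "drop c v \<noteq> []" "drop c w \<noteq> []"
    using hd_drop_agree[of v w] that unfolding c_def[symmetric]
    by (cases "drop c v") auto
  with red show "reduced_word u" unfolding u_def reduced_word_append by auto
  have cl: "word_value G (take c w) \<in> carrier G" "word_value G (drop c v) \<in> carrier G"
    "word_value G (drop c w) \<in> carrier G"
    using dv X_closed by (auto intro: word_value_closed[of _ X])
  have tk: "take c v = take c w" unfolding c_def by (intro take_agree) auto
  have "word_value G v = word_value G (take c w) \<otimes> word_value G (drop c v)"
    using word_value_append[OF dv(3,1) X_closed] tk by (metis append_take_drop_id)
  moreover have "word_value G w = word_value G (take c w) \<otimes> word_value G (drop c w)"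
    using word_value_append[OF dv(3,2) X_closed] by (metis append_take_drop_id)
  moreover have "word_value G u = inv (word_value G (drop c v)) \<otimes> word_value G (drop c w)"
    unfolding u_def using word_value_append[of "inv_word (drop c v)" X "drop c w"] dv X_closed
    by (simp add: word_value_inv_word)
  ultimately show "word_value G u = inv (word_value G v) \<otimes> word_value G w"
    using cl by (simp add: inv_mult_group m_assoc) (metis inv_closed l_inv l_one m_assoc)
qed

text \<open>The quotient of two reduced words with the same value has an empty normal form.\<close>

lemma reduced_unique:
  assumes "set v \<subseteq> X \<times> UNIV" "reduced_word v" "set w \<subseteq> X \<times> UNIV" "reduced_word w"
    and "word_value G v = word_value G w"
  shows "v = w"
proof -
  let ?c = "agree v w"
  have "word_value G w \<in> carrier G" using assms(3) X_closed word_value_closed by blast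
  then have "inv_word (drop ?c v) @ drop ?c w = []"
    using nf_div_aux[OF assms(1-4)] assms(5) by (intro reduced_nontrivial) auto
  then have "drop ?c v = []" "drop ?c w = []" by auto
  moreover have "take ?c v = take ?c w" by (intro take_agree) auto
  ultimately show ?thesis by (metis append_take_drop_id)
qed

lemma nf_eqI:
  assumes "set w \<subseteq> X \<times> UNIV" "reduced_word w" "word_value G w = g"
  shows "nf g = w"
proof -
  have "g \<in> carrier G" using assms X_closed word_value_closed by blast
  from nf[OF this] assms show ?thesis by (intro reduced_unique) auto
qed

lemma nf_inv: "g \<in> carrier G \<Longrightarrow> nf (inv g) = inv_word (nf g)"
  using nf[of g] X_closed by (intro nf_eqI) (auto simp: word_value_inv_word)

lemma nf_div:
  assumes "g \<in> carrier G" "h \<in> carrier G"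
  defines "c \<equiv> agree (nf g) (nf h)"
  shows "nf (inv g \<otimes> h) = inv_word (drop c (nf g)) @ drop c (nf h)"
  unfolding c_def
  using nf_div_aux[OF nf(1,2)[OF assms(1)] nf(1,2)[OF assms(2)]] nf(3) assms by (intro nf_eqI) auto

lemma len_div:
  assumes "g \<in> carrier G" "h \<in> carrier G"
  shows "int (len (inv g \<otimes> h)) = int (len g) + int (len h) - 2 * int (agree (nf g) (nf h))"
  using nf_div[OF assms] agree_le[of "nf g" "nf h"] by simp

lemma len_le_word:
  assumes "set w \<subseteq> X \<times> UNIV" shows "len (word_value G w) \<le> length w"
proof -
  have "word_value G (free_reduce w) = word_value G w"
    by (rule word_value_free_reduce_self[OF assms X_closed])
  then have "nf (word_value G w) = free_reduce w"
    using assms set_free_reduce[of w] by (intro nf_eqI) auto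
  moreover have "length (free_reduce w) \<le> length w"
  proof (induction w)
    case (Cons l w)
    then show ?case by (cases "free_reduce w") auto
  qed auto
  ultimately show ?thesis by simp
qed

lemma len_eq_0: "g \<in> carrier G \<Longrightarrow> len g = 0 \<Longrightarrow> g = \<one>"
  using nf(3)[of g] by auto

lemma nf_generator: "x \<in> X \<Longrightarrow> nf x = [(x, True)]"
  using X_closed by (intro nf_eqI) (auto simp: letter_value_def reduced_word_Cons)

text \<open>The universal property. Evaluation of normal forms is multiplicative because free reduction of the
  concatenated words does not change the value in the target group either.\<close>

lemma hom_extension:
  assumes "group H" "\<sigma> \<in> X \<rightarrow> carrier H"
  shows "\<exists>\<theta>\<in>hom G H. \<forall>x\<in>X. \<theta> x = \<sigma> x"
proof -
  interpret H: group H by fact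
  define ev where "ev w = word_value H (map (apfst \<sigma>) w)" for w
  define \<theta> where "\<theta> g = ev (nf g)" for g
  have sX: "\<sigma> ` X \<subseteq> carrier H" using assms(2) by auto
  have sm: "set (map (apfst \<sigma>) w) \<subseteq> \<sigma> ` X \<times> UNIV" if "set w \<subseteq> X \<times> UNIV" for w
    using that by auto
  have ev_closed: "ev w \<in> carrier H" if "set w \<subseteq> X \<times> UNIV" for w
    unfolding ev_def using H.word_value_closed[OF sm[OF that] sX] .
  have ev_app: "ev (v @ w) = ev v \<otimes>\<^bsub>H\<^esub> ev w" if "set v \<subseteq> X \<times> UNIV" "set w \<subseteq> X \<times> UNIV" for v w
    unfolding ev_def using H.word_value_append[OF sm[OF that(1)] sm[OF that(2)] sX] by simp
  have ev_eq: "ev (nf (word_value G w)) = ev w" if w: "set w \<subseteq> X \<times> UNIV" for w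
  proof -
    have "word_value G (free_reduce w) = word_value G w"
      by (rule word_value_free_reduce_self[OF w X_closed])
    then have "nf (word_value G w) = free_reduce w"
      using w set_free_reduce[of w] by (intro nf_eqI) auto
    then show ?thesis unfolding ev_def using H.word_value_free_reduce[OF w assms(2)] by simp
  qed
  have "\<theta> (g \<otimes> h) = \<theta> g \<otimes>\<^bsub>H\<^esub> \<theta> h" if "g \<in> carrier G" "h \<in> carrier G" for g h
    using ev_eq[of "nf g @ nf h"] word_value_append[of "nf g" X "nf h"] nf[OF that(1)] nf[OF that(2)]
      X_closed ev_app by (simp add: \<theta>_def)
  moreover have "\<theta> g \<in> carrier H" if "g \<in> carrier G" for g
    unfolding \<theta>_def using ev_closed nf(1)[OF that] by auto
  moreover have "\<theta> x = \<sigma> x" if "x \<in> X" for x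
    using that sX by (auto simp: \<theta>_def nf_generator ev_def letter_value_def)
  ultimately have "\<theta> \<in> hom G H" "\<forall>x\<in>X. \<theta> x = \<sigma> x" by (auto simp: hom_def)
  then show ?thesis by blast
qed

end

section \<open>Nielsen's theorem for pairs of generators\<close>

text \<open>Simultaneous conjugation is admitted as a move: neither traces nor homology classes see it, and it
  is what makes the total length a sufficient measure in the reduction below.\<close>

inductive nielsen :: "('g, 'm) monoid_scheme \<Rightarrow> 'g \<times> 'g \<Rightarrow> 'g \<times> 'g \<Rightarrow> bool"
  for G (structure) and P where
  refl: "nielsen G P P"
| swap: "nielsen G P (u, v) \<Longrightarrow> nielsen G P (v, u)"
| invert: "nielsen G P (u, v) \<Longrightarrow> nielsen G P (inv u, v)"
| mult: "nielsen G P (u, v) \<Longrightarrow> nielsen G P (u, u \<otimes> v)"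
| conj: "nielsen G P (u, v) \<Longrightarrow> k \<in> carrier G \<Longrightarrow> nielsen G P (k \<otimes> u \<otimes> inv k, k \<otimes> v \<otimes> inv k)"

lemma nielsen_trans: "nielsen G Q R \<Longrightarrow> nielsen G P Q \<Longrightarrow> nielsen G P R"
  by (induction rule: nielsen.induct) (auto intro: nielsen.intros)

context group
begin

lemma inv_cancel [simp]:
  "k \<in> carrier G \<Longrightarrow> g \<in> carrier G \<Longrightarrow> inv k \<otimes> (k \<otimes> g) = g"
  "k \<in> carrier G \<Longrightarrow> g \<in> carrier G \<Longrightarrow> k \<otimes> (inv k \<otimes> g) = g"
  by (simp_all flip: m_assoc)

lemma nielsen_closed:
  "nielsen G P Q \<Longrightarrow> P \<in> carrier G \<times> carrier G \<Longrightarrow> Q \<in> carrier G \<times> carrier G"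
  by (induction rule: nielsen.induct) auto

lemma nielsen_sym:
  assumes "nielsen G P Q" "P \<in> carrier G \<times> carrier G"
  shows "nielsen G Q P"
  using assms
proof (induction rule: nielsen.induct)
  case (swap u v)
  have "nielsen G (v, u) (u, v)" by (rule nielsen.swap[OF nielsen.refl])
  from nielsen_trans[OF swap.IH[OF swap.prems] this] show ?case .
next
  case (invert u v)
  then have "u \<in> carrier G" using nielsen_closed by blast
  moreover have "nielsen G (inv u, v) (inv (inv u), v)" by (rule nielsen.invert[OF nielsen.refl])
  ultimately have "nielsen G (inv u, v) (u, v)" by simp
  from nielsen_trans[OF invert.IH[OF invert.prems] this] show ?case .
next
  case (mult u v)
  then have c: "u \<in> carrier G" "v \<in> carrier G" using nielsen_closed by blast+
  have "nielsen G (u, u \<otimes> v) (inv (inv u), inv u \<otimes> (u \<otimes> v))"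
    by (rule nielsen.invert[OF nielsen.mult[OF nielsen.invert[OF nielsen.refl]]])
  then have "nielsen G (u, u \<otimes> v) (u, v)" using c by simp
  from nielsen_trans[OF mult.IH[OF mult.prems] this] show ?case .
next
  case (conj u v k)
  then have c: "u \<in> carrier G" "v \<in> carrier G" using nielsen_closed by blast+
  have "nielsen G (k \<otimes> u \<otimes> inv k, k \<otimes> v \<otimes> inv k)
          (inv k \<otimes> (k \<otimes> u \<otimes> inv k) \<otimes> inv (inv k), inv k \<otimes> (k \<otimes> v \<otimes> inv k) \<otimes> inv (inv k))"
    using conj by (intro nielsen.conj[OF nielsen.refl]) auto
  moreover have "inv k \<otimes> (k \<otimes> g \<otimes> inv k) \<otimes> inv (inv k) = g" if "g \<in> carrier G" for g
    using that conj by (simp add: m_assoc)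
  ultimately have "nielsen G (k \<otimes> u \<otimes> inv k, k \<otimes> v \<otimes> inv k) (u, v)" using c by simp
  from nielsen_trans[OF conj.IH[OF conj.prems] this] show ?case .
qed (auto intro: nielsen.refl)

lemma generate_pair_eq:
  assumes "generate G {u, v} = carrier G" "{u', v'} \<subseteq> carrier G" "{u, v} \<subseteq> generate G {u', v'}"
  shows "generate G {u', v'} = carrier G"
proof
  show "generate G {u', v'} \<subseteq> carrier G" using assms(2) by (rule generate_incl)
  show "carrier G \<subseteq> generate G {u', v'}"
    using generate_subgroup_incl[OF assms(3) generate_is_subgroup[OF assms(2)]] assms(1) by simp
qed

lemma nielsen_generate:
  assumes "nielsen G P Q" "P \<in> carrier G \<times> carrier G" "generate G {fst P, snd P} = carrier G"
  shows "generate G {fst Q, snd Q} = carrier G"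
  using assms
proof (induction rule: nielsen.induct)
  case (swap u v)
  then show ?case by (simp add: insert_commute)
next
  case (invert u v)
  then have c: "u \<in> carrier G" "v \<in> carrier G" using nielsen_closed by blast+
  have "inv (inv u) \<in> generate G {inv u, v}" by (intro generate.inv) simp
  with c have "u \<in> generate G {inv u, v}" by simp
  then have "{u, v} \<subseteq> generate G {inv u, v}" by (auto intro: generate.incl)
  then show ?case using generate_pair_eq[of u v "inv u" v] invert c by simp
next
  case (mult u v)
  then have c: "u \<in> carrier G" "v \<in> carrier G" using nielsen_closed by blast+
  have "inv u \<otimes> (u \<otimes> v) \<in> generate G {u, u \<otimes> v}"
    by (intro generate.eng generate.inv generate.incl) auto
  with c have "v \<in> generate G {u, u \<otimes> v}" by simp
  then have "{u, v} \<subseteq> generate G {u, u \<otimes> v}" by (auto intro: generate.incl)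
  then show ?case using generate_pair_eq[of u v u "u \<otimes> v"] mult c by simp
next
  case (conj u v k)
  then have c: "u \<in> carrier G" "v \<in> carrier G" using nielsen_closed by blast+
  let ?H = "generate G {k \<otimes> u \<otimes> inv k, k \<otimes> v \<otimes> inv k}"
  have sub: "{k \<otimes> u \<otimes> inv k, k \<otimes> v \<otimes> inv k} \<subseteq> carrier G" using c conj by auto
  have "k \<otimes> g \<otimes> inv k \<in> ?H" if "g \<in> generate G {u, v}" for g
    using that
  proof (induction rule: generate.induct)
    case one
    then show ?case using conj by (simp add: generate.one)
  next
    case (incl h)
    then show ?case by (intro generate.incl) auto
  next
    case (inv h)
    then have "inv (k \<otimes> h \<otimes> inv k) \<in> ?H" by (intro generate.inv) auto
    then show ?case using inv c conj by (auto simp: inv_mult_group m_assoc)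
  next
    case (eng h1 h2)
    then have h: "h1 \<in> carrier G" "h2 \<in> carrier G" using conj by auto
    have "(k \<otimes> h1 \<otimes> inv k) \<otimes> (k \<otimes> h2 \<otimes> inv k) \<in> ?H" using eng(3,4) by (rule generate.eng)
    moreover have "(k \<otimes> h1 \<otimes> inv k) \<otimes> (k \<otimes> h2 \<otimes> inv k) = k \<otimes> (h1 \<otimes> h2) \<otimes> inv k"
      using h conj by (simp add: m_assoc)
    ultimately show ?case by simp
  qed
  then have *: "k \<otimes> g \<otimes> inv k \<in> ?H" if "g \<in> carrier G" for g using that conj by auto
  have "g \<in> ?H" if g: "g \<in> carrier G" for g
  proof -
    have "k \<otimes> (inv k \<otimes> g \<otimes> k) \<otimes> inv k = g"
      using g conj by (simp add: m_assoc)
    then show ?thesis using *[of "inv k \<otimes> g \<otimes> k"] g conj by simp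
  qed
  then show ?case using generate_incl[OF sub] by auto
qed simp

end

lemma inv_word_drop: "inv_word (drop d w) = take (length w - d) (inv_word w)"
  by (simp add: inv_word_def rev_drop flip: drop_map)

locale minimal_pair = free_group +
  fixes u v
  assumes closed: "u \<in> carrier G" "v \<in> carrier G"
    and gen_pair: "generate G {u, v} = carrier G"
    and minimal: "nielsen G (u, v) (u', v') \<Longrightarrow> len u + len v \<le> len u' + len v'"
    and noncomm: "\<exists>g\<in>carrier G. \<exists>h\<in>carrier G. g \<otimes> h \<noteq> h \<otimes> g"
begin

abbreviation "letters \<equiv> {u, v} \<times> (UNIV :: bool set)"
abbreviation "lv \<equiv> letter_value G"

lemma uv_sub: "{u, v} \<subseteq> carrier G" using closed by auto

lemma lv_closed [simp]: "l \<in> letters \<Longrightarrow> lv l \<in> carrier G"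
  using letter_value_closed[OF _ uv_sub] .

lemma lv_flip: "l \<in> letters \<Longrightarrow> lv (flip_letter l) = inv (lv l)"
  using letter_value_flip[OF _ uv_sub] .

text \<open>A group with one generator is commutative.\<close>

lemma not_cyclic:
  assumes "g \<in> carrier G" shows "generate G {g} \<noteq> carrier G"
proof
  assume eq: "generate G {g} = carrier G"
  have sub: "subgroup {k \<in> carrier G. k \<otimes> h = h \<otimes> k} G" if "h \<in> carrier G" for h
  proof (unfold_locales, goal_cases)
    case (2 x y)
    then have "x \<otimes> y \<otimes> h = x \<otimes> (h \<otimes> y)" using that by (simp add: m_assoc)
    also have "\<dots> = h \<otimes> (x \<otimes> y)" using 2 that by (simp flip: m_assoc)
    finally show ?case using 2 by simp
  next
    case (4 x)
    then have x: "x \<in> carrier G" and xh: "x \<otimes> h = h \<otimes> x" by auto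
    have "inv x \<otimes> h = inv x \<otimes> (h \<otimes> x) \<otimes> inv x" using x that by (simp add: m_assoc)
    also have "\<dots> = h \<otimes> inv x" unfolding xh[symmetric] using x that by (simp add: m_assoc)
    finally show ?case using x by simp
  qed (use that in auto)
  have g: "g \<otimes> h = h \<otimes> g" if h: "h \<in> carrier G" for h
  proof -
    have "generate G {g} \<subseteq> {k \<in> carrier G. k \<otimes> g = g \<otimes> k}"
      by (rule generate_subgroup_incl[OF _ sub[OF assms]]) (use assms in simp)
    with h eq show ?thesis by auto
  qed
  have "k \<otimes> h = h \<otimes> k" if hk: "h \<in> carrier G" "k \<in> carrier G" for h k
  proof -
    have "generate G {g} \<subseteq> {k \<in> carrier G. k \<otimes> h = h \<otimes> k}"
      by (rule generate_subgroup_incl[OF _ sub[OF hk(1)]]) (use assms g hk in simp)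
    with hk eq show ?thesis by auto
  qed
  with noncomm show False by blast
qed

lemma not_one: "u \<noteq> \<one>" "v \<noteq> \<one>" "u \<noteq> v"
proof -
  have one: "generate G {\<one>, g} \<noteq> carrier G" if g: "g \<in> carrier G" for g
  proof -
    have "generate G {\<one>, g} \<subseteq> generate G {g}"
      using g by (intro generate_subgroup_incl generate_is_subgroup)
        (auto intro: generate.one generate.incl)
    then show ?thesis using generate_incl[of "{g}"] not_cyclic[OF g] g by auto
  qed
  show "u \<noteq> \<one>" "v \<noteq> \<one>" "u \<noteq> v"
    using one[of u] one[of v] not_cyclic[of u] gen_pair closed insert_commute[of u "\<one>" "{}"] by auto
qed

lemma lv_pos: "l \<in> letters \<Longrightarrow> 0 < len (lv l)"
proof -
  assume l: "l \<in> letters"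
  then have "lv l \<noteq> \<one>" using not_one closed by (auto simp: letter_value_def inv_eq_1_iff)
  then show ?thesis using len_eq_0[of "lv l"] l by auto
qed

lemma nielsen_letters:
  assumes "l \<in> letters" "k \<in> letters" "fst l \<noteq> fst k"
  shows "nielsen G (u, v) (lv l, lv k)" "len (lv l) + len (lv k) = len u + len v"
proof -
  note r = nielsen.refl[of G "(u, v)"] and s = nielsen.swap and i = nielsen.invert
  note pairs = r s[OF r] i[OF r] i[OF s[OF r]] s[OF i[OF r]] s[OF i[OF s[OF r]]]
    i[OF s[OF i[OF r]]] i[OF s[OF i[OF s[OF r]]]]
  show "nielsen G (u, v) (lv l, lv k)"
    using assms by (elim SigmaE) (auto simp: letter_value_def simp del: split_paired_All
      intro: pairs)
  show "len (lv l) + len (lv k) = len u + len v"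
    using assms closed by (auto simp: letter_value_def nf_inv)
qed

text \<open>If more than half of a letter cancelled against another one, then multiplying the two would
  shorten the pair. For a letter and its own inverse this holds in every free group.\<close>

lemma half_cancellation:
  assumes "l \<in> letters" "k \<in> letters" "k \<noteq> l"
  shows "2 * agree (nf (lv l)) (nf (lv k)) \<le> len (lv l)"
    and "fst l = fst k \<Longrightarrow> 2 * agree (nf (lv l)) (nf (lv k)) < len (lv l)"
proof -
  show *: "2 * agree (nf (lv l)) (nf (lv k)) < len (lv l)" if "fst l = fst k"
  proof -
    have "k = flip_letter l" using that assms(3) by (auto simp: flip_letter_def prod_eq_iff)
    then have "nf (lv k) = inv_word (nf (lv l))" using assms by (simp add: lv_flip nf_inv)
    then show ?thesis
      using agree_inv_word_less[of "nf (lv l)"] nf(2)[of "lv l"] lv_pos[of l] assms by simp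
  qed
  show "2 * agree (nf (lv l)) (nf (lv k)) \<le> len (lv l)"
  proof (cases "fst l = fst k")
    case False
    have "nielsen G (u, v) (inv (lv l), inv (lv l) \<otimes> lv k)"
      using nielsen_letters(1)[OF assms(1,2) False] by (intro nielsen.mult nielsen.invert)
    then have "len u + len v \<le> len (inv (lv l)) + len (inv (lv l) \<otimes> lv k)" by (rule minimal)
    then have "int (len (lv k)) \<le> int (len (inv (lv l) \<otimes> lv k))"
      using nielsen_letters[of l k] assms False by (simp add: nf_inv)
    then show ?thesis
      using len_div[of "lv l" "lv k"] assms by simp
  qed (use * in auto)
qed

text \<open>The tie case of the reduction. If half of a letter cancels on its left and the other half on
  its right, then the pair has the form \<open>p q\<^sup>-\<^sup>1\<close>, \<open>p r q\<^sup>-\<^sup>1\<close>, and the Nielsen equivalent pair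
  \<open>p\<^sup>-\<^sup>1 q\<close>, \<open>r\<close> is shorter.\<close>

lemma two_halves:
  assumes "l \<in> letters" "k \<in> letters" "m \<in> letters" "k \<noteq> l" "m \<noteq> flip_letter l"
  shows "agree (nf (lv l)) (nf (lv k)) + agree (nf (inv (lv l))) (nf (lv m)) < len (lv l)"
proof (rule ccontr)
  assume *: "\<not> ?thesis"
  define n where "n = nf (lv l)"
  define y where "y = nf (lv k)"
  define h where "h = agree n y"
  have fl: "flip_letter l \<in> letters" using assms(1) by (simp only: flip_mem)
  have nfi: "nf (inv (lv l)) = inv_word n" unfolding n_def using assms by (simp add: nf_inv)
  have c1: "2 * h \<le> length n" "fst l = fst k \<Longrightarrow> 2 * h < length n"
    using half_cancellation[OF assms(1,2,4)] by (auto simp: n_def y_def h_def)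
  have lf: "nf (lv (flip_letter l)) = inv_word n" using assms(1) nfi by (simp add: lv_flip)
  have ff: "fst (flip_letter l) = fst l" by (simp add: flip_letter_def)
  have c2: "2 * agree (inv_word n) (nf (lv m)) \<le> length n"
    "fst l = fst m \<Longrightarrow> 2 * agree (inv_word n) (nf (lv m)) < length n"
    using half_cancellation[OF fl assms(3,5), unfolded lf ff] by auto
  have sum: "length n \<le> h + agree (inv_word n) (nf (lv m))"
    using * by (simp add: nfi n_def[symmetric] y_def[symmetric] h_def[symmetric])
  then have h: "2 * h = length n" "agree (inv_word n) (nf (lv m)) = h" "fst l \<noteq> fst k" "fst l \<noteq> fst m"
    using c1 c2 by linarith+
  have y2: "2 * h \<le> length y"
    using half_cancellation(1)[OF assms(2,1)] assms(4) by (auto simp: h_def n_def y_def agree_commute)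
  have n: "set n \<subseteq> X \<times> UNIV" "reduced_word n" "word_value G n = lv l" "n \<noteq> []"
    using nf[of "lv l"] assms lv_pos[of l] by (auto simp: n_def)
  have y: "set y \<subseteq> X \<times> UNIV" "word_value G y = lv k"
    using nf[of "lv k"] assms by (auto simp: y_def)
  have ty: "take h y = take h n" unfolding h_def by (rule take_agree[symmetric]) simp
  have "m = flip_letter k"
  proof (rule ccontr)
    assume "m \<noteq> flip_letter k"
    then have "m = k" using assms h by (auto simp: flip_letter_def prod_eq_iff)
    then have "take h (inv_word n) = take h y"
      using take_agree[of h "inv_word n" "nf (lv m)"] h by (simp add: y_def)
    then have "h \<le> agree n (inv_word n)" using ty h(1) by (intro agree_ge) auto
    then show False using agree_inv_word_less[OF n(2,4)] h(1) by simp
  qed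
  then have nm: "nf (lv m) = inv_word y" using assms by (simp add: y_def lv_flip nf_inv)
  define p where "p = take h n"
  define q where "q = take h (inv_word n)"
  define r where "r = take (length y - 2 * h) (drop h y)"
  have qy: "take h (inv_word y) = q"
    using take_agree[of h "inv_word n" "inv_word y"] h nm by (simp add: q_def)
  have "inv_word (drop h n) = take (length n - h) (inv_word n)" by (rule inv_word_drop)
  also have "length n - h = h" using h(1) by simp
  finally have "drop h n = inv_word q" unfolding q_def by (metis inv_word_simps(5))
  then have n_eq: "n = p @ inv_word q" using append_take_drop_id[of h n] by (simp only: p_def)
  have "inv_word (drop (length y - h) y) = q" using qy y2 by (simp add: inv_word_drop)
  then have "drop (length y - h) y = inv_word q" by (metis inv_word_simps(5))
  moreover have "length y - 2 * h + h = length y - h" using y2 by simp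
  ultimately have dr: "drop (length y - 2 * h) (drop h y) = inv_word q" by (simp only: drop_drop)
  have "y = take h y @ take (length y - 2 * h) (drop h y) @ drop (length y - 2 * h) (drop h y)"
    by (simp only: append_take_drop_id)
  then have y_eq: "y = p @ r @ inv_word q"
    by (simp only: dr p_def r_def ty)
  have sets: "set p \<subseteq> X \<times> UNIV" "set q \<subseteq> X \<times> UNIV" "set r \<subseteq> X \<times> UNIV"
  proof -
    have "set (p @ r @ inv_word q) \<subseteq> X \<times> UNIV" using y(1) y_eq by simp
    then have "set p \<subseteq> X \<times> UNIV" "set r \<subseteq> X \<times> UNIV" "set (inv_word q) \<subseteq> X \<times> UNIV" by simp_all
    then show "set p \<subseteq> X \<times> UNIV" "set q \<subseteq> X \<times> UNIV" "set r \<subseteq> X \<times> UNIV" by simp_all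
  qed
  define P where "P = word_value G p"
  define Q where "Q = word_value G q"
  define R where "R = word_value G r"
  have PQR: "P \<in> carrier G" "Q \<in> carrier G" "R \<in> carrier G"
    using word_value_closed sets X_closed unfolding P_def Q_def R_def by blast+
  have iq: "word_value G (inv_word q) = inv Q"
    unfolding Q_def by (rule word_value_inv_word[OF sets(2) X_closed])
  have siq: "set (inv_word q) \<subseteq> X \<times> UNIV" using sets(2) by simp
  have l_eq: "lv l = P \<otimes> inv Q"
    unfolding n(3)[symmetric] n_eq word_value_append[OF sets(1) siq X_closed] iq P_def ..
  have "word_value G (r @ inv_word q) = R \<otimes> inv Q"
    unfolding word_value_append[OF sets(3) siq X_closed] iq R_def ..
  moreover have "set (r @ inv_word q) \<subseteq> X \<times> UNIV" using siq sets(3) by simp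
  ultimately have k_eq: "lv k = P \<otimes> (R \<otimes> inv Q)"
    unfolding y(2)[symmetric] y_eq P_def
    using word_value_append[OF sets(1) _ X_closed, of "r @ inv_word q"] by simp
  have "nielsen G (u, v) (inv (lv l), inv (lv l) \<otimes> lv k)"
    using nielsen_letters(1)[OF assms(1,2) h(3)] by (intro nielsen.mult nielsen.invert)
  then have "nielsen G (u, v) (inv Q \<otimes> inv (lv l) \<otimes> inv (inv Q),
      inv Q \<otimes> (inv (lv l) \<otimes> lv k) \<otimes> inv (inv Q))"
    using PQR by (intro nielsen.conj) auto
  moreover have "inv Q \<otimes> inv (lv l) \<otimes> inv (inv Q) = inv P \<otimes> Q"
    using PQR by (simp add: l_eq inv_mult_group m_assoc)
  moreover have "inv Q \<otimes> (inv (lv l) \<otimes> lv k) \<otimes> inv (inv Q) = R"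
    using PQR by (simp add: l_eq k_eq inv_mult_group m_assoc)
  ultimately have "len u + len v \<le> len (inv P \<otimes> Q) + len R" by (simp add: minimal)
  moreover have "len R \<le> length y - 2 * h"
    using len_le_word[OF sets(3)] unfolding R_def by (simp add: r_def)
  moreover have "inv P \<otimes> Q = word_value G (inv_word p @ q)"
    using sets X_closed word_value_append[of "inv_word p" X q]
    by (simp add: P_def Q_def word_value_inv_word[of p X])
  then have "len (inv P \<otimes> Q) \<le> 2 * h"
    using len_le_word[of "inv_word p @ q"] sets h(1) by (simp add: p_def q_def)
  moreover have "length n + length y = len u + len v"
    using nielsen_letters(2)[OF assms(1,2) h(3)] by (simp add: n_def y_def)
  moreover have "0 < length n" using n(4) by simp
  ultimately show False using y2 by linarith
qed

text \<open>Since less than a whole letter is cancelled, every letter of a reduced word in a minimal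
  pair keeps a part of its own, and the value has at least as many letters.\<close>

lemma length_product:
  assumes "set (l # w) \<subseteq> letters" "reduced_word (l # w)"
  defines "d \<equiv> (if w = [] then 0 else agree (nf (inv (lv l))) (nf (lv (hd w))))"
  shows "d < len (lv l) \<and> take (len (lv l) - d) (nf (word_value G (l # w))) = take (len (lv l) - d) (nf (lv l))
    \<and> len (lv l) - d + length w \<le> len (word_value G (l # w))"
  using assms(1,2) unfolding d_def
proof (induction w arbitrary: l)
  case Nil
  then show ?case using lv_pos[of l] by simp
next
  case (Cons k w)
  define d1 where "d1 = agree (nf (inv (lv l))) (nf (lv k))"
  define d2 where "d2 = (if w = [] then 0 else agree (nf (inv (lv k))) (nf (lv (hd w))))"
  define Y where "Y = word_value G (k # w)"
  have lk: "l \<in> letters" "k \<in> letters" "k \<noteq> flip_letter l" "l \<noteq> flip_letter k" "flip_letter l \<noteq> k"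
    using Cons.prems by (auto simp: reduced_word_Cons)
  have fl: "flip_letter l \<in> letters" using lk(1) by (simp only: flip_mem)
  have YG: "Y \<in> carrier G" unfolding Y_def using Cons.prems(1) uv_sub by (intro word_value_closed) auto
  have "set (k # w) \<subseteq> letters" "reduced_word (k # w)"
    using Cons.prems by (auto simp: reduced_word_Cons)
  from Cons.IH[OF this]
  have IH: "d2 < len (lv k)" "take (len (lv k) - d2) (nf Y) = take (len (lv k) - d2) (nf (lv k))"
    "len (lv k) - d2 + length w \<le> len Y"
    unfolding d2_def Y_def by auto
  have lf: "nf (lv (flip_letter l)) = nf (inv (lv l))" "len (inv (lv l)) = len (lv l)"
    using lk(1) by (simp_all add: lv_flip nf_inv)
  have "2 * d1 \<le> len (lv l)"
    using half_cancellation(1)[OF fl lk(2,3)] by (simp add: d1_def lf)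
  then have d1: "d1 < len (lv l)" using lv_pos[OF lk(1)] by linarith
  have d12: "d1 + d2 < len (lv k)"
  proof (cases "w = []")
    case True
    have "2 * d1 \<le> len (lv k)"
      using half_cancellation(1)[OF lk(2) fl lk(5)] by (simp add: d1_def lf agree_commute)
    then have "d1 < len (lv k)" using lv_pos[OF lk(2)] by linarith
    then show ?thesis using True by (simp add: d2_def)
  next
    case False
    then have "hd w \<in> letters" "hd w \<noteq> flip_letter k"
      using Cons.prems by (cases w; auto simp: reduced_word_Cons)+
    from two_halves[OF lk(2) fl this(1) lk(5) this(2)] show ?thesis
      using False by (simp add: d1_def d2_def lf agree_commute)
  qed
  have agY: "agree (nf (inv (lv l))) (nf Y) = d1"
    unfolding d1_def
  proof (rule agree_prefix[where k = "len (lv k) - d2"])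
    show "agree (nf (inv (lv l))) (nf (lv k)) < len (lv k) - d2"
      using d12 by (simp add: d1_def)
  qed (use IH in auto)
  have val: "word_value G (l # k # w) = inv (inv (lv l)) \<otimes> Y"
    using lk by (simp add: Y_def)
  have "nf (word_value G (l # k # w)) = inv_word (drop d1 (nf (inv (lv l)))) @ drop d1 (nf Y)"
    unfolding val using nf_div[of "inv (lv l)" Y] YG lk agY by simp
  then have nf_eq: "nf (word_value G (l # k # w)) = take (len (lv l) - d1) (nf (lv l)) @ drop d1 (nf Y)"
    using lk by (simp add: nf_inv inv_word_drop)
  have "len (lv l) - d1 + Suc (length w) \<le> len (word_value G (l # k # w))"
    unfolding nf_eq using IH d12 by simp
  moreover have "take (len (lv l) - d1) (nf (word_value G (l # k # w))) = take (len (lv l) - d1) (nf (lv l))"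
    unfolding nf_eq by simp
  ultimately show ?case using d1 by (simp add: d1_def)
qed

text \<open>A word with several letters in the minimal pair has a value of length at least two.\<close>

lemma generator_is_letter:
  assumes "x \<in> X"
  shows "\<exists>l\<in>letters. lv l = x"
proof -
  have "x \<in> generate G {u, v}" using assms X_closed gen_pair by auto
  then obtain w where w: "set w \<subseteq> letters" "reduced_word w" "word_value G w = x"
    using generate_reduced_word[OF uv_sub] by blast
  have len: "len x = 1" using nf_generator[OF assms] by simp
  have "nf \<one> = []" by (intro nf_eqI) auto
  then obtain l w' where lw: "w = l # w'" using w(3) len by (cases w) auto
  define d where "d = (if w' = [] then 0 else agree (nf (inv (lv l))) (nf (lv (hd w'))))"
  have "d < len (lv l)" "len (lv l) - d + length w' \<le> 1"
    using length_product[of l w', folded d_def] w lw len by auto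
  then have "length w' = 0" by linarith
  then have "w' = []" by simp
  then show ?thesis using w lw by (auto intro!: bexI[of _ l])
qed

end

text \<open>Among the pairs obtained from a given generating pair by Nielsen moves and simultaneous
  conjugation, a shortest one is a basis up to inversion and order.\<close>

theorem (in group) nielsen_theorem:
  assumes free: "free_on G {a, b}" and ab: "a \<noteq> b"
    and uv: "u \<in> carrier G" "v \<in> carrier G" "generate G {u, v} = carrier G"
  shows "nielsen G (u, v) (a, b)"
proof -
  interpret free_group G "{a, b}" by unfold_locales fact
  define N where "N P = len (fst P) + len (snd P)" for P
  obtain P where P: "nielsen G (u, v) P" "\<And>Q. nielsen G (u, v) Q \<Longrightarrow> N P \<le> N Q"
    using ex_has_least_nat[of "nielsen G (u, v)" "(u, v)" N] nielsen.refl by blast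
  obtain u' v' where P_eq: "P = (u', v')" by (cases P)
  have c: "u' \<in> carrier G" "v' \<in> carrier G" using nielsen_closed[OF P(1)] uv P_eq by auto
  have abG: "a \<in> carrier G" "b \<in> carrier G" using X_closed by auto
  have nfab: "nf a = [(a, True)]" "nf b = [(b, True)]" by (auto intro: nf_generator)
  have nfia: "nf (inv a) = [(a, False)]" using abG nfab by (simp add: nf_inv flip_letter_def)
  interpret minimal_pair G "{a, b}" u' v'
  proof
    show "generate G {u', v'} = carrier G" using nielsen_generate[OF P(1)] uv P_eq by simp
    show "len u' + len v' \<le> len u'' + len v''" if "nielsen G (u', v') (u'', v'')" for u'' v''
      using P(2)[OF nielsen_trans[OF that]] P(1) P_eq by (simp add: N_def)
    have "nf (inv a \<otimes> b) = [(a, False), (b, True)]"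
      using nf_div[OF abG] ab by (simp add: nfab flip_letter_def)
    moreover have "nf (inv (inv b) \<otimes> inv a) = [(b, True), (a, False)]"
      using nf_div[of "inv b" "inv a"] abG ab
      by (simp add: nfab nfia nf_inv[of b] flip_letter_def)
    ultimately have "inv a \<otimes> b \<noteq> b \<otimes> inv a" using abG ab by auto
    then show "\<exists>g\<in>carrier G. \<exists>h\<in>carrier G. g \<otimes> h \<noteq> h \<otimes> g" using abG by blast
  qed (use c in auto)
  obtain l k where lk: "l \<in> letters" "lv l = a" "k \<in> letters" "lv k = b"
    using generator_is_letter[of a] generator_is_letter[of b] by blast
  have "fst l \<noteq> fst k"
  proof
    assume eq: "fst l = fst k"
    then have "l = k \<or> k = flip_letter l" by (auto simp: flip_letter_def prod_eq_iff)
    then have "b = a \<or> b = inv a" using lk lv_flip[of l] by auto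
    then show False using ab nfab nfia by auto
  qed
  then have "nielsen G (u', v') (a, b)" using nielsen_letters(1)[of l k] lk by simp
  then show ?thesis using nielsen_trans P(1) P_eq by blast
qed

section \<open>Conjugacy of primitive elements\<close>

text \<open>Pairs of words in \<open>x\<close> and \<open>y\<close> without inverse letters, built by the two moves of the Euclidean algorithm.\<close>

inductive positive_pair :: "('g, 'm) monoid_scheme \<Rightarrow> 'g \<Rightarrow> 'g \<Rightarrow> 'g \<Rightarrow> 'g \<Rightarrow> bool"
  for G (structure) and x y where
  base: "positive_pair G x y x y"
| left: "positive_pair G x y u v \<Longrightarrow> positive_pair G x y u (u \<otimes> v)"
| right: "positive_pair G x y u v \<Longrightarrow> positive_pair G x y (u \<otimes> v) v"

inductive trivial_moves :: "('g, 'm) monoid_scheme \<Rightarrow> 'g \<times> 'g \<Rightarrow> 'g \<times> 'g \<Rightarrow> bool"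
  for G (structure) and P where
  refl: "trivial_moves G P P"
| swap: "trivial_moves G P (u, v) \<Longrightarrow> trivial_moves G P (v, u)"
| invert: "trivial_moves G P (u, v) \<Longrightarrow> trivial_moves G P (inv u, v)"
| conj: "trivial_moves G P (u, v) \<Longrightarrow> k \<in> carrier G \<Longrightarrow>
    trivial_moves G P (k \<otimes> u \<otimes> inv k, k \<otimes> v \<otimes> inv k)"

text \<open>Up to inversion, order and simultaneous conjugation, the pair consists of positive words in one of
  the four pairs \<open>a\<close> or \<open>a\<^sup>-\<^sup>1\<close> and \<open>b\<close> or \<open>b\<^sup>-\<^sup>1\<close>. Every basis has this form.\<close>

definition monotone_pair :: "('g, 'm) monoid_scheme \<Rightarrow> 'g \<Rightarrow> 'g \<Rightarrow> 'g \<times> 'g \<Rightarrow> bool" where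
  "monotone_pair G a b Q \<longleftrightarrow> (\<exists>x\<in>{a, inv\<^bsub>G\<^esub> a}. \<exists>y\<in>{b, inv\<^bsub>G\<^esub> b}. \<exists>u v.
     positive_pair G x y u v \<and> trivial_moves G (u, v) Q)"

text \<open>Conjugate to \<open>w\<close> or to its inverse: the algebraic form of freely homotopic up to orientation.\<close>

definition conj_pm :: "('g, 'm) monoid_scheme \<Rightarrow> 'g \<Rightarrow> 'g \<Rightarrow> bool" where
  "conj_pm G w g \<longleftrightarrow> (\<exists>k\<in>carrier G. g = k \<otimes>\<^bsub>G\<^esub> w \<otimes>\<^bsub>G\<^esub> inv\<^bsub>G\<^esub> k
     \<or> g = k \<otimes>\<^bsub>G\<^esub> inv\<^bsub>G\<^esub> w \<otimes>\<^bsub>G\<^esub> inv\<^bsub>G\<^esub> k)"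

lemma monotone_pair_swap: "monotone_pair G a b (u, v) \<Longrightarrow> monotone_pair G a b (v, u)"
  unfolding monotone_pair_def by (meson trivial_moves.swap)

lemma monotone_pair_invert: "monotone_pair G a b (u, v) \<Longrightarrow> monotone_pair G a b (inv\<^bsub>G\<^esub> u, v)"
  unfolding monotone_pair_def by (meson trivial_moves.invert)

lemma monotone_pair_conj:
  "monotone_pair G a b (u, v) \<Longrightarrow> k \<in> carrier G \<Longrightarrow>
   monotone_pair G a b (k \<otimes>\<^bsub>G\<^esub> u \<otimes>\<^bsub>G\<^esub> inv\<^bsub>G\<^esub> k, k \<otimes>\<^bsub>G\<^esub> v \<otimes>\<^bsub>G\<^esub> inv\<^bsub>G\<^esub> k)"
  unfolding monotone_pair_def by (meson trivial_moves.conj)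

lemma monotone_pair_invert2: "monotone_pair G a b (u, v) \<Longrightarrow> monotone_pair G a b (u, inv\<^bsub>G\<^esub> v)"
  by (intro monotone_pair_swap[OF monotone_pair_invert[OF monotone_pair_swap]])

lemma monotone_pair_positive:
  "positive_pair G x y u v \<Longrightarrow> x \<in> {a, inv\<^bsub>G\<^esub> a} \<Longrightarrow> y \<in> {b, inv\<^bsub>G\<^esub> b} \<Longrightarrow> monotone_pair G a b (u, v)"
  unfolding monotone_pair_def by (blast intro: trivial_moves.refl)

context group
begin

lemma trivial_moves_closed:
  "trivial_moves G P Q \<Longrightarrow> P \<in> carrier G \<times> carrier G \<Longrightarrow> Q \<in> carrier G \<times> carrier G"
  by (induction rule: trivial_moves.induct) auto

lemma positive_pair_closed:
  "positive_pair G x y u v \<Longrightarrow> x \<in> carrier G \<Longrightarrow> y \<in> carrier G \<Longrightarrow> u \<in> carrier G \<and> v \<in> carrier G"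
  by (induction rule: positive_pair.induct) auto

text \<open>The four products are all the results of a multiplication move, up to moves that do not multiply.\<close>

definition monotone_moves :: "'a \<Rightarrow> 'a \<Rightarrow> 'a \<Rightarrow> 'a \<Rightarrow> bool" where
  "monotone_moves a b u v \<longleftrightarrow>
     monotone_pair G a b (u, u \<otimes> v) \<and> monotone_pair G a b (u, inv u \<otimes> v) \<and>
     monotone_pair G a b (v, v \<otimes> u) \<and> monotone_pair G a b (v, inv v \<otimes> u)"

text \<open>The only moves that could produce cancellation divide one word of the pair by the other.
  They undo the last step of the construction of the pair, or, at the start, change the sign of
  one of the two letters.\<close>

lemma positive_pair_moves:
  assumes "positive_pair G x y u v" and x: "x \<in> {a, inv a}" and y: "y \<in> {b, inv b}"
    and ab: "a \<in> carrier G" "b \<in> carrier G"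
  shows "monotone_moves a b u v"
proof -
  have xy: "x \<in> carrier G" "y \<in> carrier G" using assms by auto
  have uv: "u \<in> carrier G" "v \<in> carrier G" using positive_pair_closed[OF assms(1)] xy by auto
  have ix: "inv x \<in> {a, inv a}" and iy: "inv y \<in> {b, inv b}" using x y ab by auto
  have 1: "monotone_pair G a b (u, u \<otimes> v)"
    by (rule monotone_pair_positive[OF positive_pair.left[OF assms(1)] x y])
  have "monotone_pair G a b (u \<otimes> v, v)"
    by (rule monotone_pair_positive[OF positive_pair.right[OF assms(1)] x y])
  from monotone_pair_conj[OF monotone_pair_swap[OF this] uv(2)]
  have 2: "monotone_pair G a b (v, v \<otimes> u)" using uv by (simp add: m_assoc)
  have 3: "monotone_pair G a b (u, inv u \<otimes> v) \<and> monotone_pair G a b (v, inv v \<otimes> u)"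
    using assms(1)
  proof cases
    case base
    have "monotone_pair G a b (inv x, inv x \<otimes> y)"
      by (rule monotone_pair_positive[OF positive_pair.left[OF positive_pair.base] ix y])
    from monotone_pair_invert[OF this] have *: "monotone_pair G a b (x, inv x \<otimes> y)" using xy by simp
    have "monotone_pair G a b (x \<otimes> inv y, inv y)"
      by (rule monotone_pair_positive[OF positive_pair.right[OF positive_pair.base] x iy])
    from monotone_pair_conj[OF monotone_pair_invert[OF monotone_pair_swap[OF this]], of "inv y"]
    have "monotone_pair G a b (y, inv y \<otimes> x)" using xy by (simp add: m_assoc)
    with * show ?thesis using base by simp
  next
    case (left v')
    have v': "v' \<in> carrier G" using positive_pair_closed[OF left(2)] xy by auto
    have "monotone_pair G a b (u, inv u \<otimes> v)"
      using monotone_pair_positive[OF left(2) x y] left uv v' by simp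
    moreover have "monotone_pair G a b (inv v', u \<otimes> v')"
      by (rule monotone_pair_invert[OF monotone_pair_swap[OF
            monotone_pair_positive[OF positive_pair.right[OF left(2)] x y]]])
    then have "monotone_pair G a b (v, inv v \<otimes> u)"
      using monotone_pair_swap left uv v' by (simp add: inv_mult_group m_assoc)
    ultimately show ?thesis by simp
  next
    case (right u')
    have u': "u' \<in> carrier G" using positive_pair_closed[OF right(2)] xy by auto
    have "monotone_pair G a b (u', u' \<otimes> v)"
      by (rule monotone_pair_positive[OF positive_pair.left[OF right(2)] x y])
    from monotone_pair_swap[OF monotone_pair_invert[OF this]]
    have "monotone_pair G a b (u, inv u')" using right by simp
    from monotone_pair_conj[OF this, of "inv u"]
    have "monotone_pair G a b (u, inv u \<otimes> v)"
      using uv u' right by (simp add: inv_mult_group m_assoc)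
    moreover have "monotone_pair G a b (inv v \<otimes> u' \<otimes> inv (inv v), inv v \<otimes> v \<otimes> inv (inv v))"
      by (rule monotone_pair_conj[OF monotone_pair_positive[OF right(2) x y]]) (use uv in auto)
    then have "monotone_pair G a b (v, inv v \<otimes> u)"
      using monotone_pair_swap right uv u' by (simp add: m_assoc)
    ultimately show ?thesis by simp
  qed
  show ?thesis unfolding monotone_moves_def using 1 2 3 by blast
qed

lemma trivial_moves_moves:
  assumes "trivial_moves G P Q" "P \<in> carrier G \<times> carrier G" "monotone_moves a b (fst P) (snd P)"
  shows "monotone_moves a b (fst Q) (snd Q)"
  using assms
proof (induction rule: trivial_moves.induct)
  case (swap u v)
  then show ?case by (auto simp: monotone_moves_def)
next
  case (invert u v)
  then have c: "u \<in> carrier G" "v \<in> carrier G" using trivial_moves_closed by blast+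
  have m: "monotone_pair G a b (u, u \<otimes> v)" "monotone_pair G a b (u, inv u \<otimes> v)"
    "monotone_pair G a b (v, v \<otimes> u)" "monotone_pair G a b (v, inv v \<otimes> u)"
    using invert by (auto simp: monotone_moves_def)
  from monotone_pair_conj[OF monotone_pair_invert2[OF m(4)], of v]
    monotone_pair_conj[OF monotone_pair_invert2[OF m(3)], of "inv v"]
  have "monotone_pair G a b (v, v \<otimes> inv u)" "monotone_pair G a b (v, inv v \<otimes> inv u)"
    using c by (simp_all add: inv_mult_group m_assoc)
  then show ?case
    using m(1,2)[THEN monotone_pair_invert] c by (simp add: monotone_moves_def)
next
  case (conj u v k)
  then have c: "u \<in> carrier G" "v \<in> carrier G" using trivial_moves_closed by blast+
  show ?case
    using conj.IH[OF conj.prems] c \<open>k \<in> carrier G\<close>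
      monotone_pair_conj[of G a b u "u \<otimes> v" k] monotone_pair_conj[of G a b u "inv u \<otimes> v" k]
      monotone_pair_conj[of G a b v "v \<otimes> u" k] monotone_pair_conj[of G a b v "inv v \<otimes> u" k]
    by (simp add: monotone_moves_def inv_mult_group m_assoc)
qed auto

text \<open>Monotone pairs are closed under all Nielsen moves, so every basis is monotone.\<close>

lemma nielsen_monotone_pair:
  assumes "nielsen G (a, b) Q" and ab: "a \<in> carrier G" "b \<in> carrier G"
  shows "monotone_pair G a b Q"
  using assms(1)
proof (induction rule: nielsen.induct)
  case refl
  then show ?case by (intro monotone_pair_positive[OF positive_pair.base]) auto
next
  case (mult u v)
  then obtain x y u0 v0 where *: "x \<in> {a, inv a}" "y \<in> {b, inv b}"
    "positive_pair G x y u0 v0" "trivial_moves G (u0, v0) (u, v)"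
    by (auto simp: monotone_pair_def)
  have "u0 \<in> carrier G" "v0 \<in> carrier G" using positive_pair_closed[OF *(3)] *(1,2) ab by auto
  with trivial_moves_moves[OF *(4), of a b] positive_pair_moves[OF *(3,1,2) ab]
  show ?case by (simp add: monotone_moves_def)
qed (auto intro: monotone_pair_swap monotone_pair_invert monotone_pair_conj)

lemma conj_pm_refl: "w \<in> carrier G \<Longrightarrow> conj_pm G w w"
  unfolding conj_pm_def by (intro bexI[of _ \<one>]) auto

lemma conj_pm_inv: "conj_pm G w g \<Longrightarrow> w \<in> carrier G \<Longrightarrow> conj_pm G w (inv g)"
  unfolding conj_pm_def by (auto simp: inv_mult_group m_assoc)

lemma conj_pm_conj:
  assumes "conj_pm G w g" "w \<in> carrier G" "k \<in> carrier G"
  shows "conj_pm G w (k \<otimes> g \<otimes> inv k)"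
proof -
  obtain h where h: "h \<in> carrier G" "g = h \<otimes> w \<otimes> inv h \<or> g = h \<otimes> inv w \<otimes> inv h"
    using assms by (auto simp: conj_pm_def)
  have "k \<otimes> g \<otimes> inv k = (k \<otimes> h) \<otimes> w \<otimes> inv (k \<otimes> h) \<or>
        k \<otimes> g \<otimes> inv k = (k \<otimes> h) \<otimes> inv w \<otimes> inv (k \<otimes> h)"
    using h assms by (auto simp: inv_mult_group m_assoc)
  then show ?thesis unfolding conj_pm_def using h assms by blast
qed

lemma trivial_moves_conj_pm:
  assumes "trivial_moves G P Q" "P \<in> carrier G \<times> carrier G"
  shows "(\<exists>w\<in>{fst P, snd P}. conj_pm G w (fst Q)) \<and> (\<exists>w\<in>{fst P, snd P}. conj_pm G w (snd Q))"
  using assms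
proof (induction rule: trivial_moves.induct)
  case refl
  then show ?case by (auto intro: conj_pm_refl)
next
  case (conj u v k)
  then show ?case by (auto intro: conj_pm_conj)
qed (auto intro: conj_pm_inv)

text \<open>The words of a positive pair contain the letter \<open>y\<close> with one sign only, so that such a word
  does not contain it at all if its exponent sum vanishes.\<close>

theorem primitive_conj_generator:
  fixes n :: "'a \<Rightarrow> int"
  assumes ab: "a \<in> carrier G" "b \<in> carrier G" and nielsen: "nielsen G (a, b) (u, v)"
    and hom: "\<And>g h. g \<in> carrier G \<Longrightarrow> h \<in> carrier G \<Longrightarrow> n (g \<otimes> h) = n g + n h"
    and "n a = 0" "n b \<noteq> 0" "n u = 0"
  shows "conj_pm G a u"
proof -
  obtain x y u0 v0 where *: "x \<in> {a, inv a}" "y \<in> {b, inv b}"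
    "positive_pair G x y u0 v0" "trivial_moves G (u0, v0) (u, v)"
    using nielsen_monotone_pair[OF nielsen ab] by (auto simp: monotone_pair_def)
  have xy: "x \<in> carrier G" "y \<in> carrier G" using * ab by auto
  have c: "u0 \<in> carrier G" "v0 \<in> carrier G" using positive_pair_closed[OF *(3)] xy by auto
  have n1: "n \<one> = 0" using hom[of \<one> \<one>] by simp
  have ninv: "n (inv g) = - n g" if "g \<in> carrier G" for g
    using hom[of g "inv g"] that n1 by simp
  have nx: "n x = 0" and ny: "n y \<noteq> 0" using * assms ninv by auto
  have "0 \<le> sgn (n y) * n u0 \<and> 0 < sgn (n y) * n v0 \<and> (n u0 = 0 \<longrightarrow> u0 = x)"
    using *(3)
  proof (induction rule: positive_pair.induct)
    case base
    then show ?case using nx ny by (simp add: sgn_mult_self_eq abs_sgn[symmetric] mult.commute)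
  next
    case (left u v)
    then show ?case using positive_pair_closed[OF left(1) xy] by (simp add: hom algebra_simps)
  next
    case (right u v)
    then have "0 < sgn (n y) * n (u \<otimes> v)"
      using positive_pair_closed[OF right(1) xy] by (simp add: hom algebra_simps)
    then show ?case using right by auto
  qed
  note pos = this
  obtain w where w: "w \<in> {u0, v0}" "conj_pm G w u"
    using trivial_moves_conj_pm[OF *(4)] c by auto
  then have "n w = 0" using c assms(7) by (auto simp: conj_pm_def hom ninv)
  then have "w = x" using w pos by auto
  then have "conj_pm G x u" using w by simp
  then show ?thesis using *(1) ab by (auto simp: conj_pm_def)
qed

end

section \<open>Traces of representations into the special linear group\<close>

abbreviation ent :: "real^2^2 \<Rightarrow> 2 \<Rightarrow> 2 \<Rightarrow> real" where
  "ent A i j \<equiv> vec_nth (vec_nth A i) j"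

lemma mat2_eq_iff:
  fixes A B :: "real^2^2"
  shows "A = B \<longleftrightarrow> ent A 1 1 = ent B 1 1 \<and> ent A 1 2 = ent B 1 2 \<and> ent A 2 1 = ent B 2 1 \<and> ent A 2 2 = ent B 2 2"
  by (auto simp: vec_eq_iff forall_2)

lemma mat2_simps [simp]:
  fixes A B :: "real^2^2"
  shows "ent (A ** B) 1 1 = ent A 1 1 * ent B 1 1 + ent A 1 2 * ent B 2 1" "ent (A ** B) 1 2 = ent A 1 1 * ent B 1 2 + ent A 1 2 * ent B 2 2"
    "ent (A ** B) 2 1 = ent A 2 1 * ent B 1 1 + ent A 2 2 * ent B 2 1" "ent (A ** B) 2 2 = ent A 2 1 * ent B 1 2 + ent A 2 2 * ent B 2 2"
    "ent (mat 1 :: real^2^2) 1 1 = 1" "ent (mat 1 :: real^2^2) 1 2 = 0" "ent (mat 1 :: real^2^2) 2 1 = 0"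
    "ent (mat 1 :: real^2^2) 2 2 = 1"
  by (simp_all add: matrix_matrix_mult_def sum_2 mat_def)

lemma trace2: "trace (A :: real^2^2) = ent A 1 1 + ent A 2 2"
  by (simp add: trace_def sum_2)

lemma trace2_linear: "trace (A + B) = trace A + trace B" "trace (A - B) = trace A - trace B"
  "trace (c *\<^sub>R A) = c * trace (A :: real^2^2)" "trace (mat 1 :: real^2^2) = 2"
  by (simp_all add: trace2 algebra_simps)

lemma SL2R_simps [simp]:
  "A \<in> carrier SL2R \<longleftrightarrow> det A = 1" "A \<otimes>\<^bsub>SL2R\<^esub> B = A ** B" "\<one>\<^bsub>SL2R\<^esub> = mat 1"
  by (simp_all add: SL2R_def)

lemma adjugate2:
  fixes A :: "real^2^2"
  assumes "det A = 1"
  shows "(trace A *\<^sub>R mat 1 - A) ** A = mat 1" "det (trace A *\<^sub>R mat 1 - A) = 1"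
  using assms by (simp_all add: mat2_eq_iff trace2 det_2 algebra_simps)

lemma group_SL2R: "group SL2R"
proof (rule groupI)
  fix A assume "A \<in> carrier SL2R"
  then show "\<exists>B\<in>carrier SL2R. B \<otimes>\<^bsub>SL2R\<^esub> A = \<one>\<^bsub>SL2R\<^esub>"
    using adjugate2[of A] by auto
qed (auto simp: det_mul matrix_mul_assoc)

lemma inv_SL2R: "det A = 1 \<Longrightarrow> inv\<^bsub>SL2R\<^esub> A = trace A *\<^sub>R mat 1 - A"
  using adjugate2[of A] by (intro group.inv_equality[OF group_SL2R]) auto

definition mat_comb :: "real^2^2 \<Rightarrow> real^2^2 \<Rightarrow> real \<Rightarrow> real \<Rightarrow> real \<Rightarrow> real \<Rightarrow> real^2^2" where
  "mat_comb A B c1 c2 c3 c4 = c1 *\<^sub>R mat 1 + c2 *\<^sub>R A + c3 *\<^sub>R B + c4 *\<^sub>R (A ** B)"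

lemma mat_comb_linear:
  "k *\<^sub>R mat_comb A B c1 c2 c3 c4 - mat_comb A B d1 d2 d3 d4 =
   mat_comb A B (k * c1 - d1) (k * c2 - d2) (k * c3 - d3) (k * c4 - d4)"
  by (simp add: mat_comb_def algebra_simps)

lemma trace_mat_comb:
  "trace (mat_comb A B c1 c2 c3 c4) = 2 * c1 + c2 * trace A + c3 * trace B + c4 * trace (A ** B)"
  by (simp add: mat_comb_def trace2_linear)

text \<open>By the Cayley--Hamilton theorem and its polarisation
  \<open>A B + B A = tr(A) B + tr(B) A + (tr(A B) - tr(A) tr(B)) I\<close>, the span of \<open>I\<close>, \<open>A\<close>, \<open>B\<close> and \<open>A B\<close>
  is closed under multiplication, with structure constants that depend only on the three traces.\<close>

lemma mat_comb_mult:
  assumes A: "det A = 1" and B: "det B = 1"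
  defines "x \<equiv> trace A" and "y \<equiv> trace B" and "z \<equiv> trace (A ** B)"
  shows "A ** mat_comb A B c1 c2 c3 c4 = mat_comb A B (- c2) (c1 + x * c2) (- c4) (c3 + x * c4)"
    and "B ** mat_comb A B c1 c2 c3 c4 =
      mat_comb A B (- c3 + (z - x * y) * c2 - x * c4) (y * c2 + c4) (c1 + x * c2 + y * c3 + z * c4) (- c2)"
proof -
  have CH: "M ** M = trace M *\<^sub>R M - mat 1" if "det M = 1" for M :: "real^2^2"
    using that by (simp add: mat2_eq_iff trace2 det_2 algebra_simps)
  have pol: "B ** A = (z - x * y) *\<^sub>R mat 1 + y *\<^sub>R A + x *\<^sub>R B - A ** B"
    by (simp add: mat2_eq_iff trace2 x_def y_def z_def algebra_simps)
  have scal: "M ** (c *\<^sub>R N) = c *\<^sub>R (M ** N)" "(c *\<^sub>R N) ** M = c *\<^sub>R (N ** M)" for M N :: "real^2^2" and c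
    by (simp_all add: mat2_eq_iff algebra_simps)
  have sub: "M ** (N - K) = M ** N - M ** K" "(N - K) ** M = N ** M - K ** M"
    "M ** (N + K) = M ** N + M ** K" "(N + K) ** M = N ** M + K ** M" for M N K :: "real^2^2"
    by (simp_all add: mat2_eq_iff algebra_simps)
  have AAB: "A ** (A ** B) = x *\<^sub>R (A ** B) - B"
    unfolding matrix_mul_assoc CH[OF A] by (simp add: sub scal x_def)
  have ABB: "A ** B ** B = y *\<^sub>R (A ** B) - A"
    unfolding matrix_mul_assoc[symmetric] CH[OF B] by (simp add: sub scal y_def)
  have BAB: "B ** (A ** B) = - x *\<^sub>R mat 1 + A + z *\<^sub>R B"
    unfolding matrix_mul_assoc pol
    by (simp add: sub scal ABB CH[OF B] y_def[symmetric] algebra_simps)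
  show "A ** mat_comb A B c1 c2 c3 c4 = mat_comb A B (- c2) (c1 + x * c2) (- c4) (c3 + x * c4)"
    unfolding mat_comb_def sub scal AAB CH[OF A] x_def[symmetric]
    by (simp add: algebra_simps)
  show "B ** mat_comb A B c1 c2 c3 c4 =
      mat_comb A B (- c3 + (z - x * y) * c2 - x * c4) (y * c2 + c4) (c1 + x * c2 + y * c3 + z * c4) (- c2)"
    unfolding mat_comb_def sub scal BAB CH[OF B] pol y_def[symmetric]
    by (simp add: algebra_simps)
qed

context group
begin

context
  fixes \<rho> assumes \<rho>: "\<rho> \<in> hom G SL2R"
begin

interpretation \<rho>: group_hom G SL2R \<rho>
  using \<rho> by (intro group_hom.intro group_hom_axioms.intro is_group group_SL2R)

declare \<rho>.hom_mult [simp del] \<rho>.hom_inv [simp del]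

lemma hom_det: "g \<in> carrier G \<Longrightarrow> det (\<rho> g) = 1"
  using \<rho>.hom_closed by auto

lemma hom_mult_matrix: "g \<in> carrier G \<Longrightarrow> h \<in> carrier G \<Longrightarrow> \<rho> (g \<otimes> h) = \<rho> g ** \<rho> h"
  using \<rho>.hom_mult[of g h] by simp

lemma hom_inv_matrix: "g \<in> carrier G \<Longrightarrow> \<rho> (inv g) = trace (\<rho> g) *\<^sub>R mat 1 - \<rho> g"
  using \<rho>.hom_inv[of g] inv_SL2R[OF hom_det[of g]] by simp

lemma trace_inv: "g \<in> carrier G \<Longrightarrow> trace (\<rho> (inv g)) = trace (\<rho> g)"
  unfolding hom_inv_matrix trace2_linear by simp

lemma trace_commute: "g \<in> carrier G \<Longrightarrow> h \<in> carrier G \<Longrightarrow> trace (\<rho> (g \<otimes> h)) = trace (\<rho> (h \<otimes> g))"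
  using trace_mul_sym[of "\<rho> g" "\<rho> h"] by (simp only: hom_mult_matrix)

lemma trace_conj:
  assumes "g \<in> carrier G" "k \<in> carrier G"
  shows "trace (\<rho> (k \<otimes> g \<otimes> inv k)) = trace (\<rho> g)"
  using trace_commute[of "k \<otimes> g" "inv k"] assms by simp

lemma trace_inv_mult:
  assumes "g \<in> carrier G" "h \<in> carrier G"
  shows "trace (\<rho> (inv g \<otimes> h)) = trace (\<rho> g) * trace (\<rho> h) - trace (\<rho> (g \<otimes> h))"
proof -
  have "(c *\<^sub>R mat 1 - M) ** N = c *\<^sub>R N - M ** N" for M N :: "real^2^2" and c
    by (simp add: mat2_eq_iff algebra_simps)
  then show ?thesis using assms by (simp add: hom_mult_matrix hom_inv_matrix trace2_linear)
qed

lemma trace_square_mult: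
  assumes "u \<in> carrier G" "v \<in> carrier G"
  shows "trace (\<rho> (u \<otimes> (u \<otimes> v))) = trace (\<rho> u) * trace (\<rho> (u \<otimes> v)) - trace (\<rho> v)"
  using trace_inv_mult[of u "u \<otimes> v"] assms by simp

end

text \<open>Fricke's theorem: write the word letter by letter as an element of the span of \<open>I\<close>, \<open>A\<close>, \<open>B\<close>, \<open>A B\<close>. The
  coefficients depend only on the three traces, and so does the trace of the result.\<close>

lemma trace_determined:
  assumes \<rho>: "\<rho> \<in> hom G SL2R" and \<rho>': "\<rho>' \<in> hom G SL2R"
    and uv: "u \<in> carrier G" "v \<in> carrier G" "generate G {u, v} = carrier G"
    and tr: "trace (\<rho> u) = trace (\<rho>' u)" "trace (\<rho> v) = trace (\<rho>' v)"
      "trace (\<rho> (u \<otimes> v)) = trace (\<rho>' (u \<otimes> v))"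
    and g: "g \<in> carrier G"
  shows "trace (\<rho> g) = trace (\<rho>' g)"
proof -
  define A B A' B' where "A = \<rho> u" and "B = \<rho> v" and "A' = \<rho>' u" and "B' = \<rho>' v"
  note defs = A_def B_def A'_def B'_def
  have det: "det A = 1" "det B = 1" "det A' = 1" "det B' = 1"
    unfolding defs using hom_det \<rho> \<rho>' uv by auto
  have tr': "trace A = trace A'" "trace B = trace B'" "trace (A ** B) = trace (A' ** B')"
    using tr uv \<rho> \<rho>' by (auto simp: defs hom_mult_matrix)
  define S where "S M N \<longleftrightarrow> (\<exists>c1 c2 c3 c4. M = mat_comb A B c1 c2 c3 c4 \<and> N = mat_comb A' B' c1 c2 c3 c4)"
    for M N
  have SA: "S (A ** M) (A' ** N)" and SB: "S (B ** M) (B' ** N)" if "S M N" for M N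
    using that unfolding S_def
    by (metis mat_comb_mult(1)[OF det(1,2)] mat_comb_mult(1)[OF det(3,4)] tr',
        metis mat_comb_mult(2)[OF det(1,2)] mat_comb_mult(2)[OF det(3,4)] tr')
  have SL: "S (k *\<^sub>R M - M') (k *\<^sub>R N - N')" if "S M N" "S M' N'" for k M N M' N'
    using that unfolding S_def by (metis mat_comb_linear)
  have lin: "(c *\<^sub>R mat 1 - M) ** N = c *\<^sub>R N - M ** N" for M N :: "real^2^2" and c
    by (simp add: mat2_eq_iff algebra_simps)
  obtain w where w: "set w \<subseteq> {u, v} \<times> UNIV" "word_value G w = g"
    using generate_reduced_word[of "{u, v}" g] uv g by auto
  have "S (\<rho> (word_value G w)) (\<rho>' (word_value G w))"
    using w(1)
  proof (induction w)
    case Nil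
    have "\<rho> \<one> = mat 1" "\<rho>' \<one> = mat 1"
      using hom_one[OF \<rho> is_group group_SL2R] hom_one[OF \<rho>' is_group group_SL2R] by auto
    moreover have "S (mat 1) (mat 1)" unfolding S_def mat_comb_def
      by (intro exI[of _ 1] exI[of _ 0]) simp
    ultimately show ?case by simp
  next
    case (Cons l w)
    define W where "W = word_value G w"
    have W: "W \<in> carrier G" unfolding W_def
      using Cons.prems uv by (intro word_value_closed[of _ "{u, v}"]) auto
    have IH: "S (\<rho> W) (\<rho>' W)" using Cons by (simp add: W_def)
    have eq: "\<rho> (u \<otimes> W) = A ** \<rho> W" "\<rho>' (u \<otimes> W) = A' ** \<rho>' W"
      "\<rho> (v \<otimes> W) = B ** \<rho> W" "\<rho>' (v \<otimes> W) = B' ** \<rho>' W"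
      "\<rho> (inv u \<otimes> W) = trace A *\<^sub>R \<rho> W - A ** \<rho> W" "\<rho>' (inv u \<otimes> W) = trace A *\<^sub>R \<rho>' W - A' ** \<rho>' W"
      "\<rho> (inv v \<otimes> W) = trace B *\<^sub>R \<rho> W - B ** \<rho> W" "\<rho>' (inv v \<otimes> W) = trace B *\<^sub>R \<rho>' W - B' ** \<rho>' W"
      using W uv \<rho> \<rho>' tr' by (simp_all add: defs hom_mult_matrix hom_inv_matrix lin)
    have "S (\<rho> (k \<otimes> W)) (\<rho>' (k \<otimes> W))" if "k \<in> {u, v, inv u, inv v}" for k
      using that SA[OF IH] SB[OF IH] SL[OF IH SA[OF IH]] SL[OF IH SB[OF IH]] by (auto simp: eq)
    moreover have "letter_value G l \<in> {u, v, inv u, inv v}"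
      using Cons.prems by (auto simp: letter_value_def)
    ultimately show ?case by (simp add: W_def)
  qed
  then show ?thesis
    unfolding S_def w(2) using tr' by (auto simp: trace_mat_comb)
qed

end

lemma T_tr_iff:
  "(x, y, z) \<in> T_tr \<longleftrightarrow> 0 < x \<and> 0 < y \<and> 0 < z \<and> x\<^sup>2 + y\<^sup>2 + z\<^sup>2 = x * y * z"
  by (auto simp: T_tr_def)

lemma T_tr_swap: "(x, y, z) \<in> T_tr \<Longrightarrow> (y, x, z) \<in> T_tr"
  by (auto simp: T_tr_iff algebra_simps)

lemma T_tr_rotate: "(x, y, z) \<in> T_tr \<Longrightarrow> (x, z, y) \<in> T_tr"
  by (auto simp: T_tr_iff algebra_simps)

text \<open>For fixed \<open>x\<close> and \<open>y\<close> the equation is quadratic in the last coordinate; \<open>x y - z\<close> is its other root,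
  which is positive because the product of the roots is \<open>x\<^sup>2 + y\<^sup>2\<close>.\<close>

lemma T_tr_vieta:
  assumes "(x, y, z) \<in> T_tr"
  shows "z * (x * y - z) = x\<^sup>2 + y\<^sup>2" "(x, y, x * y - z) \<in> T_tr"
proof -
  show eq: "z * (x * y - z) = x\<^sup>2 + y\<^sup>2" using assms by (simp add: T_tr_iff power2_eq_square algebra_simps)
  moreover have "0 < x\<^sup>2 + y\<^sup>2" using assms by (simp add: T_tr_iff add_pos_pos)
  ultimately have "0 < x * y - z" using assms by (metis T_tr_iff zero_less_mult_pos)
  then show "(x, y, x * y - z) \<in> T_tr"
    using assms by (simp add: T_tr_iff power2_eq_square algebra_simps)
qed

text \<open>The two matrices are normalised such that \<open>A B\<close> has lower row \<open>(1, 0)\<close>. Their determinants are \<open>1\<close>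
  precisely by the equation of the trace coordinates.\<close>

lemma T_tr_matrices:
  assumes "(x, y, z) \<in> T_tr"
  shows "\<exists>A B. det A = 1 \<and> det B = 1 \<and> trace A = x \<and> trace B = y \<and> trace (A ** B :: real^2^2) = z"
proof -
  have z: "z \<noteq> 0" and eq: "x\<^sup>2 + y\<^sup>2 + z\<^sup>2 = x * y * z" using assms by (auto simp: T_tr_iff)
  define A B :: "real^2^2"
    where "A = vector [vector [(x * z - y) / z, x / z], vector [x / z, y / z]]"
      and "B = vector [vector [(y * z - x) / z, - y / z], vector [- y / z, x / z]]"
  have "(x * z - y) * y - x * x = z * z" "(y * z - x) * x - y * y = z * z"
    using eq by (simp_all add: power2_eq_square algebra_simps)
  then have "det A = 1" "det B = 1"
    using z by (simp_all add: A_def B_def det_2 vector_2 field_simps)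
  moreover have "trace A = x" "trace B = y"
    using z by (simp_all add: A_def B_def trace2 vector_2 field_simps)
  moreover have "(x * z - y) * (y * z - x) - x * y = z * (x * y * z - x\<^sup>2 - y\<^sup>2)"
    by (simp add: power2_eq_square algebra_simps)
  then have "(x * z - y) * (y * z - x) - x * y = z * z * z"
    using eq by (simp add: power2_eq_square)
  then have "trace (A ** B) = z"
    using z by (simp add: A_def B_def trace2 vector_2 field_simps)
  ultimately show ?thesis by blast
qed

definition (in group) trace_triple :: "('a \<Rightarrow> real^2^2) \<Rightarrow> 'a \<Rightarrow> 'a \<Rightarrow> real \<times> real \<times> real" where
  "trace_triple \<rho> u v = (trace (\<rho> u), trace (\<rho> v), trace (\<rho> (u \<otimes> v)))"

context group
begin

text \<open>A Nielsen move permutes the three traces, possibly after replacing one of them by the other root of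
  the quadratic equation.\<close>

lemma nielsen_T_tr:
  assumes \<rho>: "\<rho> \<in> hom G SL2R" and "nielsen G P Q" "P \<in> carrier G \<times> carrier G"
    and "trace_triple \<rho> (fst P) (snd P) \<in> T_tr"
  shows "trace_triple \<rho> (fst Q) (snd Q) \<in> T_tr"
  using assms(2-)
proof (induction rule: nielsen.induct)
  case (swap u v)
  then have "u \<in> carrier G" "v \<in> carrier G" using nielsen_closed by blast+
  then show ?case
    using T_tr_swap swap trace_commute[OF \<rho>, of u v] by (auto simp: trace_triple_def)
next
  case (invert u v)
  then have "u \<in> carrier G" "v \<in> carrier G" using nielsen_closed by blast+
  then show ?case
    using T_tr_vieta(2) invert by (auto simp: trace_triple_def trace_inv[OF \<rho>] trace_inv_mult[OF \<rho>])
next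
  case (mult u v)
  then have "u \<in> carrier G" "v \<in> carrier G" using nielsen_closed by blast+
  then show ?case
    using T_tr_vieta(2)[OF T_tr_rotate] mult by (auto simp: trace_triple_def trace_square_mult[OF \<rho>])
next
  case (conj u v k)
  then have c: "u \<in> carrier G" "v \<in> carrier G" using nielsen_closed by blast+
  then have "(k \<otimes> u \<otimes> inv k) \<otimes> (k \<otimes> v \<otimes> inv k) = k \<otimes> (u \<otimes> v) \<otimes> inv k"
    using conj by (simp add: m_assoc)
  then show ?case
    using conj c by (simp add: trace_triple_def trace_conj[OF \<rho>])
qed simp

text \<open>The effect of a move on the traces is invertible, so prescribed traces of the moved pair can be
  translated into traces of the pair before the move.\<close>

lemma trace_triple_realized:
  assumes free: "free_on G {a, b}" and ab: "a \<noteq> b" and "nielsen G (a, b) Q" and X: "X \<in> T_tr"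
  shows "\<exists>\<rho>\<in>hom G SL2R. trace_triple \<rho> (fst Q) (snd Q) = X"
  using assms(3) X
proof (induction arbitrary: X rule: nielsen.induct)
  interpret free_group G "{a, b}" by unfold_locales fact
  have abG: "(a, b) \<in> carrier G \<times> carrier G" using X_closed by auto
  {
    case refl
    obtain x y z where X: "X = (x, y, z)" by (cases X)
    obtain A B :: "real^2^2" where AB: "det A = 1" "det B = 1" "trace A = x" "trace B = y" "trace (A ** B) = z"
      using T_tr_matrices refl X by blast
    have "(\<lambda>g. if g = a then A else B) \<in> {a, b} \<rightarrow> carrier SL2R" using AB by auto
    from hom_extension[OF group_SL2R this]
    obtain \<rho> where "\<rho> \<in> hom G SL2R" "\<rho> a = A" "\<rho> b = B" using ab by auto
    then show ?case using AB ab abG X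
      by (intro bexI[of _ \<rho>]) (auto simp: trace_triple_def hom_mult_matrix)
  next
    case (swap u v)
    obtain x y z where X: "X = (x, y, z)" by (cases X)
    have c: "u \<in> carrier G" "v \<in> carrier G" using nielsen_closed swap abG by blast+
    obtain \<rho> where "\<rho> \<in> hom G SL2R" "trace_triple \<rho> u v = (y, x, z)"
      using swap.IH[of "(y, x, z)"] T_tr_swap swap.prems X by auto
    then show ?case using X c trace_commute[of \<rho> u v]
      by (intro bexI[of _ \<rho>]) (auto simp: trace_triple_def)
  next
    case (invert u v)
    obtain x y z where X: "X = (x, y, z)" by (cases X)
    have c: "u \<in> carrier G" "v \<in> carrier G" using nielsen_closed invert abG by blast+
    obtain \<rho> where "\<rho> \<in> hom G SL2R" "trace_triple \<rho> u v = (x, y, x * y - z)"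
      using invert.IH[of "(x, y, x * y - z)"] T_tr_vieta invert.prems X by auto
    then show ?case using X c
      by (intro bexI[of _ \<rho>]) (auto simp: trace_triple_def trace_inv trace_inv_mult)
  next
    case (mult u v)
    obtain x y z where X: "X = (x, y, z)" by (cases X)
    have c: "u \<in> carrier G" "v \<in> carrier G" using nielsen_closed mult abG by blast+
    obtain \<rho> where "\<rho> \<in> hom G SL2R" "trace_triple \<rho> u v = (x, x * y - z, y)"
      using mult.IH[of "(x, x * y - z, y)"] T_tr_rotate T_tr_vieta(2) mult.prems X by auto
    then show ?case using X c
      by (intro bexI[of _ \<rho>]) (auto simp: trace_triple_def trace_square_mult)
  next
    case (conj u v k)
    have c: "u \<in> carrier G" "v \<in> carrier G" using nielsen_closed conj abG by blast+
    have "(k \<otimes> u \<otimes> inv k) \<otimes> (k \<otimes> v \<otimes> inv k) = k \<otimes> (u \<otimes> v) \<otimes> inv k"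
      using c conj by (simp add: m_assoc)
    then show ?case using conj.IH[OF conj.prems] conj c by (simp add: trace_triple_def trace_conj)
  }
qed

end

section \<open>Growth of traces along an earthquake\<close>

text \<open>The leading coefficient of the trace of a primitive element with homology class \<open>(m, n)\<close> along the
  earthquake about \<open>(1, 0)\<close>; the trace grows as \<open>exp (\<bar>n\<bar> s / 2)\<close>. Here \<open>l\<close> is the length of the curve \<open>(1, 0)\<close>, and
  \<open>exp c\<close> is the coefficient of \<open>(0, 1)\<close>. For \<open>n = 0\<close> the trace is constant. The coefficient depends on the
  sign of \<open>m n\<close>, and thereby records the direction of the twist.\<close>

definition growth_const :: "real \<Rightarrow> real \<Rightarrow> int \<Rightarrow> int \<Rightarrow> real" where
  "growth_const c l m n =
     (if n = 0 then 2 * cosh (m * l / 2) else exp (\<bar>n\<bar> * c - sgn n * m * l / 2))"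

definition growth :: "real \<Rightarrow> real \<Rightarrow> int \<Rightarrow> int \<Rightarrow> (real \<Rightarrow> real) \<Rightarrow> bool" where
  "growth c l m n f \<longleftrightarrow> ((\<lambda>s. f s * exp (- (\<bar>n\<bar> * s / 2))) \<longlongrightarrow> growth_const c l m n) at_top"

lemma growth_const_pos: "0 < growth_const c l m n"
  by (simp add: growth_const_def)

lemma growth_const_minus: "growth_const c l (- m) (- n) = growth_const c l m n"
  by (simp add: growth_const_def)

lemma growth_minus: "growth c l (- m) (- n) f \<longleftrightarrow> growth c l m n f"
  by (simp add: growth_def growth_const_minus)

lemma cosh_two: "2 * cosh (x :: real) = exp x + exp (- x)"
  by (simp add: cosh_def)

lemma growth_const_positive: "0 < n \<Longrightarrow> growth_const c l m n = exp (n * c - m * l / 2)"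
  by (simp add: growth_const_def)

lemma growth_const_dominant:
  assumes "\<bar>y\<bar> < \<bar>x\<bar>"
  shows "growth_const c l (m + k) (x + y) * growth_const c l (m - k) (x - y) = (growth_const c l m x)\<^sup>2"
proof -
  have pos: "growth_const c l (m + k) (x + y) * growth_const c l (m - k) (x - y) = (growth_const c l m x)\<^sup>2"
    if "\<bar>y\<bar> < x" for m k x y
  proof -
    have "0 < x + y" "0 < x - y" "0 < x" using that by linarith+
    then show ?thesis
      by (simp only: growth_const_positive power2_eq_square exp_add[symmetric])
        (simp add: algebra_simps add_divide_distrib diff_divide_distrib)
  qed
  show ?thesis
  proof (cases "0 < x")
    case False
    then show ?thesis
      using pos[of "- y" "- x" "- m" "- k"] assms growth_const_minus[of c l "m + k" "x + y"]
        growth_const_minus[of c l "m - k" "x - y"] growth_const_minus[of c l m x] by simp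
  qed (use pos assms in simp)
qed

lemma growth_const_balanced:
  assumes "n \<noteq> 0"
  shows "growth_const c l (m + k) (n + n) * growth_const c l (m - k) 0 =
    (growth_const c l m n)\<^sup>2 + (growth_const c l k n)\<^sup>2"
proof -
  have pos: "growth_const c l (m + k) (n + n) * growth_const c l (m - k) 0 =
      (growth_const c l m n)\<^sup>2 + (growth_const c l k n)\<^sup>2" if "0 < n" for m k n
  proof -
    have "growth_const c l (m - k) 0 = exp ((m - k) * l / 2) + exp (- ((m - k) * l / 2))"
      by (simp add: growth_const_def cosh_two)
    then show ?thesis using that
      by (simp add: growth_const_positive power2_eq_square distrib_left exp_add[symmetric])
        (simp add: algebra_simps add_divide_distrib diff_divide_distrib)
  qed
  show ?thesis
  proof (cases "0 < n")
    case False
    then show ?thesis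
      using pos[of "- n" "- m" "- k"] assms growth_const_minus[of c l "m + k" "n + n"]
        growth_const_minus[of c l "m - k" 0] growth_const_minus[of c l m n] growth_const_minus[of c l k n]
      by simp
  qed (use pos in simp)
qed

text \<open>If the growth rates of \<open>A\<close> and \<open>B\<close> differ, only the larger square survives, and the exponents add up.
  If they agree, then one of \<open>A + B\<close> and \<open>B - A\<close> does not grow, and its factor \<open>2 cosh\<close> is the sum of two
  exponentials.\<close>

lemma growth_const_vieta:
  assumes "nA \<noteq> 0 \<or> nB \<noteq> 0"
  shows "growth_const c l (mA + mB) (nA + nB) * growth_const c l (mB - mA) (nB - nA) =
    (if \<bar>nB\<bar> \<le> \<bar>nA\<bar> then (growth_const c l mA nA)\<^sup>2 else 0) +
    (if \<bar>nA\<bar> \<le> \<bar>nB\<bar> then (growth_const c l mB nB)\<^sup>2 else 0)"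
proof -
  have swap: "growth_const c l (mB - mA) (nB - nA) = growth_const c l (mA - mB) (nA - nB)"
    using growth_const_minus[of c l "mA - mB" "nA - nB"] by simp
  consider "\<bar>nB\<bar> < \<bar>nA\<bar>" | "\<bar>nA\<bar> < \<bar>nB\<bar>" | "nB = nA" | "nB = - nA" by linarith
  then show ?thesis
  proof cases
    case 1
    then show ?thesis using growth_const_dominant[OF 1, of c l mA mB] by (simp add: swap)
  next
    case 2
    then show ?thesis using growth_const_dominant[OF 2, of c l mB mA] by (simp add: add.commute)
  next
    case 3
    then show ?thesis using growth_const_balanced[of nA c l mB mA] assms by (simp add: add.commute)
  next
    case 4
    then show ?thesis
      using growth_const_balanced[of nB c l mB "- mA"] growth_const_minus[of c l mA nA] assms
      by (simp add: mult.commute add.commute)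
  qed
qed

text \<open>The product of the traces of \<open>A B\<close> and \<open>A\<^sup>-\<^sup>1 B\<close> is the sum of two squares, so no cancellation
  occurs and the growth of one factor determines that of the other.\<close>

lemma growth_vieta:
  assumes A: "growth c l mA nA fA" and B: "growth c l mB nB fB" and D: "growth c l (mB - mA) (nB - nA) fD"
    and eq: "\<And>s. fD s * fE s = (fA s)\<^sup>2 + (fB s)\<^sup>2" and pos: "\<And>s. 0 < fD s" and n: "nA \<noteq> 0 \<or> nB \<noteq> 0"
  shows "growth c l (mA + mB) (nA + nB) fE"
proof -
  define M where "M = max \<bar>nA\<bar> \<bar>nB\<bar>"
  have sq: "((\<lambda>s::real. (f s)\<^sup>2 * exp (- (M * s))) \<longlongrightarrow> (if M = \<bar>k\<bar> then (growth_const c l m k)\<^sup>2 else 0)) at_top"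
    if "growth c l m k f" "\<bar>k\<bar> \<le> M" for f m k
  proof -
    have l1: "((\<lambda>s::real. exp (- (real_of_int (M - \<bar>k\<bar>) * s))) \<longlongrightarrow> (if M = \<bar>k\<bar> then 1 else 0)) at_top"
    proof (cases "M = \<bar>k\<bar>")
      case False
      then have "0 < real_of_int (M - \<bar>k\<bar>)" using that by simp
      then have "((\<lambda>s::real. exp (- (real_of_int (M - \<bar>k\<bar>) * s))) \<longlongrightarrow> 0) at_top"
        by real_asymp
      with False show ?thesis by simp
    qed simp
    have l2: "((\<lambda>s::real. f s * exp (- (\<bar>k\<bar> * s / 2))) \<longlongrightarrow> growth_const c l m k) at_top"
      using that by (simp add: growth_def)
    note tendsto_mult[OF tendsto_power[OF l2, of 2] l1]
    moreover have "(f s * exp (- (\<bar>k\<bar> * s / 2)))\<^sup>2 * exp (- (real_of_int (M - \<bar>k\<bar>) * s)) = (f s)\<^sup>2 * exp (- (M * s))" for s :: real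
      by (simp add: power_mult_distrib power2_eq_square algebra_simps flip: exp_add)
    ultimately show ?thesis by (cases "M = \<bar>k\<bar>") simp_all
  qed
  define L where "L = growth_const c l (mA + mB) (nA + nB) * growth_const c l (mB - mA) (nB - nA)"
  have "((\<lambda>s::real. (fA s)\<^sup>2 * exp (- (M * s)) + (fB s)\<^sup>2 * exp (- (M * s))) \<longlongrightarrow> L) at_top"
  proof -
    have "L = (if M = \<bar>nA\<bar> then (growth_const c l mA nA)\<^sup>2 else 0) + (if M = \<bar>nB\<bar> then (growth_const c l mB nB)\<^sup>2 else 0)"
      unfolding L_def growth_const_vieta[OF n] by (auto simp: M_def)
    then show ?thesis using tendsto_add[OF sq[OF A] sq[OF B]] by (simp add: M_def)
  qed
  then have "((\<lambda>s::real. ((fA s)\<^sup>2 * exp (- (M * s)) + (fB s)\<^sup>2 * exp (- (M * s)))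
      / (fD s * exp (- (\<bar>nB - nA\<bar> * s / 2)))) \<longlongrightarrow> L / growth_const c l (mB - mA) (nB - nA)) at_top"
    using growth_const_pos[of c l "mB - mA" "nB - nA"] D
    by (intro tendsto_divide) (auto simp: growth_def)
  moreover have "((fA s)\<^sup>2 * exp (- (M * s)) + (fB s)\<^sup>2 * exp (- (M * s))) / (fD s * exp (- (\<bar>nB - nA\<bar> * s / 2)))
      = fE s * exp (- (\<bar>nA + nB\<bar> * s / 2))" for s :: real
  proof -
    have "\<bar>nA + nB\<bar> + \<bar>nB - nA\<bar> = 2 * M" unfolding M_def by linarith
    then have "real_of_int \<bar>nA + nB\<bar> + real_of_int \<bar>nB - nA\<bar> = 2 * real_of_int M"
      by (metis of_int_add of_int_mult of_int_numeral)
    moreover have "k * s = p * s / 2 + q * s / 2" if "p + q = 2 * k" for p q k :: real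
    proof -
      have "k * s = (p + q) / 2 * s" using that by simp
      also have "\<dots> = p * s / 2 + q * s / 2" by (simp add: field_simps)
      finally show ?thesis .
    qed
    ultimately have M: "M * s = \<bar>nA + nB\<bar> * s / 2 + \<bar>nB - nA\<bar> * s / 2" by blast
    have "((fA s)\<^sup>2 + (fB s)\<^sup>2) * exp (- (M * s)) =
        (fD s * exp (- (\<bar>nB - nA\<bar> * s / 2))) * (fE s * exp (- (\<bar>nA + nB\<bar> * s / 2)))"
      unfolding M eq[symmetric] minus_add_distrib exp_add by simp
    then show ?thesis using pos[of s] by (simp add: field_simps)
  qed
  moreover have "L / growth_const c l (mB - mA) (nB - nA) = growth_const c l (mA + mB) (nA + nB)"
    using growth_const_pos[of c l "mB - mA" "nB - nA"] by (simp add: L_def)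
  ultimately show ?thesis by (simp add: growth_def)
qed

context group
begin

text \<open>The induction carries the growth of \<open>u\<^sup>-\<^sup>1 v\<close> along with that of \<open>u v\<close>, so that the identity for the
  product of these two traces provides the one new trace that a move creates. The determinant of the homology
  classes stays nonzero, which excludes that both rates vanish.\<close>

lemma nielsen_growth:
  fixes \<rho> :: "real \<Rightarrow> 'a \<Rightarrow> real^2^2" and m n :: "'a \<Rightarrow> int" and c l :: real
  assumes \<rho>: "\<And>s. \<rho> s \<in> hom G SL2R" and "nielsen G P Q" and P: "P \<in> carrier G \<times> carrier G"
    and T: "\<And>s. trace_triple (\<rho> s) (fst P) (snd P) \<in> T_tr"
    and m: "\<And>g h. g \<in> carrier G \<Longrightarrow> h \<in> carrier G \<Longrightarrow> m (g \<otimes> h) = m g + m h"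
    and n: "\<And>g h. g \<in> carrier G \<Longrightarrow> h \<in> carrier G \<Longrightarrow> n (g \<otimes> h) = n g + n h"
    and det: "m (fst P) * n (snd P) - m (snd P) * n (fst P) \<noteq> 0"
  defines "gr \<equiv> (\<lambda>g. growth c l (m g) (n g) (\<lambda>s. trace (\<rho> s g)))"
  assumes base: "gr (fst P)" "gr (snd P)" "gr (fst P \<otimes> snd P)" "gr (inv (fst P) \<otimes> snd P)"
  shows "gr (fst Q) \<and> gr (snd Q) \<and> gr (fst Q \<otimes> snd Q) \<and> gr (inv (fst Q) \<otimes> snd Q) \<and>
    m (fst Q) * n (snd Q) - m (snd Q) * n (fst Q) \<noteq> 0"
  using assms(2)
proof (induction rule: nielsen.induct)
  case refl
  then show ?case using base det by simp
next
  have inv_hom: "m (inv g) = - m g" "n (inv g) = - n g" if "g \<in> carrier G" for g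
    using m[of g "inv g"] m[of \<one> \<one>] n[of g "inv g"] n[of \<one> \<one>] that by simp_all
  have gr_inv: "gr (inv g) \<longleftrightarrow> gr g" if "g \<in> carrier G" for g
    using that by (simp add: gr_def inv_hom growth_minus trace_inv[OF \<rho>])
  have gr_commute: "gr (g \<otimes> h) \<longleftrightarrow> gr (h \<otimes> g)" if "g \<in> carrier G" "h \<in> carrier G" for g h
    using that by (simp add: gr_def m n trace_commute[OF \<rho>, of g h] add.commute)
  {
    case (swap u v)
    then have c: "u \<in> carrier G" "v \<in> carrier G" using nielsen_closed P by blast+
    have "gr (inv (inv u \<otimes> v))" using swap c by (subst gr_inv) auto
    then have "gr (inv v \<otimes> u)" using c by (simp add: inv_mult_group)
    then show ?case using swap c gr_commute[of u v] by (auto simp: algebra_simps)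
  next
    case (invert u v)
    then have c: "u \<in> carrier G" "v \<in> carrier G" using nielsen_closed P by blast+
    then show ?case using invert gr_inv[of u] by (auto simp: inv_hom algebra_simps)
  next
    case (mult u v)
    then have c: "u \<in> carrier G" "v \<in> carrier G" using nielsen_closed P by blast+
    have tri: "(trace (\<rho> s u), trace (\<rho> s v), trace (\<rho> s (u \<otimes> v))) \<in> T_tr" for s
      using nielsen_T_tr[OF \<rho> mult(1) P T, of s] by (simp add: trace_triple_def)
    have "growth c l (m u + m (u \<otimes> v)) (n u + n (u \<otimes> v)) (\<lambda>s. trace (\<rho> s (u \<otimes> (u \<otimes> v))))"
    proof (rule growth_vieta[where fD = "\<lambda>s. trace (\<rho> s v)" and fA = "\<lambda>s. trace (\<rho> s u)"
          and fB = "\<lambda>s. trace (\<rho> s (u \<otimes> v))"])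
      show "growth c l (m u) (n u) (\<lambda>s. trace (\<rho> s u))"
        "growth c l (m (u \<otimes> v)) (n (u \<otimes> v)) (\<lambda>s. trace (\<rho> s (u \<otimes> v)))"
        "growth c l (m (u \<otimes> v) - m u) (n (u \<otimes> v) - n u) (\<lambda>s. trace (\<rho> s v))"
        using mult.IH c by (simp_all add: gr_def m n)
      show "trace (\<rho> s v) * trace (\<rho> s (u \<otimes> (u \<otimes> v))) = (trace (\<rho> s u))\<^sup>2 + (trace (\<rho> s (u \<otimes> v)))\<^sup>2" for s
        using T_tr_vieta(1)[OF T_tr_rotate[OF tri[of s]]] c by (simp add: trace_square_mult[OF \<rho>])
      show "0 < trace (\<rho> s v)" for s using tri[of s] by (simp add: T_tr_iff)
      show "n u \<noteq> 0 \<or> n (u \<otimes> v) \<noteq> 0" using mult.IH c by (auto simp: n)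
    qed
    then have "gr (u \<otimes> (u \<otimes> v))" using c by (simp add: gr_def m n)
    then show ?case using mult.IH c by (auto simp: m n algebra_simps)
  next
    case (conj u v k)
    then have c: "u \<in> carrier G" "v \<in> carrier G" using nielsen_closed P by blast+
    have gr_conj: "gr (k \<otimes> g \<otimes> inv k) \<longleftrightarrow> gr g" if "g \<in> carrier G" for g
      using that conj by (simp add: gr_def m n inv_hom trace_conj[OF \<rho>])
    have eq: "(k \<otimes> u \<otimes> inv k) \<otimes> (k \<otimes> v \<otimes> inv k) = k \<otimes> (u \<otimes> v) \<otimes> inv k"
      "inv (k \<otimes> u \<otimes> inv k) \<otimes> (k \<otimes> v \<otimes> inv k) = k \<otimes> (inv u \<otimes> v) \<otimes> inv k"
      using c conj by (simp_all add: m_assoc inv_mult_group)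
    show ?case using conj c unfolding fst_conv snd_conv eq
      by (auto simp: gr_conj m n inv_hom)
  }
qed

end

section \<open>Fenchel--Nielsen coordinates\<close>

lemma FN_to_tr_eq:
  "FN_to_tr (l, t) = (2 * cosh (l / 2), 2 * (cosh (l / 2) / sinh (l / 2)) * cosh (t / 2),
     2 * (cosh (l / 2) / sinh (l / 2)) * cosh ((t + l) / 2))"
  by (simp add: FN_to_tr_def Let_def)

text \<open>In the variables of Fenchel and Nielsen the equation of the trace coordinates is this identity.\<close>

lemma cosh_squares:
  fixes a b :: real
  shows "(sinh (b - a))\<^sup>2 + (cosh a)\<^sup>2 + (cosh b)\<^sup>2 = 2 * cosh (b - a) * cosh a * cosh b"
proof -
  define L where "L = b - a"
  have "(cosh L)\<^sup>2 = (sinh L)\<^sup>2 + 1" "(cosh a)\<^sup>2 = (sinh a)\<^sup>2 + 1"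
    by (simp_all add: cosh_square_eq)
  moreover have "cosh b = cosh a * cosh L + sinh a * sinh L"
    using cosh_add[of a L] by (simp add: L_def)
  ultimately show ?thesis unfolding L_def[symmetric] by algebra
qed

lemma FN_to_tr_in_T_tr:
  assumes "u \<in> FN_space" shows "FN_to_tr u \<in> T_tr"
proof -
  obtain l t where u: "u = (l, t)" "0 < l" using assms by (auto simp: FN_space_def)
  define C S p q where "C = cosh (l / 2)" and "S = sinh (l / 2)" and "p = cosh (t / 2)"
    and "q = cosh ((t + l) / 2)"
  have pos: "0 < C" "0 < S" "0 < p" "0 < q" using u by (auto simp: C_def S_def p_def q_def)
  have "(t + l) / 2 - t / 2 = l / 2" by (simp add: field_simps)
  then have eq: "S\<^sup>2 + p\<^sup>2 + q\<^sup>2 = 2 * C * p * q"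
    using cosh_squares[of "(t + l) / 2" "t / 2"] by (simp only: C_def S_def p_def q_def)
  have "(2 * C)\<^sup>2 + (2 * (C / S) * p)\<^sup>2 + (2 * (C / S) * q)\<^sup>2 = 4 * (C / S)\<^sup>2 * (S\<^sup>2 + p\<^sup>2 + q\<^sup>2)"
    using pos by (simp add: field_simps power2_eq_square)
  also have "\<dots> = (2 * C) * (2 * (C / S) * p) * (2 * (C / S) * q)"
    unfolding eq by (simp add: power2_eq_square)
  finally show ?thesis
    using pos unfolding u FN_to_tr_eq T_tr_iff C_def[symmetric] S_def[symmetric] p_def[symmetric]
      q_def[symmetric] by simp
qed

lemma cosh_real_abs_eq: "cosh (a :: real) = cosh b \<longleftrightarrow> \<bar>a\<bar> = \<bar>b\<bar>"
  using cosh_real_nonneg_less_iff[of "\<bar>a\<bar>" "\<bar>b\<bar>"] cosh_real_nonneg_less_iff[of "\<bar>b\<bar>" "\<bar>a\<bar>"]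
  by (auto simp: cosh_real_abs)

lemma FN_to_tr_inj: "inj_on FN_to_tr FN_space"
proof (rule inj_onI)
  fix u v assume uv: "u \<in> FN_space" "v \<in> FN_space" "FN_to_tr u = FN_to_tr v"
  obtain l t l' t' where eq: "u = (l, t)" "v = (l', t')" "0 < l" "0 < l'"
    using uv by (auto simp: FN_space_def)
  have "cosh (l / 2) = cosh (l' / 2)" using uv(3) by (simp add: eq FN_to_tr_eq)
  then have l: "l = l'" using eq by (simp add: cosh_real_abs_eq)
  have "cosh (t / 2) = cosh (t' / 2)" "cosh ((t + l) / 2) = cosh ((t' + l) / 2)"
    using uv(3) eq l by (auto simp: FN_to_tr_eq)
  then have "\<bar>t\<bar> = \<bar>t'\<bar>" "\<bar>t + l\<bar> = \<bar>t' + l\<bar>" by (auto simp: cosh_real_abs_eq)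
  then have "t = t'" using eq by linarith
  with l show "u = v" by (simp add: eq)
qed

lemma T_tr_gt_2:
  assumes "(x, y, z) \<in> T_tr" shows "2 < x"
proof -
  have pos: "0 < x" "0 < y" "0 < z" and eq: "x\<^sup>2 + y\<^sup>2 + z\<^sup>2 = x * y * z"
    using assms by (auto simp: T_tr_iff)
  have "2 * (y * z) \<le> y\<^sup>2 + z\<^sup>2" using sum_squares_bound[of y z] by simp
  moreover have "0 < x\<^sup>2" using pos by simp
  ultimately have "2 * (y * z) < x * (y * z)" using eq unfolding mult.assoc by linarith
  then show ?thesis using pos by (simp add: mult_less_cancel_right)
qed

text \<open>The length is determined by \<open>x\<close>. Solving the equation for \<open>z\<close> gives two roots, which correspond to the
  two signs of the twist parameter that \<open>y\<close> leaves open.\<close>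

lemma FN_to_tr_surj:
  assumes "X \<in> T_tr" shows "X \<in> FN_to_tr ` FN_space"
proof -
  obtain x y z where X: "X = (x, y, z)" by (cases X)
  have pos: "0 < x" "0 < y" "0 < z" and eq: "x\<^sup>2 + y\<^sup>2 + z\<^sup>2 = x * y * z"
    using assms by (auto simp: X T_tr_iff)
  have x2: "2 < x" using assms T_tr_gt_2 by (simp add: X)
  define L where "L = arcosh (x / 2)"
  define C S where "C = cosh L" and "S = sinh L"
  have C: "C = x / 2" using x2 by (simp add: C_def L_def)
  have L: "0 < L" using x2 arcosh_real_gt_1_iff[of "x / 2"] unfolding L_def
    by simp
  have S: "0 < S" using L by (simp add: S_def)
  have x: "x = 2 * C" using C by simp
  have CS: "C\<^sup>2 = S\<^sup>2 + 1" by (simp add: C_def S_def cosh_square_eq)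
  define Y Z where "Y = y * S / (2 * C)" and "Z = z * S / (2 * C)"
  have Cpos: "0 < C" using C pos by simp
  have YZ: "0 < Y" "0 < Z" using pos S Cpos by (auto simp: Y_def Z_def)
  have y: "y = 2 * (C / S) * Y" and z: "z = 2 * (C / S) * Z"
    using S Cpos by (simp_all add: Y_def Z_def)
  have "(2 * C)\<^sup>2 + (2 * (C / S) * Y)\<^sup>2 + (2 * (C / S) * Z)\<^sup>2 = 2 * C * (2 * (C / S) * Y) * (2 * (C / S) * Z)"
    using eq unfolding y z x .
  then have "4 * C\<^sup>2 * (S\<^sup>2 + Y\<^sup>2 + Z\<^sup>2) = 4 * C\<^sup>2 * (2 * C * Y * Z)"
    using S by (simp add: field_simps power2_eq_square)
  then have E: "S\<^sup>2 + Y\<^sup>2 + Z\<^sup>2 = 2 * C * Y * Z" using Cpos by simp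
  have sq: "(Z - C * Y)\<^sup>2 = S\<^sup>2 * (Y\<^sup>2 - 1)" using E CS by algebra
  then have "0 \<le> S\<^sup>2 * (Y\<^sup>2 - 1)" by (metis zero_le_power2)
  then have "1 \<le> Y\<^sup>2" using S by (simp add: zero_le_mult_iff)
  then have Y1: "1 \<le> Y" using YZ power2_le_imp_le[of 1 Y] by simp
  define a0 where "a0 = arcosh Y"
  have a0: "cosh a0 = Y" using Y1 by (simp add: a0_def)
  have "(Z - C * Y)\<^sup>2 = (S * sinh a0)\<^sup>2"
    using sq by (simp add: power_mult_distrib sinh_square_eq a0)
  then have "Z - C * Y = S * sinh a0 \<or> Z - C * Y = S * sinh (- a0)"
    by (auto simp: power2_eq_iff)
  then obtain a where a: "Z - C * Y = S * sinh a" "cosh a = Y"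
    using a0 cosh_minus[of a0] by blast
  then have "Z = cosh (a + L)" by (simp add: cosh_add C_def S_def mult.commute)
  then have "X = FN_to_tr (2 * L, 2 * a)"
    using y z a C by (simp add: X FN_to_tr_eq C_def S_def add_divide_distrib)
  moreover have "(2 * L, 2 * a) \<in> FN_space" using L by (simp add: FN_space_def)
  ultimately show ?thesis by blast
qed

lemma tr_to_FN:
  assumes "X \<in> T_tr"
  shows "tr_to_FN X \<in> FN_space" "FN_to_tr (tr_to_FN X) = X"
  using FN_to_tr_surj[OF assms] unfolding tr_to_FN_def by (auto intro: inv_into_into f_inv_into_f)

text \<open>The initial condition for the growth of traces: along the earthquake about the first curve
  of a pair the traces of the pair and of its products grow as prescribed.\<close>

lemma growth_earthquake:
  fixes l t :: real
  assumes l: "0 < l"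
  defines "X \<equiv> (\<lambda>s. FN_to_tr (l, t - s))"
  defines "c \<equiv> ln (cosh (l / 2) / sinh (l / 2)) - t / 2"
  shows "growth c l 1 0 (\<lambda>s. fst (X s))" "growth c l 0 1 (\<lambda>s. fst (snd (X s)))"
    "growth c l 1 1 (\<lambda>s. snd (snd (X s)))"
    "growth c l (-1) 1 (\<lambda>s. fst (X s) * fst (snd (X s)) - snd (snd (X s)))"
proof -
  define K where "K = cosh (l / 2) / sinh (l / 2)"
  have K: "0 < K" using l by (simp add: K_def)
  have lim: "((\<lambda>s. 2 * K * cosh ((t - s + d) / 2) * exp (- (s / 2))) \<longlongrightarrow> exp (c - d / 2)) at_top" for d
  proof -
    have l1: "((\<lambda>s. K * (exp ((t + d) / 2 - s) + exp (- ((t + d) / 2)))) \<longlongrightarrow> K * exp (- ((t + d) / 2))) at_top"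
      by real_asymp
    have l2: "2 * K * cosh ((t - s + d) / 2) * exp (- (s / 2))
        = K * (exp ((t + d) / 2 - s) + exp (- ((t + d) / 2)))" for s
    proof -
      have "2 * K * cosh ((t - s + d) / 2) * exp (- (s / 2))
          = K * (2 * cosh ((t - s + d) / 2)) * exp (- (s / 2))" by simp
      also have "\<dots> = K * (exp ((t - s + d) / 2 + - (s / 2)) + exp (- ((t - s + d) / 2) + - (s / 2)))"
        unfolding cosh_two exp_add by (simp add: algebra_simps)
      also have "(t - s + d) / 2 + - (s / 2) = (t + d) / 2 - s" by (simp add: field_simps)
      also have "- ((t - s + d) / 2) + - (s / 2) = - ((t + d) / 2)" by (simp add: field_simps)
      finally show ?thesis .
    qed
    have l3: "K * exp (- ((t + d) / 2)) = exp (c - d / 2)"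
    proof -
      have "c - d / 2 = ln K + - ((t + d) / 2)" by (simp add: c_def K_def add_divide_distrib)
      then show ?thesis using K by (simp only: exp_add exp_ln)
    qed
    show ?thesis unfolding l2 using l1 by (simp only: l3)
  qed
  show "growth c l 1 0 (\<lambda>s. fst (X s))"
    by (simp add: growth_def growth_const_def X_def FN_to_tr_eq)
  show "growth c l 0 1 (\<lambda>s. fst (snd (X s)))"
    using lim[of 0] by (simp add: growth_def growth_const_def X_def FN_to_tr_eq K_def)
  show "growth c l 1 1 (\<lambda>s. snd (snd (X s)))"
    using lim[of l] by (simp add: growth_def growth_const_def X_def FN_to_tr_eq K_def)
  have "fst (X s) * fst (snd (X s)) - snd (snd (X s)) = 2 * K * cosh ((t - s + - l) / 2)" for s
  proof -
    have "2 * cosh (l / 2) * cosh ((t - s) / 2) = cosh ((t - s + l) / 2) + cosh ((t - s + - l) / 2)"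
      using cosh_add[of "(t - s) / 2" "l / 2"] cosh_diff[of "(t - s) / 2" "l / 2"]
      by (simp add: add_divide_distrib diff_divide_distrib)
    moreover have "fst (X s) * fst (snd (X s)) - snd (snd (X s)) =
        2 * K * (2 * cosh (l / 2) * cosh ((t - s) / 2)) - 2 * K * cosh ((t - s + l) / 2)"
      by (simp add: X_def FN_to_tr_eq K_def[symmetric])
    ultimately show ?thesis by (simp only: distrib_left add_diff_cancel_left')
  qed
  then show "growth c l (-1) 1 (\<lambda>s. fst (X s) * fst (snd (X s)) - snd (snd (X s)))"
    using lim[of "- l"] by (simp add: growth_def growth_const_def)
qed

section \<open>The slope of a path in Fenchel--Nielsen coordinates\<close>

lemma growth_log:
  assumes "growth c l m n f" "\<And>s. 0 < f s"
  shows "((\<lambda>s::real. ln (f s) / s) \<longlongrightarrow> \<bar>n\<bar> / 2) at_top"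
proof -
  let ?g = "growth_const c l m n"
  have "((\<lambda>s::real. ln (f s * exp (- (\<bar>n\<bar> * s / 2)))) \<longlongrightarrow> ln ?g) at_top"
    using assms growth_const_pos[of c l m n] by (intro tendsto_ln) (auto simp: growth_def)
  then have "((\<lambda>s::real. ln (f s * exp (- (\<bar>n\<bar> * s / 2))) / s + \<bar>n\<bar> / 2) \<longlongrightarrow> 0 + \<bar>n\<bar> / 2) at_top"
    by (intro tendsto_add tendsto_const real_tendsto_divide_at_top[where g = "\<lambda>s. s"] filterlim_ident)
  moreover have "\<forall>\<^sub>F s in (at_top :: real filter). ln (f s * exp (- (\<bar>n\<bar> * s / 2))) / s + \<bar>n\<bar> / 2 = ln (f s) / s"
    using eventually_gt_at_top[of 0]
  proof eventually_elim
    case (elim s)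
    have "ln (f s * exp (- (\<bar>n\<bar> * s / 2))) = ln (f s) - \<bar>n\<bar> * s / 2"
      using assms(2)[of s] by (simp add: ln_mult)
    then show ?case using elim by (simp add: field_simps)
  qed
  ultimately show ?thesis by (simp add: tendsto_cong)
qed

lemma ln_cosh_bounds: "\<bar>u\<bar> - ln 2 \<le> ln (cosh u)" "ln (cosh u) \<le> \<bar>u\<bar>" for u :: real
proof -
  have c: "2 * cosh u = exp \<bar>u\<bar> + exp (- \<bar>u\<bar>)" using cosh_two[of "\<bar>u\<bar>"] by simp
  have "exp \<bar>u\<bar> / 2 \<le> cosh u" using c exp_gt_zero[of "- \<bar>u\<bar>"] by linarith
  then have "ln (exp \<bar>u\<bar> / 2) \<le> ln (cosh u)" by (subst ln_le_cancel_iff) auto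
  then show "\<bar>u\<bar> - ln 2 \<le> ln (cosh u)" by (simp add: ln_div)
  have "exp (- \<bar>u\<bar>) \<le> exp \<bar>u\<bar>" by simp
  then have "cosh u \<le> exp \<bar>u\<bar>" using c by linarith
  then have "ln (cosh u) \<le> ln (exp \<bar>u\<bar>)" by (subst ln_le_cancel_iff) auto
  then show "ln (cosh u) \<le> \<bar>u\<bar>" by simp
qed

lemma abs_over_of_ln_cosh:
  fixes u k :: "real \<Rightarrow> real"
  assumes "((\<lambda>s::real. (ln (cosh (u s)) + k s) / s) \<longlongrightarrow> r) at_top"
    and k: "\<forall>\<^sub>F s in (at_top :: real filter). \<bar>k s\<bar> \<le> B"
  shows "((\<lambda>s::real. \<bar>u s\<bar> / s) \<longlongrightarrow> r) at_top"
proof -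
  have "((\<lambda>s::real. \<bar>u s\<bar> / s - (ln (cosh (u s)) + k s) / s) \<longlongrightarrow> 0) at_top"
  proof (rule Lim_null_comparison)
    show "((\<lambda>s::real. (B + ln 2) / s) \<longlongrightarrow> 0) at_top" by real_asymp
    show "\<forall>\<^sub>F s in (at_top :: real filter). norm (\<bar>u s\<bar> / s - (ln (cosh (u s)) + k s) / s) \<le> (B + ln 2) / s"
      using k eventually_gt_at_top[of 0]
    proof eventually_elim
      case (elim s)
      have "\<bar>\<bar>u s\<bar> - (ln (cosh (u s)) + k s)\<bar> \<le> B + ln 2"
        using ln_cosh_bounds[of "u s"] elim(1) by linarith
      then show ?case using elim(2)
        by (simp add: divide_right_mono flip: diff_divide_distrib)
    qed
  qed
  from tendsto_add[OF this assms(1)] show ?thesis by simp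
qed

text \<open>The moduli of the ratios \<open>\<tau> / l\<close> and \<open>\<tau> / l + 1\<close> have the limits of \<open>q / p\<close> and \<open>q / p + 1\<close>,
  and these two moduli determine a real number.\<close>

lemma slope_limit:
  fixes l \<tau> :: "real \<Rightarrow> real" and p q m1 m2 m3 :: int
  assumes l: "\<And>s. 0 < l s" and p: "p \<noteq> 0"
    and x: "growth c L m1 p (\<lambda>s::real. fst (FN_to_tr (l s, \<tau> s)))"
    and y: "growth c L m2 q (\<lambda>s::real. fst (snd (FN_to_tr (l s, \<tau> s))))"
    and z: "growth c L m3 (p + q) (\<lambda>s::real. snd (snd (FN_to_tr (l s, \<tau> s))))"
  shows "((\<lambda>s::real. \<tau> s / l s) \<longlongrightarrow> q / p) at_top"
proof -
  define K where "K s = cosh (l s / 2) / sinh (l s / 2)" for s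
  have Kpos: "0 < K s" for s using l[of s] by (simp add: K_def)
  have "((\<lambda>s::real. (ln (cosh (l s / 2)) + ln 2) / s) \<longlongrightarrow> \<bar>p\<bar> / 2) at_top"
    using growth_log[OF x] by (simp add: FN_to_tr_eq ln_mult add.commute)
  then have "((\<lambda>s::real. \<bar>l s / 2\<bar> / s) \<longlongrightarrow> \<bar>p\<bar> / 2) at_top"
    by (rule abs_over_of_ln_cosh[where B = "ln 2"]) auto
  from tendsto_mult[OF this tendsto_const[of 2]]
  have l_lim: "((\<lambda>s::real. l s / s) \<longlongrightarrow> \<bar>p\<bar>) at_top" using l by (simp add: less_imp_le)
  have f1: "filterlim (\<lambda>s::real. l s / s * s) at_top at_top"
    using l_lim p by (intro filterlim_tendsto_pos_mult_at_top[of _ "\<bar>p\<bar>"] filterlim_ident) auto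
  have f2: "\<forall>\<^sub>F s in (at_top :: real filter). l s / s * s = l s"
    using eventually_gt_at_top[of 0] by eventually_elim simp
  have l_top: "filterlim l at_top at_top"
    using filterlim_cong[THEN iffD1, OF HOL.refl HOL.refl f2 f1] by simp
  have "((\<lambda>s::real. 1 / tanh (l s / 2)) \<longlongrightarrow> 1 / 1) at_top"
    using filterlim_tendsto_pos_mult_at_top[OF tendsto_const[of "1 / 2"] _ l_top]
    by (intro tendsto_divide tendsto_const filterlim_compose[OF tanh_real_at_top]) auto
  moreover have "1 / tanh (l s / 2) = K s" for s by (simp add: K_def tanh_def)
  ultimately have K_lim: "(K \<longlongrightarrow> 1) at_top" by (simp only: div_by_1)
  then have "((\<lambda>s::real. ln (2 * K s)) \<longlongrightarrow> ln (2 * 1)) at_top"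
    by (intro tendsto_ln tendsto_mult tendsto_const) auto
  then have "\<forall>\<^sub>F s in (at_top :: real filter). dist (ln (2 * K s)) (ln (2 * 1)) < 1"
    by (rule tendstoD) simp
  then have lnK: "\<forall>\<^sub>F s in (at_top :: real filter). \<bar>ln (2 * K s)\<bar> \<le> ln 2 + 1"
  proof eventually_elim
    case (elim s)
    have "0 < ln (2 :: real)" by simp
    moreover have "\<bar>ln (2 * K s) - ln 2\<bar> < 1" using elim by (simp add: dist_real_def)
    ultimately show ?case by linarith
  qed
  have abs_lim: "((\<lambda>s::real. \<bar>v s / 2\<bar> / s) \<longlongrightarrow> \<bar>k\<bar> / 2) at_top"
    if "growth c L m k (\<lambda>s::real. 2 * K s * cosh (v s / 2))" for m k v
  proof -
    have "ln (2 * K s * cosh (v s / 2)) = ln (cosh (v s / 2)) + ln (2 * K s)" for s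
      using Kpos[of s] by (subst ln_mult) auto
    moreover have "0 < 2 * K s * cosh (v s / 2)" for s using Kpos[of s] by simp
    ultimately have "((\<lambda>s::real. (ln (cosh (v s / 2)) + ln (2 * K s)) / s) \<longlongrightarrow> \<bar>k\<bar> / 2) at_top"
      using growth_log[OF that] by simp
    from abs_over_of_ln_cosh[OF this lnK] show ?thesis by simp
  qed
  have ratio: "((\<lambda>s::real. (v s / l s)\<^sup>2) \<longlongrightarrow> (k / p)\<^sup>2) at_top"
    if "growth c L m k (\<lambda>s::real. 2 * K s * cosh (v s / 2))" for m k v
  proof -
    have "((\<lambda>s::real. \<bar>v s / 2\<bar> / s) \<longlongrightarrow> \<bar>real_of_int k\<bar> / 2) at_top"
      "((\<lambda>s::real. l s / s) \<longlongrightarrow> \<bar>real_of_int p\<bar>) at_top"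
      using abs_lim[OF that] l_lim by simp_all
    from tendsto_power[OF tendsto_divide[OF tendsto_mult[OF tendsto_const[of 2] this(1)] this(2)], of 2]
    have lim: "((\<lambda>s::real. (2 * (\<bar>v s / 2\<bar> / s) / (l s / s))\<^sup>2) \<longlongrightarrow>
        (2 * (\<bar>real_of_int k\<bar> / 2) / \<bar>real_of_int p\<bar>)\<^sup>2) at_top"
      using p by simp
    have ev: "\<forall>\<^sub>F s in (at_top :: real filter). (2 * (\<bar>v s / 2\<bar> / s) / (l s / s))\<^sup>2 = (v s / l s)\<^sup>2"
      using eventually_gt_at_top[of 0] by eventually_elim (simp add: power_divide)
    show ?thesis
      using iffD1[OF tendsto_cong[OF ev] lim] by (simp add: power_divide)
  qed
  have A: "((\<lambda>s::real. (\<tau> s / l s)\<^sup>2) \<longlongrightarrow> (q / p)\<^sup>2) at_top"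
    using ratio[of m2 q \<tau>] y by (simp add: FN_to_tr_eq K_def)
  have B: "((\<lambda>s::real. ((\<tau> s + l s) / l s)\<^sup>2) \<longlongrightarrow> ((real_of_int q + p) / p)\<^sup>2) at_top"
    using ratio[of m3 "p + q" "\<lambda>s. \<tau> s + l s"] z by (simp add: FN_to_tr_eq K_def add.commute)
  have eq: "(((u + v) / v)\<^sup>2 - (u / v)\<^sup>2 - 1) / 2 = u / v" if "v \<noteq> 0" for u v :: real
    using that by (simp add: power2_eq_square field_simps)
  have "l s \<noteq> 0" for s using l[of s] by simp
  then show ?thesis
    using tendsto_divide[OF tendsto_diff[OF tendsto_diff[OF B A] tendsto_const[of 1]] tendsto_const[of 2]] p
    by (simp only: eq of_int_eq_0_iff zero_neq_numeral[symmetric] not_False_eq_True)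
qed

text \<open>If the first trace does not grow, then the length converges and \<open>\<bar>\<tau>\<bar>\<close> tends to infinity. The sign of \<open>\<tau>\<close> is
  decided by the leading coefficients of the last two traces: a smaller last trace means
  \<open>\<bar>\<tau> + l\<bar> < \<bar>\<tau>\<bar>\<close>, hence \<open>\<tau> < 0\<close>.\<close>

lemma slope_limit_infinite:
  fixes l \<tau> :: "real \<Rightarrow> real" and m1 q m2 m3 :: int
  assumes l: "\<And>s. 0 < l s" and L: "0 < L" and sgn: "0 < sgn q * m1" and m3: "m3 = m1 + m2"
    and x: "growth c L m1 0 (\<lambda>s::real. fst (FN_to_tr (l s, \<tau> s)))"
    and y: "growth c L m2 q (\<lambda>s::real. fst (snd (FN_to_tr (l s, \<tau> s))))"
    and z: "growth c L m3 q (\<lambda>s::real. snd (snd (FN_to_tr (l s, \<tau> s))))"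
  shows "filterlim (\<lambda>s::real. \<tau> s / l s) at_bot at_top"
proof -
  have m1: "m1 \<noteq> 0" and q: "q \<noteq> 0" using sgn by auto
  define K where "K s = cosh (l s / 2) / sinh (l s / 2)" for s
  have Kpos: "0 < K s" for s using l[of s] by (simp add: K_def)
  define L' where "L' = \<bar>m1\<bar> * L"
  have L': "0 < L'" using L m1 by (simp add: L'_def)
  have "((\<lambda>s::real. cosh (l s / 2)) \<longlongrightarrow> cosh (L' / 2)) at_top"
  proof -
    have e: "cosh (m1 * L / 2) = cosh (L' / 2)" using L by (simp add: cosh_real_abs_eq L'_def abs_mult)
    show ?thesis unfolding e[symmetric]
      using tendsto_mult[OF x[unfolded growth_def growth_const_def] tendsto_const[of "1/2"]]
      by (simp add: FN_to_tr_eq)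
  qed
  then have "((\<lambda>s::real. arcosh (cosh (l s / 2))) \<longlongrightarrow> arcosh (cosh (L' / 2))) at_top"
    using L' cosh_real_nonneg_less_iff[of 0 "L' / 2"] by (intro tendsto_arcosh) auto
  then have "((\<lambda>s::real. l s / 2) \<longlongrightarrow> L' / 2) at_top"
    using l L' by (simp add: arcosh_cosh_real less_imp_le)
  from tendsto_mult[OF this tendsto_const[of 2]] have l_lim: "(l \<longlongrightarrow> L') at_top" by simp
  have "(K \<longlongrightarrow> cosh (L' / 2) / sinh (L' / 2)) at_top"
    unfolding K_def using l_lim L' by (intro tendsto_intros) auto
  then have K_lim: "((\<lambda>s::real. 1 / (2 * K s)) \<longlongrightarrow> 1 / (2 * (cosh (L' / 2) / sinh (L' / 2)))) at_top"
    using L' by (intro tendsto_intros) auto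
  have pos: "0 < 1 / (2 * (cosh (L' / 2) / sinh (L' / 2)))" using L' by simp
  define Y where "Y s = 2 * K s * cosh (\<tau> s / 2)" for s
  define Z where "Z s = 2 * K s * cosh ((\<tau> s + l s) / 2)" for s
  have Ypos: "0 < Y s" and Zpos: "0 < Z s" for s using Kpos[of s] by (simp_all add: Y_def Z_def)
  have y': "((\<lambda>s::real. Y s * exp (- (\<bar>q\<bar> * s / 2))) \<longlongrightarrow> growth_const c L m2 q) at_top"
    using y by (simp add: growth_def FN_to_tr_eq Y_def K_def)
  have z': "((\<lambda>s::real. Z s * exp (- (\<bar>q\<bar> * s / 2))) \<longlongrightarrow> growth_const c L m3 q) at_top"
    using z by (simp add: growth_def FN_to_tr_eq Z_def K_def)
  have "filterlim (\<lambda>s::real. exp (real_of_int \<bar>q\<bar> * s / 2)) at_top at_top"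
  proof -
    have "0 < real_of_int \<bar>q\<bar>" using q by simp
    then show ?thesis by real_asymp
  qed
  from filterlim_tendsto_pos_mult_at_top[OF y' growth_const_pos this]
  have "filterlim Y at_top at_top" by (simp add: mult.assoc flip: exp_add)
  from filterlim_tendsto_pos_mult_at_top[OF K_lim pos this]
  have cosh_top: "filterlim (\<lambda>s::real. cosh (\<tau> s / 2)) at_top at_top"
    using Kpos by (simp add: Y_def less_imp_neq[symmetric] order_less_imp_not_eq2)
  have "filterlim (\<lambda>s::real. 2 * ln (cosh (\<tau> s / 2))) at_top at_top"
    by (intro filterlim_tendsto_pos_mult_at_top[OF tendsto_const _ filterlim_compose[OF ln_at_top cosh_top]]) simp
  then have abs_top: "filterlim (\<lambda>s::real. \<bar>\<tau> s\<bar>) at_top at_top"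
  proof (rule filterlim_at_top_mono, intro always_eventually allI)
    show "2 * ln (cosh (\<tau> s / 2)) \<le> \<bar>\<tau> s\<bar>" for s using ln_cosh_bounds(2)[of "\<tau> s / 2"] by simp
  qed
  have "growth_const c L m3 q < growth_const c L m2 q"
  proof -
    have "sgn q * m2 < sgn q * m3" using sgn by (simp add: m3 distrib_left)
    then have "real_of_int (sgn q * m2) < real_of_int (sgn q * m3)" by (simp only: of_int_less_iff)
    from mult_strict_right_mono[OF this L]
    have "real_of_int (sgn q * m2) * L < real_of_int (sgn q * m3) * L" .
    then show ?thesis using q by (cases "0 < q") (auto simp: growth_const_def)
  qed
  then obtain r where r: "growth_const c L m3 q < r" "r < growth_const c L m2 q"
    using dense by blast
  have "\<forall>\<^sub>F s in (at_top :: real filter). Z s * exp (- (\<bar>q\<bar> * s / 2)) < Y s * exp (- (\<bar>q\<bar> * s / 2))"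
    using order_tendstoD(2)[OF z' r(1)] order_tendstoD(1)[OF y' r(2)] by eventually_elim (erule (1) less_trans)
  then have neg: "\<forall>\<^sub>F s in (at_top :: real filter). \<tau> s < 0"
  proof eventually_elim
    case (elim s)
    then have "Z s < Y s" by simp
    then have "cosh ((\<tau> s + l s) / 2) < cosh (\<tau> s / 2)" using Kpos[of s] by (simp add: Y_def Z_def)
    then have "\<not> \<bar>\<tau> s / 2\<bar> \<le> \<bar>(\<tau> s + l s) / 2\<bar>"
      using cosh_real_nonneg_le_iff[OF abs_ge_zero abs_ge_zero, of "\<tau> s / 2" "(\<tau> s + l s) / 2", unfolded cosh_real_abs]
      by linarith
    then have "\<bar>\<tau> s + l s\<bar> < \<bar>\<tau> s\<bar>" by (simp add: not_le)
    then show ?case using l[of s] by linarith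
  qed
  have "filterlim (\<lambda>s::real. inverse (l s) * \<bar>\<tau> s\<bar>) at_top at_top"
    using l_lim L' abs_top
    by (intro filterlim_tendsto_pos_mult_at_top[OF tendsto_inverse[OF l_lim]]) auto
  moreover have "\<forall>\<^sub>F s in (at_top :: real filter). inverse (l s) * \<bar>\<tau> s\<bar> = - (\<tau> s / l s)"
    using neg by eventually_elim (simp add: divide_inverse)
  ultimately have "filterlim (\<lambda>s::real. - (\<tau> s / l s)) at_top at_top"
    by (simp cong: filterlim_cong)
  then show ?thesis by (simp add: filterlim_uminus_at_bot)
qed

section \<open>Earthquakes in terms of traces\<close>

text \<open>The growth of the traces of \<open>w1\<close>, \<open>w2\<close> along the earthquake about \<open>w1\<close> is known, and
  Nielsen moves lead from there to \<open>a\<close>, \<open>b\<close>, whose traces give the coordinates.\<close>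

theorem (in group) earthquake_slope:
  fixes m n :: "'a \<Rightarrow> int" and \<rho> :: "real \<Rightarrow> 'a \<Rightarrow> real^2^2"
  assumes free: "free_on G {a, b}" "a \<noteq> b"
    and w: "w1 \<in> carrier G" "w2 \<in> carrier G" "generate G {w1, w2} = carrier G"
    and m: "\<And>g h. g \<in> carrier G \<Longrightarrow> h \<in> carrier G \<Longrightarrow> m (g \<otimes> h) = m g + m h"
    and n: "\<And>g h. g \<in> carrier G \<Longrightarrow> h \<in> carrier G \<Longrightarrow> n (g \<otimes> h) = n g + n h"
    and vals: "m a = 1" "m b = 0" "n a = 0" "n b = 1"
    and det: "m w1 * n w2 - n w1 * m w2 = 1"
    and \<rho>: "\<And>s. \<rho> s \<in> hom G SL2R"
    and X: "\<And>s. trace_triple (\<rho> s) a b = X s"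
    and Y: "\<And>s. trace_triple (\<rho> s) w1 w2 = FN_to_tr (l, t - s)" and l: "0 < l"
  shows "n w1 \<noteq> 0 \<Longrightarrow> ((\<lambda>s. snd (tr_to_FN (X s)) / fst (tr_to_FN (X s))) \<longlongrightarrow> - (m w1 / n w1)) at_top"
    and "n w1 = 0 \<Longrightarrow> filterlim (\<lambda>s. snd (tr_to_FN (X s)) / fst (tr_to_FN (X s))) at_bot at_top"
proof -
  have ab: "a \<in> carrier G" "b \<in> carrier G" using free by (auto simp: free_on_def)
  \<comment> \<open>the homology coordinates with respect to the basis \<open>w1\<close>, \<open>w2\<close>, by Cramer's rule\<close>
  define m' n' where "m' g = m g * n w2 - n g * m w2" and "n' g = m w1 * n g - n w1 * m g" for g
  have m': "m' (g \<otimes> h) = m' g + m' h" and n': "n' (g \<otimes> h) = n' g + n' h"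
    if "g \<in> carrier G" "h \<in> carrier G" for g h
    using that by (simp_all add: m'_def n'_def m n algebra_simps)
  have w_vals: "m' w1 = 1" "n' w1 = 0" "m' w2 = 0" "n' w2 = 1"
    using det by (simp_all add: m'_def n'_def algebra_simps)
  have ab_vals: "m' a = n w2" "n' a = - n w1" "m' b = - m w2" "n' b = m w1"
    using vals by (simp_all add: m'_def n'_def)
  have inv_hom: "m' (inv g) = - m' g" "n' (inv g) = - n' g" if "g \<in> carrier G" for g
    using m'[of g "inv g"] m'[of \<one> \<one>] n'[of g "inv g"] n'[of \<one> \<one>] that by simp_all
  have nielsen: "nielsen G (w1, w2) (a, b)" by (rule nielsen_theorem[OF free w])
  have T_Y: "trace_triple (\<rho> s) w1 w2 \<in> T_tr" for s
    using FN_to_tr_in_T_tr[of "(l, t - s)"] l by (simp add: Y FN_space_def)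
  have X_T: "X s \<in> T_tr" for s
    using nielsen_T_tr[OF \<rho> nielsen, of s] T_Y[of s] w by (simp add: X)
  define c where "c = ln (cosh (l / 2) / sinh (l / 2)) - t / 2"
  have tr: "trace (\<rho> s w1) = fst (FN_to_tr (l, t - s))" "trace (\<rho> s w2) = fst (snd (FN_to_tr (l, t - s)))"
    "trace (\<rho> s (w1 \<otimes> w2)) = snd (snd (FN_to_tr (l, t - s)))"
    "trace (\<rho> s (inv w1 \<otimes> w2)) =
       fst (FN_to_tr (l, t - s)) * fst (snd (FN_to_tr (l, t - s))) - snd (snd (FN_to_tr (l, t - s)))" for s
    using w by (simp_all flip: Y add: trace_triple_def trace_inv_mult[OF \<rho>])
  note ge = growth_earthquake[OF l, of t, folded c_def]
  have "growth c l (m' a) (n' a) (\<lambda>s. trace (\<rho> s a)) \<and> growth c l (m' b) (n' b) (\<lambda>s. trace (\<rho> s b)) \<and>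
      growth c l (m' (a \<otimes> b)) (n' (a \<otimes> b)) (\<lambda>s. trace (\<rho> s (a \<otimes> b)))"
    using nielsen_growth[where m = m' and n = n' and c = c and l = l, OF \<rho> nielsen] T_Y w ge
    by (simp add: m' n' inv_hom w_vals tr)
  then have gr: "growth c l (n w2) (- n w1) (\<lambda>s. fst (X s))"
    "growth c l (- m w2) (m w1) (\<lambda>s. fst (snd (X s)))"
    "growth c l (n w2 + - m w2) (- n w1 + m w1) (\<lambda>s. snd (snd (X s)))"
    using ab by (simp_all flip: X add: trace_triple_def m' n' ab_vals)
  define ll tt where "ll s = fst (tr_to_FN (X s))" and "tt s = snd (tr_to_FN (X s))" for s
  have FN: "FN_to_tr (ll s, tt s) = X s" "0 < ll s" for s
    using tr_to_FN[OF X_T[of s]] by (auto simp: ll_def tt_def FN_space_def)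
  show "((\<lambda>s. snd (tr_to_FN (X s)) / fst (tr_to_FN (X s))) \<longlongrightarrow> - (m w1 / n w1)) at_top" if "n w1 \<noteq> 0"
    using slope_limit[of ll "- n w1" c l "n w2" tt "- m w2" "m w1" "n w2 + - m w2"] gr that FN
    by (simp add: ll_def tt_def)
  show "filterlim (\<lambda>s. snd (tr_to_FN (X s)) / fst (tr_to_FN (X s))) at_bot at_top" if n0: "n w1 = 0"
  proof -
    have "m w1 * n w2 = 1" using det n0 by simp
    then have "m w1 = 1 \<and> n w2 = 1 \<or> m w1 = -1 \<and> n w2 = -1" by (simp add: zmult_eq_1_iff)
    then show ?thesis
      using slope_limit_infinite[of ll l "n w2" "m w1" "n w2 + - m w2" "- m w2" c tt] gr n0 FN l
      by (auto simp: ll_def tt_def)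
  qed
qed

section \<open>Homotopies between concatenated paths\<close>

declare homotopic_paths_trans [trans]

lemma homotopic_paths_join_right:
  "homotopic_paths S q r \<Longrightarrow> path p \<Longrightarrow> path_image p \<subseteq> S \<Longrightarrow> pathfinish p = pathstart q \<Longrightarrow>
   homotopic_paths S (p +++ q) (p +++ r)"
  by (intro homotopic_paths_join) auto

lemma homotopic_paths_assoc':
  "\<lbrakk>path p; path_image p \<subseteq> S; path q; path_image q \<subseteq> S; path r; path_image r \<subseteq> S;
    pathfinish p = pathstart q; pathfinish q = pathstart r\<rbrakk>
    \<Longrightarrow> homotopic_paths S ((p +++ q) +++ r) (p +++ (q +++ r))"
  by (intro homotopic_paths_sym[OF homotopic_paths_assoc])

lemma homotopic_paths_cancel:
  fixes S :: "'a::real_normed_vector set"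
  assumes "path k" "path_image k \<subseteq> S" "path r" "path_image r \<subseteq> S"
  shows "pathfinish k = pathstart r \<Longrightarrow> homotopic_paths S (reversepath k +++ (k +++ r)) r"
    and "pathstart k = pathstart r \<Longrightarrow> homotopic_paths S (k +++ (reversepath k +++ r)) r"
    and "pathfinish r = pathstart k \<Longrightarrow> homotopic_paths S ((r +++ k) +++ reversepath k) r"
proof -
  {
    fix k :: "real \<Rightarrow> 'a" assume k: "path k" "path_image k \<subseteq> S" "pathfinish k = pathstart r"
    have "homotopic_paths S (reversepath k +++ (k +++ r)) ((reversepath k +++ k) +++ r)"
      using assms(3,4) k by (intro homotopic_paths_assoc) auto
    also have "homotopic_paths S \<dots> (linepath (pathfinish k) (pathfinish k) +++ r)"
      using assms(3,4) k by (intro homotopic_paths_join homotopic_paths_linv) auto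
    also have "homotopic_paths S \<dots> r"
      using assms(3,4) k homotopic_paths_lid by simp
    finally have "homotopic_paths S (reversepath k +++ (k +++ r)) r" .
  } note 1 = this
  show "pathfinish k = pathstart r \<Longrightarrow> homotopic_paths S (reversepath k +++ (k +++ r)) r"
    using 1 assms by blast
  show "pathstart k = pathstart r \<Longrightarrow> homotopic_paths S (k +++ (reversepath k +++ r)) r"
    using 1[of "reversepath k"] assms by simp
  assume rk: "pathfinish r = pathstart k"
  have "homotopic_paths S ((r +++ k) +++ reversepath k) (r +++ (k +++ reversepath k))"
    using assms rk by (intro homotopic_paths_assoc') auto
  also have "homotopic_paths S \<dots> (r +++ linepath (pathstart k) (pathstart k))"
    using assms rk by (intro homotopic_paths_join homotopic_paths_rinv) auto
  also have "homotopic_paths S \<dots> r"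
    using assms rk homotopic_paths_rid[of r S] by simp
  finally show "homotopic_paths S ((r +++ k) +++ reversepath k) r" .
qed

definition conj_path :: "(real \<Rightarrow> 'a::real_normed_vector) \<Rightarrow> (real \<Rightarrow> 'a) \<Rightarrow> real \<Rightarrow> 'a" where
  "conj_path k c = k +++ c +++ reversepath k"

lemma conj_path_join:
  fixes S :: "'a::real_normed_vector set"
  assumes k: "path k" "path_image k \<subseteq> S" and c: "path c" "path_image c \<subseteq> S" and d: "path d" "path_image d \<subseteq> S"
    and ends: "pathfinish k = pathstart c" "pathfinish c = pathstart c" "pathstart d = pathstart c"
      "pathfinish d = pathstart c"
  shows "homotopic_paths S (conj_path k c +++ conj_path k d) (conj_path k (c +++ d))"
proof -
  let ?k = "reversepath k"
  note j = path_image_join subset_path_image_join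
  have "homotopic_paths S (conj_path k c +++ conj_path k d) (k +++ ((c +++ ?k) +++ (k +++ (d +++ ?k))))"
    unfolding conj_path_def using k c d ends by (intro homotopic_paths_assoc') (auto simp: j)
  also have "homotopic_paths S \<dots> (k +++ (c +++ (?k +++ (k +++ (d +++ ?k)))))"
    using k c d ends by (intro homotopic_paths_join_right homotopic_paths_assoc') (auto simp: j)
  also have "homotopic_paths S \<dots> (k +++ (c +++ (d +++ ?k)))"
    using k c d ends
    by (intro homotopic_paths_join_right homotopic_paths_cancel(1)) (auto simp: j)
  also have "homotopic_paths S \<dots> (k +++ ((c +++ d) +++ ?k))"
    using k c d ends by (intro homotopic_paths_join_right homotopic_paths_assoc) (auto simp: j)
  finally show ?thesis by (simp add: conj_path_def)
qed

text \<open>Changing the path that joins a loop to the base point conjugates its class.\<close>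

lemma conj_path_conj_path:
  fixes S :: "'a::real_normed_vector set"
  assumes k: "path k" "path_image k \<subseteq> S" and k0: "path k0" "path_image k0 \<subseteq> S"
    and c: "path c" "path_image c \<subseteq> S"
    and ends: "pathfinish k = pathstart c" "pathfinish k0 = pathstart c" "pathfinish c = pathstart c"
  shows "homotopic_paths S (conj_path (k +++ reversepath k0) (conj_path k0 c)) (conj_path k c)"
proof -
  let ?k = "reversepath k" and ?h = "reversepath k0"
  note j = path_image_join subset_path_image_join
  have rev: "reversepath (k +++ ?h) = k0 +++ ?k" using ends by (simp add: reversepath_joinpaths)
  have "homotopic_paths S ((k0 +++ (c +++ ?h)) +++ (k0 +++ ?k)) (k0 +++ ((c +++ ?h) +++ (k0 +++ ?k)))"
    using k c k0 ends by (intro homotopic_paths_assoc') (auto simp: j)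
  also have "homotopic_paths S \<dots> (k0 +++ (c +++ (?h +++ (k0 +++ ?k))))"
    using k c k0 ends by (intro homotopic_paths_join_right homotopic_paths_assoc') (auto simp: j)
  also have "homotopic_paths S \<dots> (k0 +++ (c +++ ?k))"
    using k c k0 ends by (intro homotopic_paths_join_right homotopic_paths_cancel(1)) (auto simp: j)
  finally
  have 1: "homotopic_paths S ((k0 +++ (c +++ ?h)) +++ (k0 +++ ?k)) (k0 +++ (c +++ ?k))" .
  have "homotopic_paths S (conj_path (k +++ ?h) (conj_path k0 c)) ((k +++ ?h) +++ (k0 +++ (c +++ ?k)))"
    unfolding conj_path_def rev using k c k0 ends by (intro homotopic_paths_join_right 1) (auto simp: j)
  also have "homotopic_paths S \<dots> (k +++ (?h +++ (k0 +++ (c +++ ?k))))"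
    using k c k0 ends by (intro homotopic_paths_assoc') (auto simp: j)
  also have "homotopic_paths S \<dots> (k +++ (c +++ ?k))"
    using k c k0 ends by (intro homotopic_paths_join_right homotopic_paths_cancel(1)) (auto simp: j)
  finally show ?thesis by (simp add: conj_path_def)
qed

lemma conj_path_reverse:
  fixes S :: "'a::real_normed_vector set"
  assumes k: "path k" "path_image k \<subseteq> S" and c: "path c" "path_image c \<subseteq> S"
    and ends: "pathstart k = pathstart c" "pathfinish c = pathstart c"
  shows "homotopic_paths S (conj_path k (reversepath k +++ c +++ k)) c"
proof -
  let ?k = "reversepath k"
  note j = path_image_join subset_path_image_join
  have "homotopic_paths S (conj_path k (?k +++ (c +++ k))) (k +++ (?k +++ ((c +++ k) +++ ?k)))"
    unfolding conj_path_def
    using k c ends by (intro homotopic_paths_join_right homotopic_paths_assoc') (auto simp: j)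
  also have "homotopic_paths S \<dots> ((c +++ k) +++ ?k)"
    using k c ends by (intro homotopic_paths_cancel(2)) (auto simp: j)
  also have "homotopic_paths S \<dots> c"
    using k c ends by (intro homotopic_paths_cancel(3)) auto
  finally show ?thesis .
qed

lemma homotopic_loops_reversepath:
  assumes "homotopic_loops S c d" shows "homotopic_loops S (reversepath c) (reversepath d)"
proof -
  obtain h where h: "continuous_on ({0..1::real} \<times> {0..1}) h" "h \<in> ({0..1} \<times> {0..1}) \<rightarrow> S"
    "\<forall>x\<in>{0..1}. h (0, x) = c x" "\<forall>x\<in>{0..1}. h (1, x) = d x"
    "\<forall>t\<in>{0..1}. pathfinish (h \<circ> Pair t) = pathstart (h \<circ> Pair t)"
    using assms unfolding homotopic_loops by blast
  have "continuous_on ({0..1} \<times> {0..1}) (\<lambda>z. h (fst z, 1 - snd z))"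
    by (rule continuous_on_compose2[OF h(1)]) (auto intro!: continuous_intros)
  then show ?thesis
    unfolding homotopic_loops using h
    by (intro exI[of _ "\<lambda>z. h (fst z, 1 - snd z)"])
      (auto simp: reversepath_def pathfinish_def pathstart_def Pi_def)
qed

section \<open>The fundamental group of the punctured torus\<close>

lemma loops_at_iff:
  "c \<in> loops_at p \<longleftrightarrow> path c \<and> path_image c \<subseteq> S11 \<and> pathstart c = p \<and> pathfinish c = p"
  by (auto simp: loops_at_def closed_curve_def)

lemma loop_class_eqI:
  assumes "homotopic_paths S11 c d" shows "loop_class c = loop_class d"
proof -
  have "homotopic_paths S11 c e \<longleftrightarrow> homotopic_paths S11 d e" for e
    using assms homotopic_paths_sym homotopic_paths_trans by metis
  then show ?thesis by (simp add: loop_class_def)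
qed

lemma loop_class_eq:
  assumes "path c" "path_image c \<subseteq> S11"
  shows "loop_class c = loop_class d \<longleftrightarrow> homotopic_paths S11 c d"
proof
  assume eq: "loop_class c = loop_class d"
  have "c \<in> loop_class c" using assms by (simp add: loop_class_def)
  then show "homotopic_paths S11 c d"
    unfolding eq by (simp add: loop_class_def homotopic_paths_sym)
qed (rule loop_class_eqI)

lemma loops_at_join: "c \<in> loops_at p \<Longrightarrow> d \<in> loops_at p \<Longrightarrow> c +++ d \<in> loops_at p"
  by (auto simp: loops_at_iff path_image_join)

lemma loops_at_reverse: "c \<in> loops_at p \<Longrightarrow> reversepath c \<in> loops_at p"
  by (auto simp: loops_at_iff)

lemma const_linepath: "(\<lambda>_. p) = linepath p p"
  by (auto simp: linepath_def algebra_simps)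

lemma pi1_carrier [simp]: "carrier (pi1 p) = loop_class ` loops_at p"
  and pi1_one: "\<one>\<^bsub>pi1 p\<^esub> = loop_class (linepath p p)"
  by (simp_all add: pi1_def const_linepath)

lemma pi1_mult:
  assumes "c \<in> loops_at p" "d \<in> loops_at p"
  shows "loop_class c \<otimes>\<^bsub>pi1 p\<^esub> loop_class d = loop_class (c +++ d)"
proof -
  have cd: "homotopic_paths S11 c c" "homotopic_paths S11 d d" "pathfinish c = pathstart d"
    using assms by (auto simp: loops_at_iff)
  have "homotopic_paths S11 (c +++ d) e"
    if "homotopic_paths S11 c c'" "homotopic_paths S11 d d'" "homotopic_paths S11 (c' +++ d') e" for c' d' e
    using homotopic_paths_trans[OF homotopic_paths_join[OF that(1,2) cd(3)] that(3)] .
  then have "(\<exists>c'\<in>loop_class c. \<exists>d'\<in>loop_class d. homotopic_paths S11 (c' +++ d') e) \<longleftrightarrow>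
      homotopic_paths S11 (c +++ d) e" for e
    using cd(1,2) unfolding loop_class_def by blast
  then show ?thesis by (simp add: pi1_def loop_class_def)
qed

lemma group_pi1:
  assumes "p \<in> S11" shows "group (pi1 p)"
proof (rule groupI)
  have lp: "linepath p p \<in> loops_at p" using assms by (simp add: loops_at_iff)
  show "\<one>\<^bsub>pi1 p\<^esub> \<in> carrier (pi1 p)" using lp by (simp add: pi1_one)
  show "x \<otimes>\<^bsub>pi1 p\<^esub> y \<in> carrier (pi1 p)" if "x \<in> carrier (pi1 p)" "y \<in> carrier (pi1 p)" for x y
    using that by (auto simp: pi1_mult intro!: imageI loops_at_join)
  show "x \<otimes>\<^bsub>pi1 p\<^esub> y \<otimes>\<^bsub>pi1 p\<^esub> z = x \<otimes>\<^bsub>pi1 p\<^esub> (y \<otimes>\<^bsub>pi1 p\<^esub> z)"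
    if xyz: "x \<in> carrier (pi1 p)" "y \<in> carrier (pi1 p)" "z \<in> carrier (pi1 p)" for x y z
  proof -
    obtain a b c where "x = loop_class a" "y = loop_class b" "z = loop_class c"
      "a \<in> loops_at p" "b \<in> loops_at p" "c \<in> loops_at p" using xyz by auto
    moreover from this have "loop_class ((a +++ b) +++ c) = loop_class (a +++ (b +++ c))"
      by (intro loop_class_eqI homotopic_paths_assoc') (auto simp: loops_at_iff)
    ultimately show ?thesis by (simp add: pi1_mult loops_at_join)
  qed
  show "\<one>\<^bsub>pi1 p\<^esub> \<otimes>\<^bsub>pi1 p\<^esub> x = x" if x: "x \<in> carrier (pi1 p)" for x
  proof -
    obtain c where c: "x = loop_class c" "c \<in> loops_at p" using x by auto
    have "loop_class (linepath p p +++ c) = loop_class c"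
      using c by (intro loop_class_eqI homotopic_paths_lid') (auto simp: loops_at_iff)
    then show ?thesis using c lp by (simp add: pi1_one pi1_mult)
  qed
  show "\<exists>y\<in>carrier (pi1 p). y \<otimes>\<^bsub>pi1 p\<^esub> x = \<one>\<^bsub>pi1 p\<^esub>" if x: "x \<in> carrier (pi1 p)" for x
  proof -
    obtain c where c: "x = loop_class c" "c \<in> loops_at p" using x by auto
    have "homotopic_paths S11 (reversepath c +++ c) (linepath p p)"
      using homotopic_paths_linv[of c S11] c by (auto simp: loops_at_iff)
    from loop_class_eqI[OF this] c
    have "loop_class (reversepath c) \<otimes>\<^bsub>pi1 p\<^esub> x = \<one>\<^bsub>pi1 p\<^esub>"
      by (simp add: pi1_mult pi1_one loops_at_reverse)
    then show ?thesis using c loops_at_reverse by (intro bexI[of _ "loop_class (reversepath c)"]) simp_all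
  qed
qed

lemma pi1_inv:
  assumes "p \<in> S11" "c \<in> loops_at p"
  shows "inv\<^bsub>pi1 p\<^esub> (loop_class c) = loop_class (reversepath c)"
proof -
  interpret group "pi1 p" using assms by (intro group_pi1)
  have "homotopic_paths S11 (reversepath c +++ c) (linepath p p)"
    using homotopic_paths_linv[of c S11] assms by (auto simp: loops_at_iff)
  from loop_class_eqI[OF this] assms
  have "loop_class (reversepath c) \<otimes>\<^bsub>pi1 p\<^esub> loop_class c = \<one>\<^bsub>pi1 p\<^esub>"
    by (simp add: pi1_mult pi1_one loops_at_reverse)
  then show ?thesis
    using assms loops_at_reverse by (intro inv_equality) simp_all
qed

lemma conj_path_loop:
  assumes "path k" "path_image k \<subseteq> S11" "c \<in> loops_at (pathfinish k)"
  shows "conj_path k c \<in> loops_at (pathstart k)"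
  using assms by (auto simp: loops_at_iff conj_path_def path_image_join)

lemma conj_path_cong:
  assumes "path k" "path_image k \<subseteq> S11" "homotopic_paths S11 c d"
    and "pathfinish k = pathstart c" "pathfinish c = pathstart c"
  shows "homotopic_paths S11 (conj_path k c) (conj_path k d)"
  unfolding conj_path_def using assms
  by (intro homotopic_paths_join_right homotopic_paths_join) auto

text \<open>A function that is defined on loops and respects homotopy, as a function on classes.\<close>

definition class_lift ::
  "complex \<times> complex \<Rightarrow> ((real \<Rightarrow> complex \<times> complex) \<Rightarrow> 'b) \<Rightarrow> (real \<Rightarrow> complex \<times> complex) set \<Rightarrow> 'b" where
  "class_lift p F X = F (SOME c. c \<in> loops_at p \<and> loop_class c = X)"

lemma class_lift:
  assumes "c \<in> loops_at p" "\<And>d. d \<in> loops_at p \<Longrightarrow> homotopic_paths S11 c d \<Longrightarrow> F d = F c"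
  shows "class_lift p F (loop_class c) = F c"
proof -
  define d where "d = (SOME d. d \<in> loops_at p \<and> loop_class d = loop_class c)"
  have "d \<in> loops_at p \<and> loop_class d = loop_class c"
    unfolding d_def by (rule someI[of _ c]) (use assms in simp)
  moreover have "path c" "path_image c \<subseteq> S11" using assms(1) by (auto simp: loops_at_iff)
  ultimately have "d \<in> loops_at p" "homotopic_paths S11 c d" using loop_class_eq by metis+
  then have "F d = F c" by (rule assms(2))
  then show ?thesis by (simp add: class_lift_def d_def)
qed

section \<open>Homology of the punctured torus\<close>

text \<open>Rotate one coordinate to \<open>-1\<close> while the other one, different from \<open>1\<close>, stays fixed; this avoids the
  puncture. Then the other coordinate is free to move.\<close>

lemma path_connected_S11:
  assumes "p \<in> S11" "q \<in> S11"
  obtains k where "path k" "path_image k \<subseteq> S11" "pathstart k = p" "pathfinish k = q"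
proof -
  have base: "path_component S11 (u, v) (-1, -1)" if uv: "(u, v) \<in> S11" for u v
  proof -
    let ?C = "sphere (0::complex) 1"
    have C: "path_connected ?C" by (simp add: path_connected_sphere)
    have horizontal: "path_component S11 (x, y) (x', y)" if "x \<in> ?C" "x' \<in> ?C" "y \<in> ?C" "y \<noteq> 1" for x x' y
    proof (rule path_component_of_subset)
      show "?C \<times> {y} \<subseteq> S11" using that by (auto simp: S11_def)
      have "path_connected (?C \<times> {y})" by (intro path_connected_Times C path_connected_singleton)
      then show "path_component (?C \<times> {y}) (x, y) (x', y)"
        using that unfolding path_connected_component by blast
    qed
    have vertical: "path_component S11 (x, y) (x, y')" if "y \<in> ?C" "y' \<in> ?C" "x \<in> ?C" "x \<noteq> 1" for x y y'
    proof (rule path_component_of_subset)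
      show "{x} \<times> ?C \<subseteq> S11" using that by (auto simp: S11_def)
      have "path_connected ({x} \<times> ?C)" by (intro path_connected_Times C path_connected_singleton)
      then show "path_component ({x} \<times> ?C) (x, y) (x, y')"
        using that unfolding path_connected_component by blast
    qed
    have m: "-1 \<in> ?C" "-1 \<noteq> (1::complex)" by (simp_all add: one_neq_neg_one[symmetric] del: one_neq_neg_one)
    have C_uv: "u \<in> ?C" "v \<in> ?C" "u \<noteq> 1 \<or> v \<noteq> 1" using uv by (auto simp: S11_def)
    show ?thesis
    proof (cases "v = 1")
      case False
      show ?thesis
        using path_component_trans[OF horizontal[of u "-1" v] vertical[of v "-1" "-1"]] C_uv m False by blast
    next
      case True
      then show ?thesis
        using path_component_trans[OF vertical[of v "-1" u] horizontal[of u "-1" "-1"]] C_uv m by blast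
    qed
  qed
  have "path_component S11 p q"
    using path_component_trans[OF base path_component_sym[OF base]] assms by (metis prod.collapse)
  then show ?thesis using that unfolding path_component_def by blast
qed

text \<open>The two coordinates of the torus are indexed by truth values, so that winding number and homology
  are treated once for both of them.\<close>

definition coord :: "bool \<Rightarrow> complex \<times> complex \<Rightarrow> complex" where
  "coord i = (if i then snd else fst)"

definition wind :: "bool \<Rightarrow> (real \<Rightarrow> complex \<times> complex) \<Rightarrow> complex" where
  "wind i c = winding_number (coord i \<circ> c) 0"

lemma coord_continuous: "continuous_on S (coord i)"
  by (auto simp: coord_def intro!: continuous_intros)

lemma coord_S11: "coord i \<in> S11 \<rightarrow> - {0}"
  by (auto simp: coord_def S11_def)

lemma coord_path:
  assumes "path c" "path_image c \<subseteq> S11"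
  shows "path (coord i \<circ> c)" "0 \<notin> path_image (coord i \<circ> c)"
  using path_continuous_image[OF assms(1) coord_continuous] coord_S11[of i] assms(2)
  by (auto simp: path_image_compose Pi_def)

lemma wind_join:
  assumes "path c" "path_image c \<subseteq> S11" "path d" "path_image d \<subseteq> S11" "pathfinish c = pathstart d"
  shows "wind i (c +++ d) = wind i c + wind i d"
  unfolding wind_def path_compose_join
  using coord_path[OF assms(1,2)] coord_path[OF assms(3,4)] assms(5)
  by (intro winding_number_join) (auto simp: pathfinish_compose pathstart_compose)

lemma wind_reverse:
  assumes "path c" "path_image c \<subseteq> S11"
  shows "wind i (reversepath c) = - wind i c"
  unfolding wind_def path_compose_reversepath
  using coord_path[OF assms] by (intro winding_number_reversepath)

lemma wind_homotopic_paths: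
  assumes "homotopic_paths S11 c d" shows "wind i c = wind i d"
proof -
  have "homotopic_paths (- {0}) (coord i \<circ> c) (coord i \<circ> d)"
    by (rule homotopic_paths_continuous_image[OF assms coord_continuous coord_S11])
  then show ?thesis unfolding wind_def by (rule winding_number_homotopic_paths)
qed

lemma wind_homotopic_loops:
  assumes "homotopic_loops S11 c d" shows "wind i c = wind i d"
proof -
  have "homotopic_loops (- {0}) (coord i \<circ> c) (coord i \<circ> d)"
    by (rule homotopic_loops_continuous_image[OF assms coord_continuous coord_S11])
  then show ?thesis unfolding wind_def by (rule winding_number_homotopic_loops)
qed

lemma wind_loop_Ints:
  assumes "closed_curve c" shows "wind i c \<in> \<int>"
  unfolding wind_def using assms coord_path[of c i]
  by (intro integer_winding_number) (auto simp: closed_curve_def pathfinish_compose pathstart_compose)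

lemma wind_conj_path:
  assumes "path k" "path_image k \<subseteq> S11" "c \<in> loops_at (pathfinish k)"
  shows "wind i (conj_path k c) = wind i c"
  using assms unfolding conj_path_def
  by (subst wind_join wind_reverse; auto simp: loops_at_iff path_image_join wind_join wind_reverse)+

lemma wind_same_curve:
  assumes "same_curve c d"
  shows "(\<forall>i. wind i c = wind i d) \<or> (\<forall>i. wind i c = - wind i d)"
proof -
  consider "homotopic_loops S11 c d" | "homotopic_loops S11 c (reversepath d)"
    using assms by (auto simp: same_curve_def)
  then show ?thesis
  proof cases
    case 2
    then have "path d" "path_image d \<subseteq> S11"
      using homotopic_loops_imp_path[OF 2] homotopic_loops_imp_subset[OF 2] by auto
    then show ?thesis using wind_homotopic_loops[OF 2] wind_reverse by auto
  qed (use wind_homotopic_loops in blast)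
qed

lemma intersection_number_wind:
  "intersection_number c d = Re (wind False c * wind True d - wind True c * wind False d)"
  by (simp add: intersection_number_def wind_def coord_def)

definition wind_re :: "bool \<Rightarrow> (real \<Rightarrow> complex \<times> complex) \<Rightarrow> real" where
  "wind_re i c = Re (wind i c)"

lemma intersection_number_eq:
  assumes "closed_curve c" "closed_curve d"
  shows "intersection_number c d = wind_re False c * wind_re True d - wind_re True c * wind_re False d"
proof -
  have "Im (wind i e) = 0" if "closed_curve e" for i e
    using wind_loop_Ints[OF that, of i] by (auto elim!: Ints_cases)
  then show ?thesis using assms by (simp add: intersection_number_wind wind_re_def)
qed

text \<open>A coordinate circle through a point off the puncture, joined to the base point.\<close>

lemma loop_with_winding:
  assumes "p \<in> S11"
  obtains c where "c \<in> loops_at p" "wind_re j c = 1" "wind_re (\<not> j) c = 0"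
proof -
  define e where "e = (\<lambda>t. if j then (-1, circlepath 0 1 t) else (circlepath 0 1 t, -1))"
  define q :: "complex \<times> complex" where "q = (if j then (-1, 1) else (1, -1))"
  have m: "-1 \<noteq> (1::complex)" by (simp add: one_neq_neg_one[symmetric] del: one_neq_neg_one)
  have ps: "path (circlepath 0 1)" "path_image (circlepath 0 1) \<subseteq> sphere (0::complex) 1" by auto
  have "path e" using ps(1) unfolding path_def e_def by (cases j) (auto intro!: continuous_intros)
  moreover have "path_image e \<subseteq> S11"
  proof -
    have "circlepath 0 1 t \<in> sphere (0::complex) 1" if "t \<in> {0..1}" for t
      using ps(2) that unfolding path_image_def by blast
    then show ?thesis using m by (auto simp: path_image_def e_def S11_def)
  qed
  moreover have "pathstart e = q" "pathfinish e = q"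
    by (auto simp: e_def q_def pathstart_def pathfinish_def circlepath)
  ultimately have e: "e \<in> loops_at q" by (simp add: loops_at_iff)
  have "q \<in> S11" using m by (auto simp: q_def S11_def)
  then obtain k where k: "path k" "path_image k \<subseteq> S11" "pathstart k = p" "pathfinish k = q"
    using path_connected_S11[OF assms] by blast
  have we: "wind i e = (if i = j then 1 else 0)" for i
  proof (cases "i = j")
    case True
    then have "coord i \<circ> e = circlepath 0 1" by (auto simp: coord_def e_def fun_eq_iff)
    then show ?thesis using True by (simp add: wind_def winding_number_circlepath_centre)
  next
    case False
    then have "coord i \<circ> e = linepath (-1) (-1)"
      by (auto simp: coord_def e_def fun_eq_iff linepath_def algebra_simps)
    then show ?thesis using False by (simp add: wind_def)
  qed
  show ?thesis
  proof (rule that[of "conj_path k e"])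
    show "conj_path k e \<in> loops_at p" using conj_path_loop[of k e] k e by simp
    show "wind_re j (conj_path k e) = 1" "wind_re (\<not> j) (conj_path k e) = 0"
      using wind_conj_path[of k e] k e by (simp_all add: wind_re_def we)
  qed
qed

lemma (in group) additive_on_generators:
  fixes U :: "'a \<Rightarrow> real" and m n :: "'a \<Rightarrow> int"
  assumes U: "\<And>g h. g \<in> carrier G \<Longrightarrow> h \<in> carrier G \<Longrightarrow> U (g \<otimes> h) = U g + U h"
    and m: "\<And>g h. g \<in> carrier G \<Longrightarrow> h \<in> carrier G \<Longrightarrow> m (g \<otimes> h) = m g + m h"
    and n: "\<And>g h. g \<in> carrier G \<Longrightarrow> h \<in> carrier G \<Longrightarrow> n (g \<otimes> h) = n g + n h"
    and vals: "m a = 1" "m b = 0" "n a = 0" "n b = 1"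
    and ab: "a \<in> carrier G" "b \<in> carrier G" and g: "g \<in> generate G {a, b}"
  shows "U g = m g * U a + n g * U b"
proof -
  have inv: "U (inv h) = - U h" "m (inv h) = - m h" "n (inv h) = - n h" if "h \<in> carrier G" for h
    using U[of h "inv h"] U[of \<one> \<one>] m[of h "inv h"] m[of \<one> \<one>] n[of h "inv h"] n[of \<one> \<one>] that by simp_all
  show ?thesis
    using g
  proof (induction rule: generate.induct)
    case one
    then show ?case using U[of \<one> \<one>] m[of \<one> \<one>] n[of \<one> \<one>] by simp
  next
    case (eng h1 h2)
    have "h1 \<in> carrier G" "h2 \<in> carrier G"
      using eng(1,2) generate_incl[of "{a, b}"] ab by auto
    then show ?case using eng by (simp add: U m n algebra_simps)
  qed (use vals ab in \<open>auto simp: inv\<close>)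
qed

section \<open>The action of a homeomorphism on the fundamental group\<close>

lemma class_lift_hom:
  assumes F: "\<And>c. c \<in> loops_at p \<Longrightarrow> F c \<in> loops_at p"
    and cong: "\<And>c d. c \<in> loops_at p \<Longrightarrow> homotopic_paths S11 c d \<Longrightarrow> homotopic_paths S11 (F c) (F d)"
    and join: "\<And>c d. c \<in> loops_at p \<Longrightarrow> d \<in> loops_at p \<Longrightarrow> homotopic_paths S11 (F c +++ F d) (F (c +++ d))"
  obtains \<theta> where "\<theta> \<in> hom (pi1 p) (pi1 p)" "\<And>c. c \<in> loops_at p \<Longrightarrow> \<theta> (loop_class c) = loop_class (F c)"
proof -
  define \<theta> where "\<theta> = class_lift p (\<lambda>c. loop_class (F c))"
  have \<theta>: "\<theta> (loop_class c) = loop_class (F c)" if "c \<in> loops_at p" for c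
    unfolding \<theta>_def
    by (rule class_lift[OF that]) (use that cong loop_class_eqI in metis)
  have "\<theta> \<in> hom (pi1 p) (pi1 p)"
  proof (rule homI)
    show "\<theta> x \<in> carrier (pi1 p)" if "x \<in> carrier (pi1 p)" for x
      using that \<theta> F by auto
    show "\<theta> (x \<otimes>\<^bsub>pi1 p\<^esub> y) = \<theta> x \<otimes>\<^bsub>pi1 p\<^esub> \<theta> y"
      if xy: "x \<in> carrier (pi1 p)" "y \<in> carrier (pi1 p)" for x y
    proof -
      obtain c d where "x = loop_class c" "y = loop_class d" "c \<in> loops_at p" "d \<in> loops_at p"
        using xy by auto
      then show ?thesis
        using loop_class_eqI[OF join[of c d]] F by (simp add: \<theta> pi1_mult loops_at_join)
    qed
  qed
  with \<theta> show ?thesis using that by blast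
qed

text \<open>Transport by \<open>f\<close>, followed by a change of base point, is a surjective endomorphism of the
  fundamental group: preimages of loops come from the inverse homeomorphism. So the images of generators generate.\<close>

lemma homeomorphism_generates:
  assumes p: "p \<in> S11" and f: "homeomorphism S11 S11 f g"
    and ab: "\<alpha> \<in> loops_at p" "\<beta> \<in> loops_at p"
    and gen: "generate (pi1 p) {loop_class \<alpha>, loop_class \<beta>} = carrier (pi1 p)"
    and k: "path k" "path_image k \<subseteq> S11" "pathstart k = p" "pathfinish k = f p"
  shows "\<And>c. c \<in> loops_at p \<Longrightarrow> f \<circ> c \<in> loops_at (f p)"
    and "generate (pi1 p) {loop_class (conj_path k (f \<circ> \<alpha>)), loop_class (conj_path k (f \<circ> \<beta>))} = carrier (pi1 p)"
    and "loop_class (conj_path k (f \<circ> \<alpha>)) \<otimes>\<^bsub>pi1 p\<^esub> loop_class (conj_path k (f \<circ> \<beta>))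
      = loop_class (conj_path k ((f \<circ> \<alpha>) +++ (f \<circ> \<beta>)))"
proof -
  have cf: "continuous_on S11 f" "continuous_on S11 g" "f ` S11 = S11" "g ` S11 = S11"
    "\<And>x. x \<in> S11 \<Longrightarrow> g (f x) = x" "\<And>x. x \<in> S11 \<Longrightarrow> f (g x) = x"
    using f by (auto simp: homeomorphism_def)
  have map: "h \<circ> c \<in> loops_at (h q)"
    if "c \<in> loops_at q" "continuous_on S11 h" "h ` S11 \<subseteq> S11" for h c q
    using that path_continuous_image[of c h] continuous_on_subset[OF that(2), of "path_image c"]
    by (auto simp: loops_at_iff path_image_compose pathstart_compose pathfinish_compose)
  show fl: "f \<circ> c \<in> loops_at (f p)" if "c \<in> loops_at p" for c
    using map[OF that cf(1)] cf(3) by simp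
  define F where "F c = conj_path k (f \<circ> c)" for c
  have F: "F c \<in> loops_at p" if "c \<in> loops_at p" for c
    using conj_path_loop[OF k(1,2), of "f \<circ> c"] fl[OF that] k by (simp add: F_def)
  have join: "homotopic_paths S11 (F c +++ F d) (F (c +++ d))" if "c \<in> loops_at p" "d \<in> loops_at p" for c d
    unfolding F_def path_compose_join
    using fl[OF that(1)] fl[OF that(2)] k by (intro conj_path_join) (auto simp: loops_at_iff)
  have cong: "homotopic_paths S11 (F c) (F d)" if "c \<in> loops_at p" "homotopic_paths S11 c d" for c d
  proof -
    have "homotopic_paths S11 (f \<circ> c) (f \<circ> d)"
      using that(2) cf by (intro homotopic_paths_continuous_image) auto
    then show ?thesis
      unfolding F_def using k fl[OF that(1)] by (intro conj_path_cong) (auto simp: loops_at_iff)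
  qed
  obtain \<theta> where \<theta>: "\<theta> \<in> hom (pi1 p) (pi1 p)" "\<And>c. c \<in> loops_at p \<Longrightarrow> \<theta> (loop_class c) = loop_class (F c)"
    using class_lift_hom[OF F cong join] by blast
  interpret group "pi1 p" by (rule group_pi1[OF p])
  interpret \<theta>: group_hom "pi1 p" "pi1 p" \<theta>
    using \<theta> by (intro group_hom.intro group_hom_axioms.intro group_pi1[OF p])
  have surj: "\<theta> ` carrier (pi1 p) = carrier (pi1 p)"
  proof
    show "\<theta> ` carrier (pi1 p) \<subseteq> carrier (pi1 p)" using \<theta>.hom_closed by blast
    show "carrier (pi1 p) \<subseteq> \<theta> ` carrier (pi1 p)"
    proof
      fix X assume "X \<in> carrier (pi1 p)"
      then obtain c where c: "X = loop_class c" "c \<in> loops_at p" by auto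
      define d where "d = reversepath k +++ c +++ k"
      have d: "d \<in> loops_at (f p)"
        using c k by (auto simp: d_def loops_at_iff path_image_join)
      have gd: "g \<circ> d \<in> loops_at p" using map[OF d cf(2)] cf p by auto
      have "homotopic_paths S11 (f \<circ> (g \<circ> d)) d"
      proof (rule homotopic_paths_sym[OF homotopic_paths_eq])
        show "d t = (f \<circ> (g \<circ> d)) t" if "t \<in> {0..1}" for t
        proof -
          have "d t \<in> S11" using d that by (auto simp: loops_at_iff path_image_def)
          then show ?thesis by (simp add: cf(6))
        qed
      qed (use d in \<open>auto simp: loops_at_iff\<close>)
      then have "homotopic_paths S11 (F (g \<circ> d)) (conj_path k d)"
        unfolding F_def using k fl[OF gd]
        by (intro conj_path_cong) (auto simp: loops_at_iff)
      also have "homotopic_paths S11 (conj_path k d) c"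
        unfolding d_def using k c by (intro conj_path_reverse) (auto simp: loops_at_iff)
      finally have "loop_class (F (g \<circ> d)) = loop_class c" by (rule loop_class_eqI)
      then have "X = \<theta> (loop_class (g \<circ> d))" using c(1) \<theta>(2)[OF gd] by simp
      then show "X \<in> \<theta> ` carrier (pi1 p)" using gd by simp
    qed
  qed
  have "generate (pi1 p) (\<theta> ` {loop_class \<alpha>, loop_class \<beta>}) = \<theta> ` generate (pi1 p) {loop_class \<alpha>, loop_class \<beta>}"
    using ab by (intro \<theta>.generate_img) auto
  then show "generate (pi1 p) {loop_class (conj_path k (f \<circ> \<alpha>)), loop_class (conj_path k (f \<circ> \<beta>))} = carrier (pi1 p)"
    using ab by (simp only: gen surj image_insert image_empty \<theta>(2) F_def)
  show "loop_class (conj_path k (f \<circ> \<alpha>)) \<otimes>\<^bsub>pi1 p\<^esub> loop_class (conj_path k (f \<circ> \<beta>))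
      = loop_class (conj_path k ((f \<circ> \<alpha>) +++ (f \<circ> \<beta>)))"
    using loop_class_eqI[OF join[OF ab]] F[OF ab(1)] F[OF ab(2)]
    by (simp add: pi1_mult F_def path_compose_join)
qed

text \<open>The trace along a curve is well defined: two representations with the same three traces agree on all
  traces, and another path to the base point conjugates the class.\<close>

lemma curve_trace_eq:
  assumes p: "p \<in> S11" and ab: "\<alpha> \<in> loops_at p" "\<beta> \<in> loops_at p"
    and gen: "generate (pi1 p) {loop_class \<alpha>, loop_class \<beta>} = carrier (pi1 p)"
    and \<rho>: "holonomy p \<alpha> \<beta> X \<rho>"
    and k: "path k" "path_image k \<subseteq> S11" "pathstart k = p" and c: "c \<in> loops_at (pathfinish k)"
  shows "curve_trace p \<alpha> \<beta> X c = trace (\<rho> (loop_class (conj_path k c)))"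
  unfolding curve_trace_def
proof (rule the_equality)
  have c': "pathstart c = pathfinish k" using c by (simp add: loops_at_iff)
  show "\<exists>\<rho>' k'. holonomy p \<alpha> \<beta> X \<rho>' \<and> path k' \<and> path_image k' \<subseteq> S11 \<and> pathstart k' = p \<and>
      pathfinish k' = pathstart c \<and> trace (\<rho> (loop_class (conj_path k c))) =
      trace (\<rho>' (loop_class (k' +++ c +++ reversepath k')))"
    using \<rho> k c' by (intro exI[of _ \<rho>] exI[of _ k]) (simp add: conj_path_def)
next
  fix t assume "\<exists>\<rho>' k'. holonomy p \<alpha> \<beta> X \<rho>' \<and> path k' \<and> path_image k' \<subseteq> S11 \<and> pathstart k' = p \<and>
      pathfinish k' = pathstart c \<and> t = trace (\<rho>' (loop_class (k' +++ c +++ reversepath k')))"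
  then obtain \<rho>' h where \<rho>': "holonomy p \<alpha> \<beta> X \<rho>'"
    and h: "path h" "path_image h \<subseteq> S11" "pathstart h = p" "pathfinish h = pathstart c"
    and t: "t = trace (\<rho>' (loop_class (conj_path h c)))" by (auto simp: conj_path_def)
  interpret group "pi1 p" by (rule group_pi1[OF p])
  have hom: "\<rho> \<in> hom (pi1 p) SL2R" "\<rho>' \<in> hom (pi1 p) SL2R"
    using \<rho> \<rho>' by (auto simp: holonomy_def)
  have abG: "loop_class \<alpha> \<in> carrier (pi1 p)" "loop_class \<beta> \<in> carrier (pi1 p)" using ab by auto
  have c0: "path c" "path_image c \<subseteq> S11" "pathfinish c = pathstart c" "pathfinish k = pathstart c"
    using c by (auto simp: loops_at_iff)
  define e where "e = h +++ reversepath k"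
  have e: "e \<in> loops_at p" using h k c0 by (auto simp: e_def loops_at_iff path_image_join)
  have kc: "conj_path k c \<in> loops_at p" using conj_path_loop[OF k(1,2) c] k by simp
  have hc: "conj_path h c \<in> loops_at p" using conj_path_loop[OF h(1,2), of c] h c0 by (simp add: loops_at_iff)
  have "homotopic_paths S11 (conj_path e (conj_path k c)) (conj_path h c)"
    unfolding e_def using h k c0 by (intro conj_path_conj_path) auto
  then have "loop_class (conj_path h c) = loop_class (conj_path e (conj_path k c))"
    by (rule loop_class_eqI[symmetric])
  also have "\<dots> = loop_class e \<otimes>\<^bsub>pi1 p\<^esub> (loop_class (conj_path k c) \<otimes>\<^bsub>pi1 p\<^esub> inv\<^bsub>pi1 p\<^esub> (loop_class e))"
    unfolding conj_path_def[of e] using e kc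
    by (simp add: pi1_inv[OF p] pi1_mult loops_at_reverse loops_at_join)
  finally have cl: "loop_class (conj_path h c) =
      loop_class e \<otimes>\<^bsub>pi1 p\<^esub> loop_class (conj_path k c) \<otimes>\<^bsub>pi1 p\<^esub> inv\<^bsub>pi1 p\<^esub> (loop_class e)"
    using m_assoc[of "loop_class e" "loop_class (conj_path k c)" "inv\<^bsub>pi1 p\<^esub> loop_class e"]
      inv_closed[of "loop_class e"] e kc by (simp del: inv_closed)
  have "t = trace (\<rho> (loop_class (conj_path h c)))"
    unfolding t
  proof (rule trace_determined[OF hom(2,1) abG gen])
    have "trace (\<rho>' (loop_class (\<alpha> +++ \<beta>))) = trace (\<rho> (loop_class (\<alpha> +++ \<beta>)))"
      using \<rho> \<rho>' by (auto simp: holonomy_def)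
    then show "trace (\<rho>' (loop_class \<alpha> \<otimes>\<^bsub>pi1 p\<^esub> loop_class \<beta>)) = trace (\<rho> (loop_class \<alpha> \<otimes>\<^bsub>pi1 p\<^esub> loop_class \<beta>))"
      using ab by (simp add: pi1_mult)
  qed (use \<rho> \<rho>' hc in \<open>auto simp: holonomy_def\<close>)
  also have "\<dots> = trace (\<rho> (loop_class (conj_path k c)))"
    unfolding cl using e kc by (intro trace_conj[OF hom(1)]) auto
  finally show "t = trace (\<rho> (loop_class (conj_path k c)))" .
qed

section \<open>The limit of the slope\<close>

text \<open>The exponent sums of \<open>\<alpha>\<close> and \<open>\<beta>\<close> are coordinates for the homology, in which the intersection form is a
  multiple of the determinant. The multiple is nonzero, since the two coordinate circles of the torus intersect.\<close>

lemma homology_coordinates: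
  assumes p: "p \<in> S11" and ab: "\<alpha> \<in> loops_at p" "\<beta> \<in> loops_at p"
    and free: "free_on (pi1 p) {loop_class \<alpha>, loop_class \<beta>}" and neq: "loop_class \<alpha> \<noteq> loop_class \<beta>"
  obtains m n :: "(real \<Rightarrow> complex \<times> complex) set \<Rightarrow> int" where
    "\<And>g h. g \<in> carrier (pi1 p) \<Longrightarrow> h \<in> carrier (pi1 p) \<Longrightarrow> m (g \<otimes>\<^bsub>pi1 p\<^esub> h) = m g + m h"
    "\<And>g h. g \<in> carrier (pi1 p) \<Longrightarrow> h \<in> carrier (pi1 p) \<Longrightarrow> n (g \<otimes>\<^bsub>pi1 p\<^esub> h) = n g + n h"
    "m (loop_class \<alpha>) = 1" "m (loop_class \<beta>) = 0" "n (loop_class \<alpha>) = 0" "n (loop_class \<beta>) = 1"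
    "\<And>c d. c \<in> loops_at p \<Longrightarrow> d \<in> loops_at p \<Longrightarrow> intersection_number c d = intersection_number \<alpha> \<beta> *
       (m (loop_class c) * n (loop_class d) - n (loop_class c) * m (loop_class d))"
    "intersection_number \<alpha> \<beta> \<noteq> 0"
proof -
  let ?a = "loop_class \<alpha>" and ?b = "loop_class \<beta>"
  interpret group "pi1 p" by (rule group_pi1[OF p])
  interpret free_group "pi1 p" "{?a, ?b}" by unfold_locales (rule free)
  have ex: "\<exists>u. u \<in> hom (pi1 p) integer_group \<and> u ?a = i \<and> u ?b = j" for i j :: int
  proof -
    have "(\<lambda>x. if x = ?a then i else j) \<in> {?a, ?b} \<rightarrow> carrier integer_group"
      by (auto simp: integer_group_def)
    from hom_extension[OF group_integer_group this] show ?thesis using neq by auto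
  qed
  obtain m where m: "m \<in> hom (pi1 p) integer_group" "m ?a = 1" "m ?b = 0" using ex[of 1 0] by blast
  obtain n where n: "n \<in> hom (pi1 p) integer_group" "n ?a = 0" "n ?b = 1" using ex[of 0 1] by blast
  have add: "u (g \<otimes>\<^bsub>pi1 p\<^esub> h) = u g + u h"
    if "u \<in> hom (pi1 p) integer_group" "g \<in> carrier (pi1 p)" "h \<in> carrier (pi1 p)" for u g h
    using hom_mult[OF that] by (simp add: integer_group_def)
  have abG: "?a \<in> carrier (pi1 p)" "?b \<in> carrier (pi1 p)" using ab by auto
  have W: "wind_re i c = m (loop_class c) * wind_re i \<alpha> + n (loop_class c) * wind_re i \<beta>"
    if c: "c \<in> loops_at p" for i c
  proof -
    define U where "U = class_lift p (wind_re i)"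
    have U: "U (loop_class c) = wind_re i c" if "c \<in> loops_at p" for c
      unfolding U_def by (rule class_lift[OF that]) (simp add: wind_re_def wind_homotopic_paths)
    have "U (g \<otimes>\<^bsub>pi1 p\<^esub> h) = U g + U h" if gh: "g \<in> carrier (pi1 p)" "h \<in> carrier (pi1 p)" for g h
    proof -
      obtain c d where cd: "g = loop_class c" "h = loop_class d" "c \<in> loops_at p" "d \<in> loops_at p"
        using gh by auto
      then have "wind_re i (c +++ d) = wind_re i c + wind_re i d"
        by (simp add: wind_re_def wind_join loops_at_iff)
      with cd show ?thesis by (simp add: pi1_mult loops_at_join U)
    qed
    then have "U (loop_class c) = m (loop_class c) * U ?a + n (loop_class c) * U ?b"
      using add[OF m(1)] add[OF n(1)] m n abG gen c
      by (intro additive_on_generators) auto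
    then show ?thesis using U ab c by simp
  qed
  have I: "intersection_number c d = intersection_number \<alpha> \<beta> *
       (m (loop_class c) * n (loop_class d) - n (loop_class c) * m (loop_class d))"
    if cd: "c \<in> loops_at p" "d \<in> loops_at p" for c d
  proof -
    have "closed_curve c" "closed_curve d" "closed_curve \<alpha>" "closed_curve \<beta>"
      using cd ab by (auto simp: loops_at_def)
    then show ?thesis
      by (simp only: intersection_number_eq W[OF cd(1)] W[OF cd(2)]) (simp add: algebra_simps)
  qed
  obtain c1 c2 where c: "c1 \<in> loops_at p" "wind_re False c1 = 1" "wind_re True c1 = 0"
    "c2 \<in> loops_at p" "wind_re True c2 = 1" "wind_re False c2 = 0"
    using loop_with_winding[OF p, of False] loop_with_winding[OF p, of True] by (metis (full_types))
  then have "intersection_number c1 c2 = 1" by (simp add: intersection_number_eq loops_at_def)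
  then have "intersection_number \<alpha> \<beta> \<noteq> 0" using I[OF c(1,4)] by auto
  then show ?thesis using that add[OF m(1)] add[OF n(1)] m n I by blast
qed

text \<open>Conjugation in the fundamental group is undone by a free homotopy.\<close>

lemma homotopic_conj_generator:
  assumes p: "p \<in> S11" and \<alpha>: "\<alpha> \<in> loops_at p" and c: "c \<in> loops_at p"
    and conj: "conj_pm (pi1 p) (loop_class \<alpha>) (loop_class c)"
  shows "homotopic_loops S11 c \<alpha> \<or> homotopic_loops S11 c (reversepath \<alpha>)"
proof -
  interpret group "pi1 p" by (rule group_pi1[OF p])
  have free: "homotopic_loops S11 c d"
    if d: "d \<in> loops_at p" and k: "k \<in> loops_at p"
      and eq: "loop_class c = loop_class k \<otimes>\<^bsub>pi1 p\<^esub> loop_class d \<otimes>\<^bsub>pi1 p\<^esub> inv\<^bsub>pi1 p\<^esub> (loop_class k)" for d k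
  proof -
    have "loop_class c = loop_class k \<otimes>\<^bsub>pi1 p\<^esub> (loop_class d \<otimes>\<^bsub>pi1 p\<^esub> inv\<^bsub>pi1 p\<^esub> (loop_class k))"
      using m_assoc[of "loop_class k" "loop_class d" "inv\<^bsub>pi1 p\<^esub> loop_class k"]
        inv_closed[of "loop_class k"] d k eq by (simp del: inv_closed)
    also have "\<dots> = loop_class (conj_path k d)"
      using d k by (simp add: conj_path_def pi1_inv[OF p] pi1_mult loops_at_reverse loops_at_join)
    finally have "homotopic_paths S11 c (conj_path k d)"
      using c loop_class_eq[of c] by (auto simp: loops_at_iff)
    then have "homotopic_loops S11 c (conj_path k d)"
      using c d k by (intro homotopic_paths_imp_homotopic_loops) (auto simp: loops_at_iff conj_path_def)
    moreover have "homotopic_loops S11 (conj_path k d) d"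
      unfolding conj_path_def using d k by (intro homotopic_loops_conjugate) (auto simp: loops_at_iff)
    ultimately show ?thesis by (rule homotopic_loops_trans)
  qed
  obtain k where k: "k \<in> loops_at p"
    "loop_class c = loop_class k \<otimes>\<^bsub>pi1 p\<^esub> loop_class \<alpha> \<otimes>\<^bsub>pi1 p\<^esub> inv\<^bsub>pi1 p\<^esub> (loop_class k) \<or>
     loop_class c = loop_class k \<otimes>\<^bsub>pi1 p\<^esub> loop_class (reversepath \<alpha>) \<otimes>\<^bsub>pi1 p\<^esub> inv\<^bsub>pi1 p\<^esub> (loop_class k)"
    using conj by (auto simp: conj_pm_def pi1_inv[OF p \<alpha>])
  then show ?thesis using free[OF \<alpha>] free[OF loops_at_reverse[OF \<alpha>]] by blast
qed

lemma same_curve_sym_trans: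
  assumes "same_curve c d" "homotopic_loops S11 c e \<or> homotopic_loops S11 c (reversepath e)"
  shows "same_curve d e"
  using assms homotopic_loops_reversepath[of S11 c "reversepath d"]
    homotopic_loops_reversepath[of S11 c "reversepath e"] homotopic_loops_reversepath[of S11 c e]
  unfolding same_curve_def reversepath_reversepath
  by (meson homotopic_loops_sym homotopic_loops_trans)

lemma holonomy_iff_trace_triple:
  assumes "\<alpha> \<in> loops_at p" "\<beta> \<in> loops_at p" "p \<in> S11"
  shows "holonomy p \<alpha> \<beta> X \<rho> \<longleftrightarrow>
    \<rho> \<in> hom (pi1 p) SL2R \<and> group.trace_triple (pi1 p) \<rho> (loop_class \<alpha>) (loop_class \<beta>) = X"
  using assms by (simp add: holonomy_def group.trace_triple_def[OF group_pi1] pi1_mult)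

text \<open>The change of trace coordinates is surjective, because every point of Teichmueller space
  is the triple of traces of \<open>w1\<close>, \<open>w2\<close> under some representation. So the earthquake about \<open>w1\<close>
  lifts to a family of representations.\<close>

lemma earthquake_representations:
  assumes p: "p \<in> S11" and ab: "\<alpha> \<in> loops_at p" "\<beta> \<in> loops_at p"
    and free: "free_on (pi1 p) {loop_class \<alpha>, loop_class \<beta>}" and neq: "loop_class \<alpha> \<noteq> loop_class \<beta>"
    and k: "path k" "path_image k \<subseteq> S11" "pathstart k = p"
    and cd: "c \<in> loops_at (pathfinish k)" "d \<in> loops_at (pathfinish k)"
    and w: "w1 = loop_class (conj_path k c)" "w2 = loop_class (conj_path k d)"
      "w1 \<otimes>\<^bsub>pi1 p\<^esub> w2 = loop_class (conj_path k (c +++ d))"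
    and gen: "generate (pi1 p) {w1, w2} = carrier (pi1 p)" and u: "u \<in> FN_space"
  obtains l t \<rho> where "0 < l" "\<And>s. \<rho> s \<in> hom (pi1 p) SL2R"
    "\<And>s. group.trace_triple (pi1 p) (\<rho> s) (loop_class \<alpha>) (loop_class \<beta>)
        = earthquake_tr p \<alpha> \<beta> c d (FN_to_tr u) s"
    "\<And>s. group.trace_triple (pi1 p) (\<rho> s) w1 w2 = FN_to_tr (l, t - s)"
proof -
  let ?a = "loop_class \<alpha>" and ?b = "loop_class \<beta>" and ?tt = "group.trace_triple (pi1 p)"
  interpret group "pi1 p" by (rule group_pi1[OF p])
  have abG: "?a \<in> carrier (pi1 p)" "?b \<in> carrier (pi1 p)" using ab by auto
  have gab: "generate (pi1 p) {?a, ?b} = carrier (pi1 p)" using free by (simp add: free_on_def)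
  have wG: "w1 \<in> carrier (pi1 p)" "w2 \<in> carrier (pi1 p)"
    unfolding w(1,2) using conj_path_loop[OF k(1,2) cd(1)] conj_path_loop[OF k(1,2) cd(2)] k by auto
  have down: "nielsen (pi1 p) (w1, w2) (?a, ?b)" by (rule nielsen_theorem[OF free neq wG gen])
  have up: "nielsen (pi1 p) (?a, ?b) (w1, w2)" using nielsen_sym[OF down] wG by simp
  define \<phi> where "\<phi> = trace_change p \<alpha> \<beta> c d"
  have \<phi>: "\<phi> X = ?tt \<rho> w1 w2" if "holonomy p \<alpha> \<beta> X \<rho>" for X \<rho>
    using curve_trace_eq[OF p ab gab that k] cd loops_at_join[OF cd]
    by (simp add: \<phi>_def trace_change_def trace_triple_def w(3) flip: w(1,2))
  have hol: "\<exists>\<rho>. holonomy p \<alpha> \<beta> X \<rho>" if "X \<in> T_tr" for X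
    using trace_triple_realized[OF free neq nielsen.refl that]
    by (auto simp: holonomy_iff_trace_triple[OF ab p])
  have \<phi>_T: "\<phi> X \<in> T_tr" if X: "X \<in> T_tr" for X
  proof -
    obtain \<rho> where \<rho>: "holonomy p \<alpha> \<beta> X \<rho>" using hol[OF X] by blast
    then show ?thesis
      using nielsen_T_tr[of \<rho>, OF _ up] abG X by (simp add: \<phi>[OF \<rho>] holonomy_iff_trace_triple[OF ab p])
  qed
  have \<phi>_surj: "Y \<in> \<phi> ` T_tr" if Y: "Y \<in> T_tr" for Y
  proof -
    obtain \<rho> where \<rho>: "\<rho> \<in> hom (pi1 p) SL2R" "?tt \<rho> w1 w2 = Y"
      using trace_triple_realized[OF free neq up Y] by auto
    have "?tt \<rho> ?a ?b \<in> T_tr"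
      using nielsen_T_tr[OF \<rho>(1) down] wG \<rho>(2) Y by simp
    moreover have "\<phi> (?tt \<rho> ?a ?b) = Y"
      using \<phi>[of "?tt \<rho> ?a ?b" \<rho>] \<rho> by (simp add: holonomy_iff_trace_triple[OF ab p])
    ultimately show ?thesis by blast
  qed
  define Y0 where "Y0 = \<phi> (FN_to_tr u)"
  have Y0: "Y0 \<in> T_tr" unfolding Y0_def by (intro \<phi>_T FN_to_tr_in_T_tr u)
  obtain l t where lt: "tr_to_FN Y0 = (l, t)" by (cases "tr_to_FN Y0")
  have l: "0 < l" using tr_to_FN(1)[OF Y0] by (simp add: lt FN_space_def)
  define Y where "Y s = FN_to_tr (l, t - s)" for s
  have Y: "earthquake_alpha_tr Y0 s = Y s" for s by (simp add: earthquake_alpha_tr_def lt Y_def)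
  have Y_T: "Y s \<in> T_tr" for s unfolding Y_def using l by (intro FN_to_tr_in_T_tr) (simp add: FN_space_def)
  define X where "X s = inv_into T_tr \<phi> (Y s)" for s
  have X: "X s \<in> T_tr" "\<phi> (X s) = Y s" for s
    unfolding X_def using inv_into_into[OF \<phi>_surj[OF Y_T]] f_inv_into_f[OF \<phi>_surj[OF Y_T]] by auto
  have X_eq: "X s = earthquake_tr p \<alpha> \<beta> c d (FN_to_tr u) s" for s
    by (simp add: earthquake_tr_def Let_def \<phi>_def[symmetric] Y0_def[symmetric] Y X_def)
  define \<rho> where "\<rho> s = (SOME \<rho>. holonomy p \<alpha> \<beta> (X s) \<rho>)" for s
  have \<rho>: "holonomy p \<alpha> \<beta> (X s) (\<rho> s)" for s
    unfolding \<rho>_def using hol[OF X(1)] by (rule someI_ex)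
  show ?thesis
  proof (rule that[of l \<rho> t])
    show "?tt (\<rho> s) w1 w2 = FN_to_tr (l, t - s)" for s
      using \<phi>[OF \<rho>[of s]] X(2)[of s] by (simp add: Y_def)
  qed (use l \<rho> in \<open>simp_all add: holonomy_iff_trace_triple[OF ab p] X_eq\<close>)
qed

theorem theorem3p4p2:
  fixes p :: "complex \<times> complex"
    and \<alpha> \<beta> \<gamma> :: "real \<Rightarrow> complex \<times> complex"
    and E :: "real \<times> real \<Rightarrow> real \<Rightarrow> real \<times> real"
  assumes "meridian_longitude p \<alpha> \<beta>"
    and "simple_closed_curve \<gamma>"
    and "left_earthquake_FN p \<alpha> \<beta> \<gamma> E"
  shows "(same_curve \<gamma> \<alpha> \<longrightarrow>
            - (1 / slope \<alpha> \<beta> \<alpha>) = - \<infinity> \<and>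
            (\<forall>u\<in>{0<..} \<times> UNIV.
               ((\<lambda>s. ereal (snd (E u s) / fst (E u s))) \<longlongrightarrow> - (1 / slope \<alpha> \<beta> \<alpha>)) at_top)) \<and>
         (\<not> same_curve \<gamma> \<alpha> \<longrightarrow>
            1 / slope \<alpha> \<beta> \<gamma> = ereal (intersection_number \<gamma> \<beta> / intersection_number \<gamma> \<alpha>) \<and>
            (\<forall>u\<in>{0<..} \<times> UNIV.
               ((\<lambda>s. ereal (snd (E u s) / fst (E u s))) \<longlongrightarrow> 1 / slope \<alpha> \<beta> \<gamma>) at_top))"
proof -
  let ?a = "loop_class \<alpha>" and ?b = "loop_class \<beta>"
  have ab: "\<alpha> \<in> loops_at p" "\<beta> \<in> loops_at p" and free: "free_on (pi1 p) {?a, ?b}" and neq: "?a \<noteq> ?b"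
    using assms(1) by (auto simp: meridian_longitude_def)
  have p: "p \<in> S11" using ab(1) pathstart_in_path_image[of \<alpha>] by (auto simp: loops_at_iff)
  interpret group "pi1 p" by (rule group_pi1[OF p])
  have abG: "?a \<in> carrier (pi1 p)" "?b \<in> carrier (pi1 p)" using ab by auto
  have closed: "closed_curve \<alpha>" "closed_curve \<beta>" "closed_curve \<gamma>"
    using ab assms(2) by (auto simp: loops_at_def simple_closed_curve_def)
  obtain f where f: "op_homeo f" "same_curve (f \<circ> \<alpha>) \<gamma>"
    and E: "\<And>u s. u \<in> FN_space \<Longrightarrow>
        E u s = tr_to_FN (earthquake_tr p \<alpha> \<beta> (f \<circ> \<alpha>) (f \<circ> \<beta>) (FN_to_tr u) s)"
    using assms(3) by (auto simp: left_earthquake_FN_def)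
  obtain g where g: "homeomorphism S11 S11 f g" using f(1) by (auto simp: op_homeo_def)
  have "f p \<in> S11" using g p by (auto simp: homeomorphism_def)
  then obtain k where k: "path k" "path_image k \<subseteq> S11" "pathstart k = p" "pathfinish k = f p"
    using path_connected_S11[OF p] by blast
  have gab: "generate (pi1 p) {?a, ?b} = carrier (pi1 p)" using free by (simp add: free_on_def)
  note hg = homeomorphism_generates[OF p g ab gab k]
  define ca cb where "ca = conj_path k (f \<circ> \<alpha>)" and "cb = conj_path k (f \<circ> \<beta>)"
  define w1 w2 where "w1 = loop_class ca" and "w2 = loop_class cb"
  note w_defs = w1_def w2_def ca_def cb_def
  have fab: "f \<circ> \<alpha> \<in> loops_at (pathfinish k)" "f \<circ> \<beta> \<in> loops_at (pathfinish k)"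
    using hg(1) ab k by auto
  have cab: "ca \<in> loops_at p" "cb \<in> loops_at p"
    using conj_path_loop[OF k(1,2) fab(1)] conj_path_loop[OF k(1,2) fab(2)] k by (auto simp: ca_def cb_def)
  have wG: "w1 \<in> carrier (pi1 p)" "w2 \<in> carrier (pi1 p)" using cab by (auto simp: w1_def w2_def)
  have gen_w: "generate (pi1 p) {w1, w2} = carrier (pi1 p)" using hg(2) by (simp add: w_defs)
  obtain m n :: "(real \<Rightarrow> complex \<times> complex) set \<Rightarrow> int" where
    m: "\<And>g h. g \<in> carrier (pi1 p) \<Longrightarrow> h \<in> carrier (pi1 p) \<Longrightarrow> m (g \<otimes>\<^bsub>pi1 p\<^esub> h) = m g + m h" and
    n: "\<And>g h. g \<in> carrier (pi1 p) \<Longrightarrow> h \<in> carrier (pi1 p) \<Longrightarrow> n (g \<otimes>\<^bsub>pi1 p\<^esub> h) = n g + n h" and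
    vals: "m ?a = 1" "m ?b = 0" "n ?a = 0" "n ?b = 1" and
    I: "\<And>c d. c \<in> loops_at p \<Longrightarrow> d \<in> loops_at p \<Longrightarrow> intersection_number c d = intersection_number \<alpha> \<beta> *
       (m (loop_class c) * n (loop_class d) - n (loop_class c) * m (loop_class d))" and
    D: "intersection_number \<alpha> \<beta> \<noteq> 0"
    using homology_coordinates[OF p ab free neq] by blast
  have wind_c: "wind i ca = wind i (f \<circ> \<alpha>)" "wind i cb = wind i (f \<circ> \<beta>)" for i
    using wind_conj_path[OF k(1,2)] fab by (auto simp: ca_def cb_def)
  have "intersection_number ca cb = intersection_number (f \<circ> \<alpha>) (f \<circ> \<beta>)"
    by (simp add: intersection_number_wind wind_c)
  also have "\<dots> = intersection_number \<alpha> \<beta>" using f(1) closed by (auto simp: op_homeo_def)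
  finally have "real_of_int (m w1 * n w2 - n w1 * m w2) = 1"
    using I[OF cab] D by (simp add: w1_def w2_def)
  then have det: "m w1 * n w2 - n w1 * m w2 = 1" by (simp only: of_int_eq_1_iff)
  \<comment> \<open>\<open>\<gamma>\<close> is the image of \<open>\<alpha>\<close> up to orientation, so that its intersection numbers are known up to a
    common sign \<open>e\<close>, which cancels in the slope\<close>
  have "(\<forall>i. wind i \<gamma> = wind i ca) \<or> (\<forall>i. wind i \<gamma> = - wind i ca)"
    using wind_same_curve[OF f(2)] by (auto simp: wind_c)
  then obtain e :: real where e: "e = 1 \<or> e = -1"
    "\<And>c. intersection_number \<gamma> c = e * intersection_number ca c"
  proof
    assume "\<forall>i. wind i \<gamma> = wind i ca"
    then show ?thesis using that[of 1] by (simp add: intersection_number_wind)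
  next
    assume "\<forall>i. wind i \<gamma> = - wind i ca"
    then show ?thesis using that[of "-1"] by (simp add: intersection_number_wind algebra_simps)
  qed
  have I\<gamma>: "intersection_number \<gamma> \<alpha> = - e * intersection_number \<alpha> \<beta> * n w1"
    "intersection_number \<gamma> \<beta> = e * intersection_number \<alpha> \<beta> * m w1"
    using I[OF cab(1) ab(1)] I[OF cab(1) ab(2)] vals by (simp_all add: e(2) w1_def)
  have e0: "e \<noteq> 0" using e(1) by auto
  have I\<alpha>: "intersection_number \<alpha> \<alpha> = 0" by (simp add: intersection_number_wind mult.commute)
  have slope_\<alpha>: "- (1 / slope \<alpha> \<beta> \<alpha>) = - \<infinity>" using D by (simp add: slope_def I\<alpha> divide_ereal_def)
  \<comment> \<open>the two cases are told apart by the homology of \<open>\<gamma>\<close>: a primitive class homologous to \<open>\<alpha>\<close> up to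
    sign is conjugate to \<open>\<alpha>\<close> up to inversion\<close>
  have n_zero: "n w1 = 0" if "same_curve \<gamma> \<alpha>"
  proof -
    have "intersection_number \<gamma> \<alpha> = 0"
      using wind_same_curve[OF that] I\<alpha> by (auto simp: intersection_number_wind)
    then show ?thesis using I\<gamma>(1) e0 D by simp
  qed
  have n_nonzero: "n w1 \<noteq> 0" if "\<not> same_curve \<gamma> \<alpha>"
  proof
    assume "n w1 = 0"
    moreover have "nielsen (pi1 p) (?a, ?b) (w1, w2)"
      using nielsen_sym[OF nielsen_theorem[OF free neq wG gen_w]] wG by simp
    ultimately have "conj_pm (pi1 p) ?a (loop_class ca)"
      using primitive_conj_generator[OF abG, of w1 w2 n] n vals by (simp add: w1_def)
    then have "homotopic_loops S11 ca \<alpha> \<or> homotopic_loops S11 ca (reversepath \<alpha>)"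
      by (rule homotopic_conj_generator[OF p ab(1) cab(1)])
    moreover have "homotopic_loops S11 (f \<circ> \<alpha>) ca"
      unfolding ca_def conj_path_def using k fab(1)
      by (intro homotopic_loops_sym[OF homotopic_loops_conjugate]) (auto simp: loops_at_iff)
    ultimately have "homotopic_loops S11 (f \<circ> \<alpha>) \<alpha> \<or> homotopic_loops S11 (f \<circ> \<alpha>) (reversepath \<alpha>)"
      using homotopic_loops_trans by blast
    then show False using same_curve_sym_trans[OF f(2)] that by blast
  qed
  have limits: "n w1 \<noteq> 0 \<Longrightarrow> ((\<lambda>s. snd (E u s) / fst (E u s)) \<longlongrightarrow> - (m w1 / n w1)) at_top"
    "n w1 = 0 \<Longrightarrow> filterlim (\<lambda>s. snd (E u s) / fst (E u s)) at_bot at_top"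
    if u: "u \<in> {0<..} \<times> UNIV" for u
  proof -
    have u': "u \<in> FN_space" using u by (simp add: FN_space_def)
    have wc: "w1 = loop_class (conj_path k (f \<circ> \<alpha>))" "w2 = loop_class (conj_path k (f \<circ> \<beta>))"
      "w1 \<otimes>\<^bsub>pi1 p\<^esub> w2 = loop_class (conj_path k ((f \<circ> \<alpha>) +++ (f \<circ> \<beta>)))"
      using hg(3) by (simp_all add: w_defs)
    obtain l t \<rho> where r: "0 < l" "\<And>s. \<rho> s \<in> hom (pi1 p) SL2R"
      "\<And>s. trace_triple (\<rho> s) ?a ?b = earthquake_tr p \<alpha> \<beta> (f \<circ> \<alpha>) (f \<circ> \<beta>) (FN_to_tr u) s"
      "\<And>s. trace_triple (\<rho> s) w1 w2 = FN_to_tr (l, t - s)"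
      by (rule earthquake_representations[OF p ab free neq k(1-3) fab wc gen_w u']) (rule that)
    note slope = earthquake_slope[OF free neq wG gen_w m n vals det r(2) r(3) r(4) r(1), folded E[OF u']]
    show "((\<lambda>s. snd (E u s) / fst (E u s)) \<longlongrightarrow> - (m w1 / n w1)) at_top" if "n w1 \<noteq> 0"
      by (rule slope(1)) (rule that | assumption)+
    show "filterlim (\<lambda>s. snd (E u s) / fst (E u s)) at_bot at_top" if "n w1 = 0"
      by (rule slope(2)) (rule that | assumption)+
  qed
  have 1: "((\<lambda>s. ereal (snd (E u s) / fst (E u s))) \<longlongrightarrow> - (1 / slope \<alpha> \<beta> \<alpha>)) at_top"
    if "same_curve \<gamma> \<alpha>" "u \<in> {0<..} \<times> UNIV" for u
    using limits(2)[OF that(2) n_zero[OF that(1)]]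
    unfolding slope_\<alpha> tendsto_MInfty filterlim_at_bot_dense by simp
  have slope_\<gamma>: "1 / slope \<alpha> \<beta> \<gamma> = ereal (intersection_number \<gamma> \<beta> / intersection_number \<gamma> \<alpha>)"
    if "\<not> same_curve \<gamma> \<alpha>"
  proof -
    have "intersection_number \<gamma> \<alpha> \<noteq> 0" using n_nonzero[OF that] I\<gamma>(1) e0 D by simp
    then show ?thesis by (simp add: slope_def one_ereal_def)
  qed
  have 2: "((\<lambda>s. ereal (snd (E u s) / fst (E u s))) \<longlongrightarrow> 1 / slope \<alpha> \<beta> \<gamma>) at_top"
    if "\<not> same_curve \<gamma> \<alpha>" "u \<in> {0<..} \<times> UNIV" for u
  proof -
    have "intersection_number \<gamma> \<beta> / intersection_number \<gamma> \<alpha> = - (m w1 / n w1)"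
      using e0 D n_nonzero[OF that(1)] by (simp add: I\<gamma> field_simps)
    then show ?thesis
      using limits(1)[OF that(2) n_nonzero[OF that(1)]] unfolding slope_\<gamma>[OF that(1)] by simp
  qed
  show ?thesis using slope_\<alpha> 1 slope_\<gamma> 2 by blast
qed

end
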